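(* Let $G_0\subset PSL(2,\mathbf Z)$ be a subgroup of finite index and let $g\in G_0$ be hyperbolic, with repelling and attracting fixed points $\alpha_g^-,\alpha_g^+\in\mathbf P^1(\mathbf R)$. Let $\lambda(g)>0$ be the hyperbolic distance by which $g$ shifts points of the $g$-invariant geodesic from $\alpha_g^-$ to $\alpha_g^+$. Then the limiting modular symbol $\{\{*,\alpha_g^+\}\}_{G_0}$, computed along this geodesic, exists and equals $$\{\{*,\alpha_g^+\}\}_{G_0}=\frac{\{0,g(0)\}_{G_0}}{\lambda(g)}\in H_1(X_{G_0},\mathbf R).$$
   Context: $H$ is the upper half-plane, $\overline H=H\cup\mathbf P^1(\mathbf Q)$, $X_{G_0}=G_0\backslash\overline H$ is the compactified modular curve, and $\varphi:\overline H\to X_{G_0}$ is the projection. For $\alpha,\beta\in\overline H$ the modular symbol $\{\alpha,\beta\}_{G_0}\in H_1(X_{G_0},\mathbf R)$ is defined by $\int_{\{\alpha,\beta\}_{G_0}}\omega=\int_\alpha^\beta\varphi^*(\omega)$ for all holomorphic differentials $\omega$ on $X_{G_0}$, integrating along the geodesic from $\alpha$ to $\beta$ (real homology is identified with complex-linear functionals on holomorphic differentials). For real irrational $\beta$ and a geodesic in $H$ with endpoint $\beta$, $$\{\{*,\beta\}\}_{G_0}:=\lim\frac{1}{T(x,y)}\{x,y\}_{G_0},$$ where $x,y\in H$ lie on the geodesic, $x$ is arbitrary but fixed, $T(x,y)$ is the hyperbolic (geodesic) distance between them, and $y$ tends to $\beta$ along the geodesic. *)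

theory Defs
  imports "HOL-Analysis.Analysis" "HOL-Algebra.Coset"
begin

section \<open>The modular group and its action on the Riemann sphere\<close>

type_synonym mat2 = "int^2^2"

definition SL2Z :: "mat2 monoid" where
  "SL2Z = \<lparr>carrier = {A. det A = 1}, monoid.mult = (**), one = mat 1\<rparr>"

text \<open>Elements of \<open>PSL(2,Z)\<close> are the cosets \<open>{A, -A}\<close>.\<close>

definition PSL2Z :: "mat2 set monoid" where
  "PSL2Z = SL2Z Mod {mat 1, - mat 1}"

definition psl :: "mat2 \<Rightarrow> mat2 set" where
  "psl A = {A, - A}"

text \<open>The Riemann sphere is \<open>complex option\<close>, with \<open>None\<close> as the point at infinity; its
  topology is given by the neighbourhood filters.\<close>

definition sphere_nhds :: "complex option \<Rightarrow> complex option filter" where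
  "sphere_nhds p = (case p of
       None \<Rightarrow> sup (principal {None}) (filtermap Some at_infinity)
     | Some z \<Rightarrow> filtermap Some (nhds z))"

definition moebius :: "mat2 \<Rightarrow> complex option \<Rightarrow> complex option" where
  "moebius A p = (let a = of_int (A$1$1); b = of_int (A$1$2);
                      c = of_int (A$2$1); d = of_int (A$2$2)
    in case p of
         None \<Rightarrow> if c = 0 then None else Some (a / c)
       | Some z \<Rightarrow> if c * z + d = 0 then None else Some ((a * z + b) / (c * z + d)))"

definition psl_act :: "mat2 set \<Rightarrow> complex option \<Rightarrow> complex option" where
  "psl_act g p = the_elem ((\<lambda>A. moebius A p) ` g)"

definition upper_half_plane :: "complex set" where
  "upper_half_plane = {z. Im z > 0}"

definition P1R :: "complex option set" where
  "P1R = insert None (Some ` \<real>)"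

definition P1Q :: "complex option set" where
  "P1Q = insert None (Some ` \<rat>)"

definition extended_half_plane :: "complex option set" where
  "extended_half_plane = Some ` upper_half_plane \<union> P1Q"


section \<open>Hyperbolic elements and their fixed points\<close>

definition hyperbolic :: "mat2 set \<Rightarrow> bool" where
  "hyperbolic g \<longleftrightarrow> (\<forall>A\<in>g. \<bar>trace A\<bar> > 2)"

definition attracting_fixed_point :: "mat2 set \<Rightarrow> complex option \<Rightarrow> bool" where
  "attracting_fixed_point g p \<longleftrightarrow> psl_act g p = p \<and>
     (\<forall>\<^sub>F u in sphere_nhds p. filterlim (\<lambda>n. (psl_act g ^^ n) u) (sphere_nhds p) sequentially)"

definition repelling_fixed_point :: "mat2 set \<Rightarrow> complex option \<Rightarrow> bool" where
  "repelling_fixed_point g p \<longleftrightarrow> attracting_fixed_point (inv\<^bsub>PSL2Z\<^esub> g) p"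


section \<open>Hyperbolic geometry of the upper half-plane\<close>

definition hyp_dist :: "complex \<Rightarrow> complex \<Rightarrow> real" where
  "hyp_dist z w = arcosh (1 + (cmod (z - w))\<^sup>2 / (2 * Im z * Im w))"

text \<open>Complete oriented geodesics with unit-speed parametrisation: the images of
  \<open>t \<mapsto> \<i> e\<^sup>t\<close> under \<open>SL(2,R)\<close>.\<close>

definition geodesic :: "(real \<Rightarrow> complex) \<Rightarrow> bool" where
  "geodesic \<gamma> \<longleftrightarrow> (\<exists>a b c d :: real. a * d - b * c = 1 \<and>
     \<gamma> = (\<lambda>t. (of_real a * (\<i> * of_real (exp t)) + of_real b) /
               (of_real c * (\<i> * of_real (exp t)) + of_real d)))"

lemma geodesic_unit_speed:
  assumes "geodesic \<gamma>"
  shows "\<gamma> t \<in> upper_half_plane" and "hyp_dist (\<gamma> s) (\<gamma> t) = \<bar>s - t\<bar>"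
proof -
  obtain a b c d :: real where det: "a * d - b * c = 1"
    and \<gamma>: "\<And>t. \<gamma> t = (of_real a * (\<i> * of_real (exp t)) + of_real b) /
                       (of_real c * (\<i> * of_real (exp t)) + of_real d)"
    using assms unfolding geodesic_def by auto
  define q where "q t = of_real c * (\<i> * of_real (exp t)) + of_real d" for t
  define N where "N t = (c * exp t)\<^sup>2 + d\<^sup>2" for t
  have cd: "c \<noteq> 0 \<or> d \<noteq> 0"
    using det by auto
  have N: "N t > 0" for t
    using cd by (auto simp: N_def sum_power2_gt_zero_iff)
  have qN: "(cmod (q t))\<^sup>2 = N t" for t
    by (simp add: q_def N_def cmod_power2)
  have q0: "q t \<noteq> 0" for t
    using N[of t] qN[of t] by auto
  have im: "Im (\<gamma> t) = exp t / N t" for t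
  proof -
    have "Im (\<gamma> t) = (a * d - b * c) * exp t / N t"
      by (simp add: \<gamma> N_def Im_divide algebra_simps)
    then show ?thesis by (simp add: det)
  qed
  then show "\<gamma> t \<in> upper_half_plane"
    using N by (simp add: upper_half_plane_def)
  have "\<gamma> s - \<gamma> t = of_real (a * d - b * c) * \<i> * of_real (exp s - exp t) / (q s * q t)"
    using q0[of s] q0[of t] unfolding \<gamma> q_def by (simp add: divide_simps) (simp add: algebra_simps)
  then have "cmod (\<gamma> s - \<gamma> t) = \<bar>exp s - exp t\<bar> / (cmod (q s) * cmod (q t))"
    unfolding det by (simp only: norm_mult norm_divide norm_of_real) simp
  then have "(cmod (\<gamma> s - \<gamma> t))\<^sup>2 = (exp s - exp t)\<^sup>2 / (N s * N t)"
    by (simp add: power_divide power_mult_distrib qN)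
  then have "1 + (cmod (\<gamma> s - \<gamma> t))\<^sup>2 / (2 * Im (\<gamma> s) * Im (\<gamma> t)) =
             1 + (exp s - exp t)\<^sup>2 / (2 * exp s * exp t)"
    using N[of s] N[of t] by (simp add: im)
  also have "\<dots> = cosh (s - t)"
    by (simp add: cosh_def exp_minus exp_diff field_simps power2_eq_square)
  also have "\<dots> = cosh \<bar>s - t\<bar>"
    by simp
  finally show "hyp_dist (\<gamma> s) (\<gamma> t) = \<bar>s - t\<bar>"
    unfolding hyp_dist_def by (simp only: arcosh_cosh_real abs_ge_zero)
qed

text \<open>\<open>geodesic_point \<gamma> e p\<close>: \<open>p\<close> is the point of the closed geodesic at the extended parameter
  value \<open>e\<close>, the values \<open>\<plusminus>\<infinity>\<close> giving the endpoints on the boundary.\<close>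

definition geodesic_point :: "(real \<Rightarrow> complex) \<Rightarrow> ereal \<Rightarrow> complex option \<Rightarrow> bool" where
  "geodesic_point \<gamma> e p \<longleftrightarrow> (case e of
       ereal t \<Rightarrow> p = Some (\<gamma> t)
     | PInfty \<Rightarrow> filterlim (\<lambda>t. Some (\<gamma> t)) (sphere_nhds p) at_top
     | MInfty \<Rightarrow> filterlim (\<lambda>t. Some (\<gamma> t)) (sphere_nhds p) at_bot)"

text \<open>The integral of \<open>f(z) dz\<close> along the oriented geodesic from \<open>\<alpha>\<close> to \<open>\<beta>\<close>; it is improper at
  an endpoint on the boundary. The parametrisation is unique up to a translation.\<close>

definition geodesic_integral ::
    "(complex \<Rightarrow> complex) \<Rightarrow> complex option \<Rightarrow> complex option \<Rightarrow> complex" where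
  "geodesic_integral f \<alpha> \<beta> = (if \<alpha> = \<beta> then 0 else
     (let (\<gamma>, a, b) = (SOME (\<gamma>, a, b). geodesic \<gamma> \<and> a \<le> b \<and>
                         geodesic_point \<gamma> a \<alpha> \<and> geodesic_point \<gamma> b \<beta>)
      in LBINT t=a..b. f (\<gamma> t) * vector_derivative \<gamma> (at t)))"

text \<open>The distance by which \<open>g\<close> shifts the points of the \<open>g\<close>-invariant geodesic \<open>\<gamma>\<close>.\<close>

definition shift_length :: "mat2 set \<Rightarrow> (real \<Rightarrow> complex) \<Rightarrow> real" where
  "shift_length g \<gamma> = (THE l. \<forall>t. hyp_dist (\<gamma> t) (the (psl_act g (Some (\<gamma> t)))) = l)"


section \<open>Holomorphic differentials on a Riemann surface given by an atlas\<close>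

type_synonym 'x chart = "'x set \<times> ('x \<Rightarrow> complex)"

text \<open>A differential is the family of its coefficients: in the chart \<open>c\<close> with coordinate \<open>w\<close> it is
  \<open>\<omega> c w dw\<close>. The last condition only makes the representation unique.\<close>

definition holomorphic_differentials ::
    "'x chart set \<Rightarrow> ('x chart \<Rightarrow> complex \<Rightarrow> complex) set" where
  "holomorphic_differentials \<A> = {\<omega>.
     (\<forall>c\<in>\<A>. \<omega> c holomorphic_on (snd c ` fst c)) \<and>
     (\<forall>c\<in>\<A>. \<forall>d\<in>\<A>. \<forall>p\<in>fst c \<inter> fst d.
        \<omega> c (snd c p) =
        \<omega> d (snd d p) * deriv (\<lambda>w. snd d (inv_into (fst c) (snd c) w)) (snd c p)) \<and>
     (\<forall>c w. c \<notin> \<A> \<or> w \<notin> snd c ` fst c \<longrightarrow> \<omega> c w = 0)}"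

text \<open>The coefficient function of the pullback of \<open>\<omega>\<close> along a map \<open>f\<close> from a plane domain.\<close>

definition pullback ::
    "'x chart set \<Rightarrow> (complex \<Rightarrow> 'x) \<Rightarrow> ('x chart \<Rightarrow> complex \<Rightarrow> complex) \<Rightarrow> complex \<Rightarrow> complex" where
  "pullback \<A> f \<omega> z = (let c = (SOME c. c \<in> \<A> \<and> f z \<in> fst c)
     in \<omega> c (snd c (f z)) * deriv (\<lambda>w. snd c (f w)) z)"


section \<open>The compactified modular curve\<close>

type_synonym modular_point = "complex option set"

definition modular_proj :: "mat2 set set \<Rightarrow> complex option \<Rightarrow> modular_point" where
  "modular_proj G p = (\<lambda>g. psl_act g p) ` G"

definition modular_curve :: "mat2 set set \<Rightarrow> modular_point set" where
  "modular_curve G = modular_proj G ` extended_half_plane"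

definition stabilizer :: "mat2 set set \<Rightarrow> complex option \<Rightarrow> mat2 set set" where
  "stabilizer G p = {g \<in> G. psl_act g p = p}"

text \<open>Charts centred at the image of a point \<open>z\<^sub>0\<close> of the half-plane: on a hyperbolic disc around
  \<open>z\<^sub>0\<close> that meets only its translates under the stabilizer of \<open>z\<^sub>0\<close>, of order \<open>e\<close>, the local
  coordinate is the \<open>e\<close>-th power of \<open>(z - z\<^sub>0) / (z - cnj z\<^sub>0)\<close>.\<close>

definition interior_charts :: "mat2 set set \<Rightarrow> modular_point chart set" where
  "interior_charts G = {(U, \<psi>). \<exists>z\<^sub>0 r D.
     z\<^sub>0 \<in> upper_half_plane \<and> 0 < r \<and>
     D = {z \<in> upper_half_plane. cmod ((z - z\<^sub>0) / (z - cnj z\<^sub>0)) < r} \<and>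
     (\<forall>g\<in>G. psl_act g ` (Some ` D) \<inter> Some ` D \<noteq> {} \<longrightarrow> g \<in> stabilizer G (Some z\<^sub>0)) \<and>
     U = modular_proj G ` (Some ` D) \<and>
     (\<forall>z\<in>D. \<psi> (modular_proj G (Some z)) =
              ((z - z\<^sub>0) / (z - cnj z\<^sub>0)) ^ card (stabilizer G (Some z\<^sub>0)))}"

text \<open>The width of the cusp \<open>k(\<infinity>)\<close>, for \<open>k\<close> in \<open>PSL(2,Z)\<close>.\<close>

definition cusp_width :: "mat2 set set \<Rightarrow> mat2 set \<Rightarrow> nat" where
  "cusp_width G k = (LEAST h. 0 < h \<and>
     k \<otimes>\<^bsub>PSL2Z\<^esub> psl (vector [vector [1, int h], vector [0, 1]]) \<otimes>\<^bsub>PSL2Z\<^esub> inv\<^bsub>PSL2Z\<^esub> k \<in> G)"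

text \<open>Charts centred at the image of a cusp \<open>k(\<infinity>)\<close> of width \<open>h\<close>: the local coordinate is
  \<open>exp (2\<pi>\<i>z/h)\<close> with \<open>z\<close> in the horoball \<open>Im z > 1\<close>. Two points of this horoball that are
  equivalent under \<open>PSL(2,Z)\<close> differ by an integer translation.\<close>

definition cusp_charts :: "mat2 set set \<Rightarrow> modular_point chart set" where
  "cusp_charts G = {(U, \<psi>). \<exists>k\<in>carrier PSL2Z.
     U = modular_proj G ` psl_act k ` insert None (Some ` {z. Im z > 1}) \<and>
     \<psi> (modular_proj G (psl_act k None)) = 0 \<and>
     (\<forall>z. Im z > 1 \<longrightarrow> \<psi> (modular_proj G (psl_act k (Some z))) =
              exp (2 * of_real pi * \<i> * z / of_nat (cusp_width G k)))}"

definition modular_atlas :: "mat2 set set \<Rightarrow> modular_point chart set" where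
  "modular_atlas G = interior_charts G \<union> cusp_charts G"

type_synonym modular_differential = "modular_point chart \<Rightarrow> complex \<Rightarrow> complex"

definition modular_differentials :: "mat2 set set \<Rightarrow> modular_differential set" where
  "modular_differentials G = holomorphic_differentials (modular_atlas G)"


section \<open>Modular symbols\<close>

text \<open>\<open>H\<^sub>1(X\<^sub>G, R)\<close> is the space of complex-linear functionals on the holomorphic differentials
  (extended by \<open>0\<close> to the whole function type). Its topology is the pointwise one inherited from
  the function type, which is the usual one because the space is finite-dimensional.\<close>

definition real_homology :: "mat2 set set \<Rightarrow> (modular_differential \<Rightarrow> complex) set" where
  "real_homology G = {F.
     (\<forall>\<omega>\<in>modular_differentials G. \<forall>\<eta>\<in>modular_differentials G.
        F (\<lambda>c w. \<omega> c w + \<eta> c w) = F \<omega> + F \<eta>) \<and>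
     (\<forall>\<omega>\<in>modular_differentials G. \<forall>a. F (\<lambda>c w. a * \<omega> c w) = a * F \<omega>) \<and>
     (\<forall>\<omega>. \<omega> \<notin> modular_differentials G \<longrightarrow> F \<omega> = 0)}"

definition modular_symbol ::
    "mat2 set set \<Rightarrow> complex option \<Rightarrow> complex option \<Rightarrow> modular_differential \<Rightarrow> complex" where
  "modular_symbol G \<alpha> \<beta> = (\<lambda>\<omega>.
     if \<omega> \<in> modular_differentials G
     then geodesic_integral
            (pullback (modular_atlas G) (\<lambda>z. modular_proj G (Some z)) \<omega>) \<alpha> \<beta>
     else 0)"

text \<open>\<open>S\<close> is the limiting modular symbol \<open>{{*, \<beta>}}\<close> computed along the geodesic \<open>\<gamma>\<close>, whose end
  \<open>\<beta>\<close> is real and irrational. The base point \<open>\<gamma> s\<close> is arbitrary.\<close>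

definition has_limiting_modular_symbol ::
    "mat2 set set \<Rightarrow> (real \<Rightarrow> complex) \<Rightarrow> complex option \<Rightarrow>
     (modular_differential \<Rightarrow> complex) \<Rightarrow> bool" where
  "has_limiting_modular_symbol G \<gamma> \<beta> S \<longleftrightarrow>
     \<beta> \<in> P1R - P1Q \<and> geodesic \<gamma> \<and> geodesic_point \<gamma> \<infinity> \<beta> \<and> S \<in> real_homology G \<and>
     (\<forall>s. ((\<lambda>t \<omega>. modular_symbol G (Some (\<gamma> s)) (Some (\<gamma> t)) \<omega> /
                   of_real (hyp_dist (\<gamma> s) (\<gamma> t))) \<longlongrightarrow> S) at_top)"

end

theory Submission
  imports Defs "HOL-Complex_Analysis.Complex_Analysis"
begin

text \<open>
  Let \<open>F\<close> be a primitive on the upper half-plane of the pullback \<open>f(z) dz\<close> of a holomorphic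
  differential \<open>\<omega>\<close>. The pullback is invariant under \<open>G\<close>, so that \<open>F(g z) - F(z)\<close> is a constant \<open>P\<close>, the
  period of \<open>g\<close> (\<open>primitive_mob\<close>). A hyperbolic \<open>g\<close> translates its axis \<open>\<gamma>\<close> by \<open>\<lambda>(g)\<close>, that is,
  \<open>g(\<gamma>(t)) = \<gamma>(t + \<lambda>(g))\<close> (\<open>geodesic_translated\<close>, \<open>translation_length_pos\<close>). Hence
  \<open>F(\<gamma>(t + \<lambda>(g))) = F(\<gamma>(t)) + P\<close>, and \<open>F \<circ> \<gamma>\<close> grows linearly with slope \<open>P / \<lambda>(g)\<close>
  (\<open>quasi_periodic_slope\<close>). Since \<open>{\<gamma>(s), \<gamma>(t)}\<close> evaluates \<open>\<omega>\<close> to \<open>F(\<gamma>(t)) - F(\<gamma>(s))\<close> (\<open>symbol_interior\<close>)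
  and \<open>t - s\<close> is the hyperbolic distance, the limit exists and equals \<open>P / \<lambda>(g)\<close>.

  It remains to identify \<open>P\<close> with \<open>{0, g(0)}\<close> (\<open>symbol_period\<close>). In the coordinate \<open>q\<close> at a cusp the
  pullback is \<open>h(q) dq\<close> with \<open>h\<close> holomorphic at \<open>0\<close> (\<open>pullback_coeff_cusp\<close>). So \<open>F\<close> has limits at the cusps
  (\<open>primitive_cusp_limit\<close>), which \<open>g\<close> also shifts by \<open>P\<close>, and the improper integral along the geodesic
  from \<open>0\<close> to \<open>g(0)\<close> converges absolutely to their difference (\<open>symbol_cusps\<close>).

  The properties of the pullback rest on the charts of the modular curve. They exist around
  every point because \<open>SL(2,Z)\<close> acts properly discontinuously (\<open>discontinuous_action\<close>) and, at the cusps,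
  because \<open>G\<close> has finite index (\<open>exists_period\<close>). The pullback does not depend on the chart
  (\<open>pullback_coeff_eq\<close>); at elliptic points, where the projection is ramified, it vanishes in all charts.
  The limit point is irrational because \<open>t\<^sup>2 - 4\<close> is not a square for a trace \<open>t\<close> with \<open>|t| > 2\<close>
  (\<open>hyperbolic_fixed_irrational\<close>).
\<close>

section \<open>The action of the modular group\<close>

(* The symbol $ is reserved here for the components of vectors and matrices. *)
no_notation fps_nth (infixl "$" 75)

text \<open>The factor of automorphy \<open>cz + d\<close>.\<close>

definition aut :: "mat2 \<Rightarrow> complex \<Rightarrow> complex" where
  "aut A z = of_int (A$2$1) * z + of_int (A$2$2)"

text \<open>The action of a matrix on the half-plane, as a total function on \<open>\<complex>\<close>; it agrees with the
  action on the sphere wherever \<open>cz + d \<noteq> 0\<close>, in particular off the real axis.\<close>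

definition mob :: "mat2 \<Rightarrow> complex \<Rightarrow> complex" where
  "mob A z = (of_int (A$1$1) * z + of_int (A$1$2)) / aut A z"

text \<open>The adjugate, which inverts a matrix of determinant \<open>1\<close> without leaving the integers.\<close>

definition adj2 :: "mat2 \<Rightarrow> mat2" where
  "adj2 A = vector [vector [A$2$2, - (A$1$2)], vector [- (A$2$1), A$1$1]]"

lemma adj2_nth [simp]:
  "adj2 A$1$1 = A$2$2" "adj2 A$1$2 = - (A$1$2)" "adj2 A$2$1 = - (A$2$1)" "adj2 A$2$2 = A$1$1"
  by (simp_all add: adj2_def)

lemma mat2_eq_iff:
  "(A::mat2) = B \<longleftrightarrow> A$1$1 = B$1$1 \<and> A$1$2 = B$1$2 \<and> A$2$1 = B$2$1 \<and> A$2$2 = B$2$2"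
  by (auto simp: vec_eq_iff forall_2)

lemma mat2_mult_nth: "((A::mat2) ** B)$i$j = A$i$1 * B$1$j + A$i$2 * B$2$j"
  by (simp add: matrix_matrix_mult_def sum_2)

lemma mat2_one_nth [simp]:
  "(mat 1 :: mat2)$1$1 = 1" "(mat 1 :: mat2)$1$2 = 0" "(mat 1 :: mat2)$2$1 = 0" "(mat 1 :: mat2)$2$2 = 1"
  by (simp_all add: mat_def)

lemma det_adj2 [simp]: "det (adj2 A) = det A"
  by (simp add: det_2)

lemma det_uminus2 [simp]: "det (- (A::mat2)) = det A"
  by (simp add: det_2)

lemma mult_adj2: "det A = 1 \<Longrightarrow> A ** adj2 A = mat 1" "det A = 1 \<Longrightarrow> adj2 A ** A = mat 1"
  by (auto simp: mat2_eq_iff mat2_mult_nth det_2 algebra_simps)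

lemma mult_minus2: "(- (A::mat2)) ** B = - (A ** (B::mat2))" "(A::mat2) ** (- B) = - (A ** (B::mat2))"
  by (auto simp: mat2_eq_iff mat2_mult_nth)

lemma SL2Z_simps: "carrier SL2Z = {A. det A = 1}" "x \<otimes>\<^bsub>SL2Z\<^esub> y = x ** y" "\<one>\<^bsub>SL2Z\<^esub> = mat 1"
  by (simp_all add: SL2Z_def)

lemma group_SL2Z: "group SL2Z"
proof (rule groupI, goal_cases)
  case (5 x)
  then show ?case
    by (intro bexI[of _ "adj2 x"]) (simp_all add: SL2Z_simps mult_adj2)
qed (simp_all add: SL2Z_simps det_mul matrix_mul_assoc)

lemma subgroup_pm: "subgroup {mat 1, - mat 1 :: mat2} SL2Z"
proof -
  interpret group SL2Z by (rule group_SL2Z)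
  have "inv\<^bsub>SL2Z\<^esub> (- mat 1) = (- mat 1 :: mat2)"
    by (rule inv_equality) (simp_all add: SL2Z_simps mult_minus2)
  moreover have "inv\<^bsub>SL2Z\<^esub> (mat 1) = (mat 1 :: mat2)"
    using inv_one by (simp add: SL2Z_simps)
  ultimately show ?thesis
    by (intro subgroupI) (auto simp: SL2Z_simps mult_minus2)
qed

lemma normal_pm: "{mat 1, - mat 1 :: mat2} \<lhd> SL2Z"
proof -
  interpret group SL2Z by (rule group_SL2Z)
  show ?thesis
    by (rule normalI[OF subgroup_pm])
       (auto simp: SL2Z_simps r_coset_def l_coset_def mult_minus2)
qed

lemma group_PSL2Z: "group PSL2Z"
  unfolding PSL2Z_def by (rule normal.factorgroup_is_group[OF normal_pm])

lemma psl_eq_iff: "psl A = psl B \<longleftrightarrow> B = A \<or> B = - A"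
  by (auto simp: psl_def doubleton_eq_iff)

lemma psl_eq_r_coset: "psl A = {mat 1, - mat 1 :: mat2} #>\<^bsub>SL2Z\<^esub> A"
  by (auto simp: psl_def r_coset_def SL2Z_simps mult_minus2)

lemma carrier_PSL2Z: "carrier PSL2Z = psl ` {A. det A = 1}"
  by (auto simp: PSL2Z_def FactGroup_def RCOSETS_def SL2Z_simps psl_eq_r_coset)

lemma mult_PSL2Z: "psl A \<otimes>\<^bsub>PSL2Z\<^esub> psl B = psl (A ** B)"
  by (auto simp: PSL2Z_def FactGroup_def set_mult_def SL2Z_simps psl_def mult_minus2)

lemma one_PSL2Z: "\<one>\<^bsub>PSL2Z\<^esub> = psl (mat 1)"
  by (simp add: PSL2Z_def FactGroup_def psl_def)

lemma inv_PSL2Z: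
  assumes "det A = 1" shows "inv\<^bsub>PSL2Z\<^esub> (psl A) = psl (adj2 A)"
proof -
  interpret group PSL2Z by (rule group_PSL2Z)
  show ?thesis
    by (rule inv_equality) (use assms in \<open>auto simp: mult_PSL2Z one_PSL2Z mult_adj2 carrier_PSL2Z\<close>)
qed

text \<open>The point of the Riemann sphere with homogeneous coordinates \<open>(x : y)\<close>.\<close>

definition hom_pt :: "complex \<Rightarrow> complex \<Rightarrow> complex option" where
  "hom_pt x y = (if y = 0 then None else Some (x / y))"

lemma hom_pt_cases: obtains x y where "p = hom_pt x y" "x \<noteq> 0 \<or> y \<noteq> 0"
  using that[of 1 0] that[of "the p" 1] by (cases p) (auto simp: hom_pt_def)

lemma hom_pt_eq_iff:
  assumes "x \<noteq> 0 \<or> y \<noteq> 0" "x' \<noteq> 0 \<or> y' \<noteq> 0"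
  shows "hom_pt x y = hom_pt x' y' \<longleftrightarrow> x * y' = x' * y"
  using assms by (auto simp: hom_pt_def field_simps)

lemma of_int_det2: "det (A :: mat2) = 1 \<Longrightarrow>
   of_int (A$1$1) * of_int (A$2$2) - of_int (A$1$2) * of_int (A$2$1) = (1::'a::ring_1)"
  by (drule arg_cong[where f="of_int :: int \<Rightarrow> 'a"]) (simp add: det_2)

text \<open>In homogeneous coordinates the action is linear, so that it needs no case distinction at
  \<open>\<infinity>\<close>.\<close>

lemma moebius_hom_pt:
  assumes "x \<noteq> 0 \<or> y \<noteq> 0"
  shows "moebius A (hom_pt x y) =
    hom_pt (of_int (A$1$1) * x + of_int (A$1$2) * y) (of_int (A$2$1) * x + of_int (A$2$2) * y)"
proof (cases "y = 0")
  case True then show ?thesis using assms by (auto simp: moebius_def hom_pt_def)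
next
  case False
  then have "of_int (A$2$1) * (x / y) + of_int (A$2$2) = (of_int (A$2$1) * x + of_int (A$2$2) * y) / y"
   "of_int (A$1$1) * (x / y) + of_int (A$1$2) = (of_int (A$1$1) * x + of_int (A$1$2) * y) / y"
    by (simp_all add: field_simps)
  with False show ?thesis by (simp add: moebius_def hom_pt_def)
qed

lemma hom_coord_nonzero:
  assumes "det (A :: mat2) = 1" "x \<noteq> 0 \<or> y \<noteq> (0::complex)"
  shows "of_int (A$1$1) * x + of_int (A$1$2) * y \<noteq> 0 \<or> of_int (A$2$1) * x + of_int (A$2$2) * y \<noteq> 0"
proof (rule ccontr)
  define a b c d :: complex where "a = of_int (A$1$1)" "b = of_int (A$1$2)" "c = of_int (A$2$1)" "d = of_int (A$2$2)"
  note ab = this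
  have d: "a * d - b * c = 1" unfolding ab by (rule of_int_det2[OF assms(1)])
  assume "\<not> ?thesis"
  then have 1: "a * x + b * y = 0" "c * x + d * y = 0" unfolding ab by auto
  have "x = (a * d - b * c) * x" "y = (a * d - b * c) * y" using d by simp_all
  then have "x = d * (a * x + b * y) - b * (c * x + d * y)" "y = a * (c * x + d * y) - c * (a * x + b * y)"
    by (simp_all add: algebra_simps)
  then show False using 1 assms(2) by simp
qed

lemma moebius_mult:
  assumes "det A = 1" "det B = 1"
  shows "moebius (A ** B) p = moebius A (moebius B p)"
proof -
  obtain x y where p: "p = hom_pt x y" and xy: "x \<noteq> 0 \<or> y \<noteq> 0" by (rule hom_pt_cases)
  show ?thesis
    unfolding p moebius_hom_pt[OF xy] moebius_hom_pt[OF hom_coord_nonzero[OF assms(2) xy]]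
    by (simp add: mat2_mult_nth algebra_simps)
qed

lemma moebius_one [simp]: "moebius (mat 1) p = p"
  by (cases p) (auto simp: moebius_def)

lemma minus_linear_fraction:
  "- (c * z) - d = 0 \<longleftrightarrow> c * z + d = (0::complex)"
  "(- (a * z) - b) / (- (c * z) - d) = (a * z + b) / (c * z + (d::complex))"
proof -
  have *: "- (a * z) - b = - (a * z + b)" for a b :: complex by simp
  show "- (c * z) - d = 0 \<longleftrightarrow> c * z + d = 0" unfolding * neg_equal_0_iff_equal ..
  show "(- (a * z) - b) / (- (c * z) - d) = (a * z + b) / (c * z + d)"
    unfolding * minus_divide_divide ..
qed

lemma moebius_uminus [simp]: "moebius (- A) p = moebius A p"
  by (cases p) (simp_all add: moebius_def Let_def minus_linear_fraction neg_eq_iff_add_eq_0)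

lemma moebius_adj2 [simp]:
  "det A = 1 \<Longrightarrow> moebius (adj2 A) (moebius A p) = p"
  "det A = 1 \<Longrightarrow> moebius A (moebius (adj2 A) p) = p"
  by (simp_all add: moebius_mult[symmetric] mult_adj2)

lemma psl_act_psl [simp]: "psl_act (psl A) p = moebius A p"
  by (simp add: psl_act_def psl_def)

subsection \<open>The upper half-plane\<close>

lemma H_iff [simp]: "z \<in> upper_half_plane \<longleftrightarrow> Im z > 0"
  by (simp add: upper_half_plane_def)

lemma open_H: "open upper_half_plane" and convex_H: "convex upper_half_plane"
  by (simp_all add: upper_half_plane_def open_halfspace_Im_gt convex_halfspace_Im_gt)

lemma aut_nonzero:
  assumes "det A = 1" "Im z \<noteq> 0" shows "aut A z \<noteq> 0"
proof
  assume 0: "aut A z = 0"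
  from arg_cong[OF this, of Im] have "A$2$1 = 0" using assms by (simp add: aut_def)
  moreover from this 0 have "A$2$2 = 0" by (simp add: aut_def)
  ultimately show False using assms by (simp add: det_2)
qed

lemma moebius_Some: "det A = 1 \<Longrightarrow> Im z \<noteq> 0 \<Longrightarrow> moebius A (Some z) = Some (mob A z)"
  using aut_nonzero[of A z] by (simp add: moebius_def mob_def aut_def Let_def)

lemma Im_mob:
  assumes "det A = 1" "Im z \<noteq> 0" shows "Im (mob A z) = Im z / (cmod (aut A z))\<^sup>2"
proof -
  have "Im (mob A z) = Im z * (real_of_int (A$1$1) * real_of_int (A$2$2) - real_of_int (A$1$2) * real_of_int (A$2$1)) / (cmod (aut A z))\<^sup>2"
    by (simp add: mob_def aut_def Im_divide cmod_power2 algebra_simps)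
  then show ?thesis by (simp only: of_int_det2[OF assms(1)])
qed

lemma mob_in_H [simp]: "det A = 1 \<Longrightarrow> Im z > 0 \<Longrightarrow> Im (mob A z) > 0"
  using aut_nonzero[of A z] by (simp add: Im_mob)

lemma mob_mult:
  assumes "det A = 1" "det B = 1" "Im z > 0"
  shows "mob (A ** B) z = mob A (mob B z)"
proof -
  have AB: "det (A ** B) = 1" using assms by (simp add: det_mul)
  have "Im z \<noteq> 0" "Im (mob B z) \<noteq> 0" using mob_in_H[OF assms(2,3)] assms(3) by linarith+
  then have "Some (mob (A ** B) z) = Some (mob A (mob B z))"
    using moebius_mult[OF assms(1,2), of "Some z"]
    unfolding moebius_Some[OF AB \<open>Im z \<noteq> 0\<close>] moebius_Some[OF assms(2) \<open>Im z \<noteq> 0\<close>]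
      moebius_Some[OF assms(1) \<open>Im (mob B z) \<noteq> 0\<close>] by blast
  then show ?thesis by blast
qed

lemma mob_one [simp]: "mob (mat 1) z = z" by (simp add: mob_def aut_def)
lemma mob_adj2 [simp]:
  "det A = 1 \<Longrightarrow> Im z > 0 \<Longrightarrow> mob (adj2 A) (mob A z) = z"
  "det A = 1 \<Longrightarrow> Im z > 0 \<Longrightarrow> mob A (mob (adj2 A) z) = z"
  by (simp_all add: mob_mult[symmetric] mult_adj2)

lemma aut_mult:
  assumes "det B = 1" "Im z > 0" shows "aut (A ** B) z = aut A (mob B z) * aut B z"
  using aut_nonzero[of B z] assms by (simp add: mob_def aut_def mat2_mult_nth field_simps)

lemma mob_diff:
  assumes "aut A z \<noteq> 0" "aut A w \<noteq> 0" "det A = 1"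
  shows "mob A z - mob A w = (z - w) / (aut A z * aut A w)"
proof -
  have "mob A z - mob A w = (of_int (A$1$1) * of_int (A$2$2) - of_int (A$1$2) * of_int (A$2$1)) * (z - w) / (aut A z * aut A w)"
    using assms(1,2) unfolding mob_def by (simp add: divide_simps) (simp add: aut_def algebra_simps)
  then show ?thesis by (simp only: of_int_det2[OF assms(3)]) simp
qed

lemma mob_has_field_derivative:
  assumes "det A = 1" "Im z \<noteq> 0"
  shows "(mob A has_field_derivative 1 / (aut A z)\<^sup>2) (at z)"
proof -
  have nz: "of_int (A$2$1) * z + of_int (A$2$2) \<noteq> 0" using aut_nonzero[OF assms] by (simp add: aut_def)
  have "((\<lambda>z. (of_int (A$1$1) * z + of_int (A$1$2)) / (of_int (A$2$1) * z + of_int (A$2$2))) has_field_derivative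
     (of_int (A$1$1) * (of_int (A$2$1) * z + of_int (A$2$2)) - (of_int (A$1$1) * z + of_int (A$1$2)) * of_int (A$2$1)) /
       ((of_int (A$2$1) * z + of_int (A$2$2)) * (of_int (A$2$1) * z + of_int (A$2$2)))) (at z)"
    by (rule derivative_eq_intros refl | (use nz in simp))+
  moreover have "of_int (A$1$1) * (of_int (A$2$1) * z + of_int (A$2$2)) - (of_int (A$1$1) * z + of_int (A$1$2)) * of_int (A$2$1) = (1::complex)"
    using of_int_det2[OF assms(1), where 'a=complex] by (simp add: algebra_simps)
  moreover have "mob A = (\<lambda>z. (of_int (A$1$1) * z + of_int (A$1$2)) / (of_int (A$2$1) * z + of_int (A$2$2)))"
    by (simp add: fun_eq_iff mob_def aut_def)
  ultimately show ?thesis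
    by (simp add: aut_def power2_eq_square)
qed

lemma mob_holomorphic: "det A = 1 \<Longrightarrow> mob A holomorphic_on upper_half_plane"
  unfolding holomorphic_on_open[OF open_H]
  by (intro ballI exI, rule mob_has_field_derivative) auto

section \<open>Subgroups and orbits\<close>

text \<open>The preimage of a subgroup of \<open>PSL(2,Z)\<close> in \<open>SL(2,Z)\<close>. Working with this set of matrices
  avoids choosing representatives of the cosets \<open>{A, -A}\<close>.\<close>

definition lift_SL :: "mat2 set set \<Rightarrow> mat2 set" where
  "lift_SL G = {A. det A = 1 \<and> psl A \<in> G}"

locale PSL2Z_subgroup =
  fixes G :: "mat2 set set"
  assumes subgroup_G: "subgroup G PSL2Z"
begin

abbreviation proj :: "complex \<Rightarrow> modular_point" where
  "proj z \<equiv> modular_proj G (Some z)"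

lemma lift_one: "mat 1 \<in> lift_SL G"
  using subgroup.one_closed[OF subgroup_G] by (simp add: lift_SL_def one_PSL2Z)

lemma lift_mult: "A \<in> lift_SL G \<Longrightarrow> B \<in> lift_SL G \<Longrightarrow> A ** B \<in> lift_SL G"
  using subgroup.m_closed[OF subgroup_G, of "psl A" "psl B"] by (simp add: lift_SL_def mult_PSL2Z det_mul)

lemma lift_adj2: "A \<in> lift_SL G \<Longrightarrow> adj2 A \<in> lift_SL G"
  using subgroup.m_inv_closed[OF subgroup_G, of "psl A"] by (simp add: lift_SL_def inv_PSL2Z)

lemma psl_uminus: "psl (- A) = psl A"
  by (auto simp: psl_def)

lemma lift_uminus: "A \<in> lift_SL G \<Longrightarrow> - A \<in> lift_SL G"
  by (simp add: lift_SL_def psl_uminus)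

lemma G_eq: "G = psl ` lift_SL G"
  using subgroup.subset[OF subgroup_G] by (auto simp: lift_SL_def carrier_PSL2Z)

lemma lift_det [simp]: "A \<in> lift_SL G \<Longrightarrow> det A = 1"
  by (simp add: lift_SL_def)

lemma modular_proj_eq: "modular_proj G p = (\<lambda>A. moebius A p) ` lift_SL G"
  unfolding modular_proj_def by (subst G_eq) (simp add: image_image)

lemma modular_proj_moebius:
  assumes "A \<in> lift_SL G" shows "modular_proj G (moebius A p) = modular_proj G p"
proof -
  have "moebius B p \<in> (\<lambda>B. moebius B (moebius A p)) ` lift_SL G" if "B \<in> lift_SL G" for B
    by (rule image_eqI[of _ _ "B ** adj2 A"])
       (use that assms in \<open>simp_all add: moebius_mult lift_mult lift_adj2\<close>)
  moreover have "moebius B (moebius A p) \<in> (\<lambda>B. moebius B p) ` lift_SL G" if "B \<in> lift_SL G" for B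
    by (rule image_eqI[of _ _ "B ** A"])
       (use that assms in \<open>simp_all add: moebius_mult lift_mult\<close>)
  ultimately show ?thesis unfolding modular_proj_eq by blast
qed

lemma modular_proj_eq_iff:
  "modular_proj G p = modular_proj G q \<longleftrightarrow> (\<exists>A\<in>lift_SL G. q = moebius A p)"
proof
  assume "modular_proj G p = modular_proj G q"
  moreover have "q \<in> modular_proj G q" unfolding modular_proj_eq
    using lift_one by (intro image_eqI[of _ _ "mat 1"]) auto
  ultimately show "\<exists>A\<in>lift_SL G. q = moebius A p" by (auto simp: modular_proj_eq)
qed (auto simp: modular_proj_moebius)

lemma proj_mob: "A \<in> lift_SL G \<Longrightarrow> Im z > 0 \<Longrightarrow> proj (mob A z) = proj z"
  using modular_proj_moebius[of A "Some z"] by (simp add: moebius_Some)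

lemma proj_eqE:
  assumes "proj z = proj w" "Im z > 0"
  obtains A where "A \<in> lift_SL G" "w = mob A z"
  using assms that by (auto simp: modular_proj_eq_iff moebius_Some)

end

section \<open>Proper discontinuity and stabilizers\<close>

text \<open>The Cayley transform centred at \<open>z0\<close>; it maps the half-plane onto the unit disc and \<open>z0\<close> to
  \<open>0\<close>.\<close>

definition cayley :: "complex \<Rightarrow> complex \<Rightarrow> complex" where
  "cayley z0 z = (z - z0) / (z - cnj z0)"

text \<open>The hyperbolic discs on which the charts at interior points live.\<close>

definition hyp_disc :: "complex \<Rightarrow> real \<Rightarrow> complex set" where
  "hyp_disc z0 r = {z \<in> upper_half_plane. cmod (cayley z0 z) < r}"

lemma diff_cnj_nonzero: "Im z0 > 0 \<Longrightarrow> Im z > 0 \<Longrightarrow> z - cnj z0 \<noteq> 0"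
  by (auto simp: complex_eq_iff)

lemma cayley_has_field_derivative:
  assumes "Im z0 > 0" "Im z > 0"
  shows "(cayley z0 has_field_derivative (z0 - cnj z0) / (z - cnj z0)\<^sup>2) (at z)"
proof -
  note nz = diff_cnj_nonzero[OF assms]
  have "((\<lambda>z. (z - z0) / (z - cnj z0)) has_field_derivative
     ((1 - 0) * (z - cnj z0) - (z - z0) * (1 - 0)) / ((z - cnj z0) * (z - cnj z0))) (at z)"
    by (rule derivative_eq_intros refl | (use nz in simp))+
  then show ?thesis by (simp add: power2_eq_square cayley_def[abs_def])
qed

lemma cayley_inj:
  assumes "Im z0 > 0" "Im z > 0" "Im w > 0" "cayley z0 z = cayley z0 w"
  shows "z = w"
proof -
  have "(z - z0) * (w - cnj z0) = (w - z0) * (z - cnj z0)"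
    using assms diff_cnj_nonzero[of z0] by (simp add: cayley_def frac_eq_eq)
  then have "(z - w) * (z0 - cnj z0) = 0" by (simp add: algebra_simps)
  moreover have "z0 - cnj z0 \<noteq> 0" using assms by (auto simp: complex_eq_iff)
  ultimately show ?thesis by simp
qed

lemma cayley_self [simp]: "cayley z0 z0 = 0" by (simp add: cayley_def)

lemma cayley_eq_0_iff: "Im z0 > 0 \<Longrightarrow> Im z > 0 \<Longrightarrow> cayley z0 z = 0 \<longleftrightarrow> z = z0"
  using diff_cnj_nonzero[of z0 z] by (auto simp: cayley_def)

lemma cayley_holomorphic: "Im z0 > 0 \<Longrightarrow> cayley z0 holomorphic_on upper_half_plane"
  unfolding holomorphic_on_open[OF open_H]
  by (intro ballI exI, rule cayley_has_field_derivative) auto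

lemma open_hyp_disc: 
  assumes "Im z0 > 0" shows "open (hyp_disc z0 r)"
proof -
  have "continuous_on upper_half_plane (\<lambda>z. cmod (cayley z0 z))"
    by (intro continuous_on_norm holomorphic_on_imp_continuous_on cayley_holomorphic assms)
  then have "open ((\<lambda>z. cmod (cayley z0 z)) -` {..<r} \<inter> upper_half_plane)"
    using continuous_on_open_vimage[OF open_H] open_lessThan by blast
  moreover have "(\<lambda>z. cmod (cayley z0 z)) -` {..<r} \<inter> upper_half_plane = hyp_disc z0 r" by (auto simp: hyp_disc_def)
  ultimately show ?thesis by simp
qed

lemma hyp_disc_subset_ball:
  assumes "Im z0 > 0" "r \<le> 1/2" "z \<in> hyp_disc z0 r"
  shows "dist z0 z < 4 * r * Im z0"
proof -
  have Imz: "Im z > 0" using assms by (auto simp: hyp_disc_def)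
  have r: "r > 0" using assms(3) by (auto simp: hyp_disc_def intro: le_less_trans[OF norm_ge_zero])
  have pos: "cmod (z - cnj z0) > 0" using diff_cnj_nonzero[OF assms(1) Imz] by simp
  have "cmod (z - z0) < r * cmod (z - cnj z0)"
    using assms(3) pos by (simp add: hyp_disc_def cayley_def norm_divide pos_divide_less_eq)
  also have "cmod (z - cnj z0) \<le> cmod (z - z0) + cmod (z0 - cnj z0)"
    using norm_triangle_ineq[of "z - z0" "z0 - cnj z0"] by simp
  also have "cmod (z0 - cnj z0) = 2 * Im z0"
    using assms(1) by (simp add: complex_diff_cnj norm_mult)
  finally have "cmod (z - z0) < r * (cmod (z - z0) + 2 * Im z0)" using r by simp
  moreover have "r * cmod (z - z0) \<le> 1/2 * cmod (z - z0)" by (rule mult_right_mono[OF assms(2)]) simp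
  ultimately have "cmod (z - z0) < 4 * r * Im z0" by (simp add: algebra_simps)
  then show ?thesis by (simp add: dist_norm norm_minus_commute)
qed

lemma finite_bounded_mat2: "finite {A::mat2. \<forall>i j. \<bar>A$i$j\<bar> \<le> k}"
proof (rule finite_subset)
  let ?f = "\<lambda>(a,b,c,d). vector [vector [a, b], vector [c, d]] :: mat2"
  show "finite (?f ` ({-k..k} \<times> {-k..k} \<times> {-k..k} \<times> {-k..k}))" by simp
  have "A \<in> ?f ` ({-k..k} \<times> {-k..k} \<times> {-k..k} \<times> {-k..k})" if "\<forall>i j. \<bar>A$i$j\<bar> \<le> k" for A
    by (rule image_eqI[of _ _ "(A$1$1, A$1$2, A$2$1, A$2$2)"])
       (use that in \<open>auto simp: mat2_eq_iff abs_le_iff forall_2\<close>)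
  then show "{A::mat2. \<forall>i j. \<bar>A$i$j\<bar> \<le> k} \<subseteq> ?f ` ({-k..k} \<times> {-k..k} \<times> {-k..k} \<times> {-k..k})" by blast
qed

lemma linear_coeff_bound:
  fixes a b :: int and z :: complex
  assumes "cmod (of_int a * z + of_int b) \<le> B" "0 < m" "m \<le> Im z" "cmod z \<le> R"
  shows "\<bar>real_of_int a\<bar> \<le> B / m \<and> \<bar>real_of_int b\<bar> \<le> B + B / m * R"
proof
  have "\<bar>real_of_int a\<bar> * m \<le> \<bar>real_of_int a\<bar> * Im z" by (rule mult_left_mono) (use assms in auto)
  also have "\<dots> = \<bar>Im (of_int a * z + of_int b)\<bar>" using assms by (simp add: abs_mult)
  also have "\<dots> \<le> B" using abs_Im_le_cmod assms(1) by (rule order_trans)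
  finally show a: "\<bar>real_of_int a\<bar> \<le> B / m" using assms(2) by (simp add: pos_le_divide_eq)
  have "\<bar>real_of_int b\<bar> = cmod ((of_int a * z + of_int b) - of_int a * z)" by simp
  also have "\<dots> \<le> cmod (of_int a * z + of_int b) + cmod (of_int a * z)" by (rule norm_triangle_ineq4)
  also have "\<dots> \<le> B + B / m * R"
    unfolding norm_mult using assms a by (intro add_mono mult_mono) (auto intro: order_trans[OF abs_ge_zero])
  finally show "\<bar>real_of_int b\<bar> \<le> B + B / m * R" .
qed

text \<open>Only finitely many elements of \<open>SL(2,Z)\<close> move some point of a compact part of the half-plane
  to another such point: \<open>Im (A z) = Im z / |cz + d|\<^sup>2\<close> bounds \<open>cz + d\<close>, hence also \<open>az + b\<close>, and
  these bound the entries.\<close>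

lemma finite_SL_meeting:
  fixes m R :: real
  assumes "m > 0"
  defines "P \<equiv> \<lambda>z. m \<le> Im z \<and> cmod z \<le> R"
  shows "finite {A::mat2. det A = 1 \<and> (\<exists>z. P z \<and> P (mob A z))}"
proof -
  define s where "s = sqrt (R / m)"
  define k where "k = \<lceil>max (max (s / m) (s + s / m * R)) (max (R * s / m) (R * s + R * s / m * R))\<rceil>"
  have "\<bar>A$i$j\<bar> \<le> k" if A: "det A = 1" and z: "P z" "P (mob A z)" for A z i j
  proof -
    have Imz: "Im z > 0" "Im (mob A z) > 0" using z assms by (auto simp: P_def)
    have nz: "aut A z \<noteq> 0" using aut_nonzero[OF A] Imz by simp
    have R0: "R \<ge> 0" using z by (auto simp: P_def intro: order_trans[OF norm_ge_zero])
    have "(cmod (aut A z))\<^sup>2 = Im z / Im (mob A z)"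
      using Im_mob[OF A, of z] Imz nz by (simp add: field_simps)
    also have "\<dots> \<le> R / m"
      using z assms(1) R0 abs_Im_le_cmod[of z] by (intro frac_le) (auto simp: P_def)
    finally have aut: "cmod (aut A z) \<le> s" unfolding s_def by (rule real_le_rsqrt)
    have "of_int (A$1$1) * z + of_int (A$1$2) = mob A z * aut A z" using nz by (simp add: mob_def)
    then have num: "cmod (of_int (A$1$1) * z + of_int (A$1$2)) \<le> R * s"
      using z aut R0 by (auto simp: norm_mult P_def intro!: mult_mono)
    have 1: "\<bar>real_of_int (A$2$1)\<bar> \<le> s / m \<and> \<bar>real_of_int (A$2$2)\<bar> \<le> s + s / m * R"
      using aut z assms(1) by (intro linear_coeff_bound[of _ z]) (auto simp: P_def aut_def)
    have 2: "\<bar>real_of_int (A$1$1)\<bar> \<le> R * s / m \<and> \<bar>real_of_int (A$1$2)\<bar> \<le> R * s + R * s / m * R"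
      using num z assms(1) by (intro linear_coeff_bound[of _ z]) (auto simp: P_def)
    have "\<bar>real_of_int (A$i$j)\<bar> \<le> max (max (s / m) (s + s / m * R)) (max (R * s / m) (R * s + R * s / m * R))"
      using 1 2 exhaust_2[of i] exhaust_2[of j] by (auto simp: le_max_iff_disj)
    then have "\<bar>real_of_int (A$i$j)\<bar> \<le> real_of_int k" unfolding k_def using le_of_int_ceiling order_trans by blast
    then show ?thesis by linarith
  qed
  then show ?thesis by (intro finite_subset[OF _ finite_bounded_mat2[of k]]) blast
qed

lemma finite_SL_meeting_ball:
  assumes "Im z0 > 0"
  shows "finite {A::mat2. det A = 1 \<and> (\<exists>z\<in>ball z0 (Im z0 / 2). mob A z \<in> ball z0 (Im z0 / 2))}"
proof -
  have "Im z0 / 2 \<le> Im z \<and> cmod z \<le> cmod z0 + Im z0 / 2" if "z \<in> ball z0 (Im z0 / 2)" for z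
  proof -
    have d: "cmod (z0 - z) < Im z0 / 2" using that by (simp add: dist_norm)
    then have "Im z0 - Im z < Im z0 / 2" using abs_Im_le_cmod[of "z0 - z"] by simp
    moreover have "cmod z \<le> cmod z0 + cmod (z0 - z)" using norm_triangle_ineq4[of z0 "z0 - z"] by simp
    ultimately show ?thesis using d by simp
  qed
  then show ?thesis
    by (intro finite_subset[OF _ finite_SL_meeting[of "Im z0 / 2" "cmod z0 + Im z0 / 2"]]) (use assms in blast, simp add: assms)
qed

lemma finite_SL_fixing:
  assumes "Im z0 > 0" shows "finite {A::mat2. det A = 1 \<and> mob A z0 = z0}"
  by (rule finite_subset[OF _ finite_SL_meeting_ball[OF assms]])
     (use assms in \<open>auto intro!: bexI[of _ z0]\<close>)

text \<open>A small disc around \<open>z0\<close> meets only its translates under the stabilizer of \<open>z0\<close>: each of the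
  finitely many other candidates moves \<open>z0\<close>, and is excluded by shrinking the disc.\<close>

lemma discontinuous_action:
  assumes "Im z0 > 0"
  obtains r where "r > 0"
    "\<And>A z. det A = 1 \<Longrightarrow> z \<in> hyp_disc z0 r \<Longrightarrow> mob A z \<in> hyp_disc z0 r \<Longrightarrow> mob A z0 = z0"
proof -
  have *: "\<exists>e>0. \<forall>A\<in>T. \<forall>z\<in>ball z0 e. mob A z \<notin> ball z0 e"
    if "finite T" "\<forall>A\<in>T. det A = 1 \<and> mob A z0 \<noteq> z0" for T
    using that
  proof (induction T rule: finite_induct)
    case empty show ?case by (auto intro: exI[of _ 1])
  next
    case (insert A T)
    then obtain e where e: "e > 0" "\<forall>A\<in>T. \<forall>z\<in>ball z0 e. mob A z \<notin> ball z0 e" by auto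
    define \<delta> where "\<delta> = dist (mob A z0) z0 / 2"
    have \<delta>: "\<delta> > 0" using insert by (simp add: \<delta>_def)
    have "isCont (mob A) z0" using mob_has_field_derivative[of A z0] insert assms DERIV_isCont by auto
    then obtain e1 where e1: "e1 > 0" "\<And>z. dist z z0 < e1 \<Longrightarrow> dist (mob A z) (mob A z0) < \<delta>"
      using \<delta> unfolding continuous_at_eps_delta by blast
    have "mob A z \<notin> ball z0 (min e (min e1 \<delta>))" if "z \<in> ball z0 (min e (min e1 \<delta>))" for z
    proof
      assume "mob A z \<in> ball z0 (min e (min e1 \<delta>))"
      then have "dist z0 (mob A z) < \<delta>" by simp
      moreover have "dist (mob A z) (mob A z0) < \<delta>" using e1(2)[of z] that by (simp add: dist_commute)
      ultimately have "dist z0 (mob A z0) < 2 * \<delta>" 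
        using dist_triangle[of z0 "mob A z0" "mob A z"] by linarith
      then show False by (simp add: \<delta>_def dist_commute)
    qed
    moreover have "ball z0 (min e (min e1 \<delta>)) \<subseteq> ball z0 e" by (rule subset_ball) simp
    then have "\<forall>B\<in>T. \<forall>z\<in>ball z0 (min e (min e1 \<delta>)). mob B z \<notin> ball z0 (min e (min e1 \<delta>))"
      using e(2) by blast
    moreover have "min e (min e1 \<delta>) > 0" using e(1) e1(1) \<delta> by simp
    ultimately show ?case by blast
  qed
  define S where "S = {A::mat2. det A = 1 \<and> (\<exists>z\<in>ball z0 (Im z0 / 2). mob A z \<in> ball z0 (Im z0 / 2))}"
  have "finite (S - {A. mob A z0 = z0})" using finite_SL_meeting_ball[OF assms] by (auto simp: S_def)
  moreover have "\<forall>A\<in>S - {A. mob A z0 = z0}. det A = 1 \<and> mob A z0 \<noteq> z0" by (simp add: S_def)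
  ultimately have "\<exists>e>0. \<forall>A\<in>S - {A. mob A z0 = z0}. \<forall>z\<in>ball z0 e. mob A z \<notin> ball z0 e" by (rule *)
  then obtain e where e: "e > 0" "\<And>A z. A \<in> S \<Longrightarrow> mob A z0 \<noteq> z0 \<Longrightarrow> z \<in> ball z0 e \<Longrightarrow> mob A z \<notin> ball z0 e"
    by blast
  \<comment> \<open>a disc of parameter \<open>r\<close> lies in the ball of radius \<open>4 r Im z0\<close>, by \<open>hyp_disc_subset_ball\<close>\<close>
  define r where "r = min (1/8) (e / (4 * Im z0))"
  have r: "r > 0" "r \<le> 1/2" "4 * r * Im z0 \<le> e" "4 * r * Im z0 \<le> Im z0 / 2"
    using e(1) assms by (auto simp: r_def min_def field_simps)
  have sub: "hyp_disc z0 r \<subseteq> ball z0 e" "hyp_disc z0 r \<subseteq> ball z0 (Im z0 / 2)"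
    using hyp_disc_subset_ball[OF assms r(2)] r(3,4) by fastforce+
  show ?thesis
  proof (rule that[OF r(1)])
    fix A z assume A: "det A = 1" "z \<in> hyp_disc z0 r" "mob A z \<in> hyp_disc z0 r"
    then have "A \<in> S" unfolding S_def using sub(2) by blast
    moreover have "z \<in> ball z0 e" "mob A z \<in> ball z0 e" using sub(1) A by blast+
    ultimately show "mob A z0 = z0" using e(2) by blast
  qed
qed

text \<open>An element \<open>A\<close> that fixes \<open>z0\<close> acts on the disc coordinate as the rotation by this number,
  which is also the derivative of \<open>A\<close> at \<open>z0\<close>.\<close>

definition rotation :: "complex \<Rightarrow> mat2 \<Rightarrow> complex" where "rotation z0 A = 1 / (aut A z0)\<^sup>2"

lemma mob_cnj: "mob A (cnj z) = cnj (mob A z)" "aut A (cnj z) = cnj (aut A z)"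
  by (simp_all add: mob_def aut_def)

lemma cmod_aut_fixed:
  assumes "det A = 1" "Im z0 > 0" "mob A z0 = z0" shows "cmod (aut A z0) = 1"
proof -
  have "(cmod (aut A z0))\<^sup>2 = 1"
    using Im_mob[of A z0] assms aut_nonzero[of A z0] by (simp add: field_simps)
  moreover have "cmod (aut A z0) \<noteq> - 1" using norm_ge_zero[of "aut A z0"] by linarith
  ultimately show ?thesis by (simp add: power2_eq_1_iff)
qed

lemma cayley_mob_fixed:
  assumes "det A = 1" "Im z0 > 0" "mob A z0 = z0" "Im z > 0"
  shows "cayley z0 (mob A z) = rotation z0 A * cayley z0 z"
proof -
  have nz: "aut A z0 \<noteq> 0" "aut A z \<noteq> 0" "aut A (cnj z0) \<noteq> 0"
    using assms aut_nonzero[OF assms(1)] by simp_all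
  have 1: "mob A z - z0 = (z - z0) / (aut A z * aut A z0)"
    using mob_diff[OF nz(2) nz(1) assms(1)] assms(3) by simp
  have 2: "mob A z - cnj z0 = (z - cnj z0) / (aut A z * cnj (aut A z0))"
    using mob_diff[OF nz(2) nz(3) assms(1)] assms(3) by (simp add: mob_cnj)
  have "aut A z0 * cnj (aut A z0) = 1"
    using cmod_aut_fixed[OF assms(1-3)] complex_norm_square[of "aut A z0"] by simp
  then have 3: "cnj (aut A z0) = 1 / aut A z0" using nz by (simp add: field_simps)
  have "z - cnj z0 \<noteq> 0" using diff_cnj_nonzero assms by blast
  then show ?thesis unfolding cayley_def 1 2 3 rotation_def
    using nz by (simp add: field_simps power2_eq_square)
qed

lemma rotation_mult:
  assumes "det B = 1" "Im z0 > 0" "mob B z0 = z0"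
  shows "rotation z0 (A ** B) = rotation z0 A * rotation z0 B"
  using assms by (simp add: rotation_def aut_mult power_mult_distrib)

lemma rotation_nonzero: "det A = 1 \<Longrightarrow> Im z0 > 0 \<Longrightarrow> rotation z0 A \<noteq> 0"
  by (simp add: rotation_def aut_nonzero)

lemma rotation_uminus [simp]: "rotation z0 (- A) = rotation z0 A"
proof -
  have "aut (- A) z0 = - aut A z0" by (simp add: aut_def)
  then show ?thesis by (simp add: rotation_def)
qed

lemma rotation_eq_1:
  assumes "det A = 1" "Im z0 > 0" "mob A z0 = z0" "rotation z0 A = 1"
  shows "A = mat 1 \<or> A = - mat 1"
proof -
  have nz: "aut A z0 \<noteq> 0" using assms aut_nonzero[OF assms(1)] by simp
  then have "(aut A z0)\<^sup>2 = 1" using assms(4) by (simp add: rotation_def field_simps)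
  then have aut: "aut A z0 = 1 \<or> aut A z0 = - 1" by (simp add: power2_eq_1_iff)
  then have "Im (aut A z0) = 0" by auto
  then have c: "A$2$1 = 0" using assms by (simp add: aut_def)
  have d: "A$2$2 = 1 \<or> A$2$2 = - 1" using aut unfolding aut_def c
    by simp (metis of_int_1 of_int_eq_iff of_int_minus)
  have a: "A$1$1 = A$2$2" using d c assms(1) by (auto simp: det_2)
  have "of_int (A$1$1) * z0 + of_int (A$1$2) = z0 * of_int (A$2$2)"
    using assms(3) nz unfolding mob_def aut_def c by (simp add: field_simps)
  then have "A$1$2 = 0" unfolding a by simp
  then show ?thesis using a c d by (auto simp: mat2_eq_iff)
qed

context PSL2Z_subgroup begin

text \<open>The stabilizer of a point of the half-plane, as a set of matrices; it is twice as large as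
  the stabilizer in \<open>PSL(2,Z)\<close>.\<close>

definition fixers :: "complex \<Rightarrow> mat2 set" where
  "fixers z = {A \<in> lift_SL G. mob A z = z}"

lemma stabilizer_eq: "Im z > 0 \<Longrightarrow> stabilizer G (Some z) = psl ` fixers z"
  unfolding stabilizer_def fixers_def
  by (subst G_eq) (auto simp: moebius_Some image_iff)

lemma finite_fixers: "Im z > 0 \<Longrightarrow> finite (fixers z)"
  by (rule finite_subset[OF _ finite_SL_fixing[of z]]) (auto simp: fixers_def)

lemma fixers_group:
  assumes "Im z > 0"
  shows "mat 1 \<in> fixers z" "A \<in> fixers z \<Longrightarrow> B \<in> fixers z \<Longrightarrow> A ** B \<in> fixers z"
    "A \<in> fixers z \<Longrightarrow> adj2 A \<in> fixers z"
proof -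
  show "adj2 A \<in> fixers z" if "A \<in> fixers z"
    using that mob_adj2(1)[of A z] assms by (auto simp: fixers_def lift_adj2)
qed (use assms in \<open>auto simp: fixers_def lift_one lift_mult mob_mult\<close>)

lemma rotation_eq_iff:
  assumes "Im z > 0" "A \<in> fixers z" "B \<in> fixers z"
  shows "rotation z A = rotation z B \<longleftrightarrow> psl A = psl B"
proof
  have A: "det A = 1" "mob A z = z" and B: "det B = 1" "mob B z = z" using assms by (auto simp: fixers_def)
  have B': "det (adj2 B) = 1" "mob (adj2 B) z = z"
    using fixers_group(3)[OF assms(1,3)] B by (auto simp: fixers_def)
  assume eq: "rotation z A = rotation z B"
  have "rotation z (adj2 B ** A) = rotation z (adj2 B ** B)"
    using rotation_mult[of A z "adj2 B"] rotation_mult[of B z "adj2 B"] A B assms(1) eq by simp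
  also have "\<dots> = 1" using B by (simp add: mult_adj2 rotation_def aut_def)
  finally have "adj2 B ** A = mat 1 \<or> adj2 B ** A = - mat 1"
    using A B B' assms(1) by (intro rotation_eq_1[of _ z]) (simp_all add: det_mul mob_mult)
  then have "B ** (adj2 B ** A) = B \<or> B ** (adj2 B ** A) = - B" by (auto simp: mult_minus2)
  then show "psl A = psl B" using B by (auto simp: matrix_mul_assoc mult_adj2 psl_uminus)
next
  assume "psl A = psl B" then show "rotation z A = rotation z B" by (auto simp: psl_eq_iff)
qed

lemma card_stabilizer:
  assumes "Im z > 0" shows "card (stabilizer G (Some z)) = card (rotation z ` fixers z)"
proof -
  have "\<exists>h. bij_betw h (psl ` fixers z) (rotation z ` fixers z)"
  proof
    let ?h = "\<lambda>g. rotation z (SOME A. A \<in> fixers z \<and> psl A = g)"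
    have h: "?h (psl A) = rotation z A" if "A \<in> fixers z" for A
      using someI[of "\<lambda>B. B \<in> fixers z \<and> psl B = psl A" A] that rotation_eq_iff[OF assms] by blast
    show "bij_betw ?h (psl ` fixers z) (rotation z ` fixers z)"
      unfolding bij_betw_def inj_on_def using h rotation_eq_iff[OF assms] by (auto simp: image_image)
  qed
  then show ?thesis unfolding stabilizer_eq[OF assms] using bij_betw_same_card by blast
qed

text \<open>The order of the stabilizer in \<open>PSL(2,Z)\<close>, which is the exponent in the local coordinate.\<close>

definition stab_order :: "complex \<Rightarrow> nat" where "stab_order z = card (stabilizer G (Some z))"

lemma stab_order_pos: "Im z > 0 \<Longrightarrow> stab_order z > 0"
  using fixers_group(1)[of z] finite_fixers[of z] unfolding stab_order_def card_stabilizer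
  by (auto simp: card_gt_0_iff)

text \<open>The rotation numbers form a finite set of \<open>stab_order z\<close> elements that is permuted by
  multiplication by any of them. Comparing products gives Lagrange's theorem in this case.\<close>

lemma rotation_power_stab_order:
  assumes "Im z > 0" "A \<in> fixers z" shows "rotation z A ^ stab_order z = 1"
proof -
  define R where "R = rotation z ` fixers z"
  have fin: "finite R" using finite_fixers[OF assms(1)] by (simp add: R_def)
  have nz: "rotation z B \<noteq> 0" if "B \<in> fixers z" for B
    using that assms(1) by (intro rotation_nonzero) (auto simp: fixers_def)
  have "(*) (rotation z A) ` R \<subseteq> R"
  proof (clarsimp simp: R_def)
    fix B assume B: "B \<in> fixers z"
    then have "rotation z A * rotation z B = rotation z (A ** B)"
      using assms by (subst rotation_mult) (auto simp: fixers_def)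
    then show "rotation z A * rotation z B \<in> rotation z ` fixers z"
      using fixers_group(2)[OF assms(1,2) B] by auto
  qed
  moreover have inj: "inj_on ((*) (rotation z A)) R" using nz[OF assms(2)] by (auto simp: inj_on_def)
  ultimately have eq: "(*) (rotation z A) ` R = R" using fin endo_inj_surj by blast
  have "(\<Prod>x\<in>R. x) = (\<Prod>x\<in>(*) (rotation z A) ` R. x)" by (simp only: eq)
  also have "\<dots> = (\<Prod>x\<in>R. rotation z A * x)" using inj by (simp add: prod.reindex)
  also have "\<dots> = rotation z A ^ card R * (\<Prod>x\<in>R. x)" by (simp add: prod.distrib)
  finally have "rotation z A ^ card R = 1"
    using fin nz by (auto simp: R_def)
  then show ?thesis by (simp add: stab_order_def card_stabilizer[OF assms(1)] R_def)
qed

text \<open>By counting, the rotation numbers are therefore all roots of unity of order \<open>stab_order z\<close>.\<close>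

lemma rotation_roots_of_unity:
  assumes "Im z > 0" "\<zeta> ^ stab_order z = 1"
  obtains A where "A \<in> fixers z" "rotation z A = \<zeta>"
proof -
  have "card {\<zeta>::complex. \<zeta> ^ stab_order z = 1} = stab_order z"
    using stab_order_pos[OF assms(1)] by (intro card_roots_unity_eq)
  moreover have "rotation z ` fixers z \<subseteq> {\<zeta>. \<zeta> ^ stab_order z = 1}" using rotation_power_stab_order[OF assms(1)] by auto
  moreover have "finite {\<zeta>::complex. \<zeta> ^ stab_order z = 1}" using stab_order_pos[OF assms(1)] by (intro finite_roots_unity) simp
  moreover have "card (rotation z ` fixers z) = stab_order z" by (simp only: stab_order_def card_stabilizer[OF assms(1)])
  ultimately have "rotation z ` fixers z = {\<zeta>. \<zeta> ^ stab_order z = 1}" using card_subset_eq by metis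
  then have "\<zeta> \<in> rotation z ` fixers z" using assms(2) by blast
  then show ?thesis using that by blast
qed

end

section \<open>Translations and cusp widths\<close>

lemma mob_minus_id:
  assumes "A$2$1 = 0" "det A = 1"
  obtains n :: int where "\<And>z. mob A z = z + of_int n" "psl A = psl (vector [vector [1, n], vector [0, 1]])"
proof -
  have ad: "A$1$1 * A$2$2 = 1" using assms by (simp add: det_2)
  then have "A$1$1 = 1 \<and> A$2$2 = 1 \<or> A$1$1 = -1 \<and> A$2$2 = -1"
    using pos_zmult_eq_1_iff zmult_eq_1_iff by blast
  then show ?thesis
  proof
    assume "A$1$1 = 1 \<and> A$2$2 = 1"
    then show ?thesis using assms
      by (intro that[of "A$1$2"]) (auto simp: mob_def aut_def psl_eq_iff mat2_eq_iff)
  next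
    assume "A$1$1 = -1 \<and> A$2$2 = -1"
    then show ?thesis using assms
      by (intro that[of "- (A$1$2)"]) (auto simp: mob_def aut_def psl_eq_iff mat2_eq_iff)
  qed
qed

text \<open>The matrix of the translation \<open>z \<mapsto> z + n\<close>.\<close>

definition trans_mat :: "int \<Rightarrow> mat2" where
  "trans_mat n = vector [vector [1, n], vector [0, 1]]"

lemma trans_mat_nth [simp]: "trans_mat n$1$1 = 1" "trans_mat n$1$2 = n" "trans_mat n$2$1 = 0" "trans_mat n$2$2 = 1"
  by (simp_all add: trans_mat_def)

lemma det_trans_mat [simp]: "det (trans_mat n) = 1" by (simp add: det_2)
lemma trans_mat_add: "trans_mat (m + n) = trans_mat m ** trans_mat n" by (simp add: mat2_eq_iff mat2_mult_nth)
lemma adj2_trans_mat: "adj2 (trans_mat n) = trans_mat (- n)" by (simp add: mat2_eq_iff)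
lemma mob_trans_mat [simp]: "mob (trans_mat n) z = z + of_int n" by (simp add: mob_def aut_def)

text \<open>An element that maps a point of the horoball \<open>Im z > 1\<close> to another such point is a translation.\<close>

lemma horoball_translation:
  assumes "det A = 1" "Im z > 1" "Im (mob A z) > 1"
  shows "A$2$1 = 0"
proof (rule ccontr)
  assume c: "A$2$1 \<noteq> 0"
  have nz: "aut A z \<noteq> 0" using assms by (intro aut_nonzero) auto
  have "1 \<le> \<bar>real_of_int (A$2$1)\<bar>" using c by linarith
  then have "1 * Im z \<le> \<bar>real_of_int (A$2$1)\<bar> * Im z" by (rule mult_right_mono) (use assms in simp)
  also have "\<dots> = \<bar>Im (aut A z)\<bar>" using assms by (simp add: aut_def abs_mult)
  also have "\<dots> \<le> cmod (aut A z)" by (rule abs_Im_le_cmod)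
  finally have "(Im z)\<^sup>2 \<le> (cmod (aut A z))\<^sup>2" using assms by (intro power_mono) auto
  moreover have "Im z < (Im z)\<^sup>2" using assms by (simp add: power2_eq_square)
  moreover have "(cmod (aut A z))\<^sup>2 < Im z"
    using assms nz by (simp add: Im_mob pos_less_divide_eq)
  ultimately show False by linarith
qed

locale modular_subgroup = PSL2Z_subgroup +
  assumes finite_index: "finite (rcosets\<^bsub>PSL2Z\<^esub> G)"
begin

text \<open>The integers \<open>n\<close> such that \<open>G\<close> contains the conjugate by \<open>K\<close> of the translation by \<open>n\<close>. They form
  a group, generated by the width of the cusp \<open>K(\<infinity>)\<close>.\<close>

definition periods :: "mat2 \<Rightarrow> int set" where
  "periods K = {n. K ** trans_mat n ** adj2 K \<in> lift_SL G}"

lemma conj_trans_mat_mult: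
  assumes "det K = 1"
  shows "(K ** trans_mat m ** adj2 K) ** (K ** trans_mat n ** adj2 K) = K ** trans_mat (m + n) ** adj2 K"
proof -
  have "(K ** trans_mat m ** adj2 K) ** (K ** trans_mat n ** adj2 K) =
      K ** trans_mat m ** (adj2 K ** K) ** trans_mat n ** adj2 K"
    by (simp only: matrix_mul_assoc)
  then show ?thesis by (simp add: mult_adj2[OF assms] trans_mat_add matrix_mul_assoc)
qed

lemma periods_add: "det K = 1 \<Longrightarrow> m \<in> periods K \<Longrightarrow> n \<in> periods K \<Longrightarrow> m + n \<in> periods K"
  using lift_mult[of "K ** trans_mat m ** adj2 K" "K ** trans_mat n ** adj2 K"]
  unfolding periods_def mem_Collect_eq by (simp only: conj_trans_mat_mult)

lemma zero_period: 
  assumes "det K = 1" shows "0 \<in> periods K"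
proof -
  have "trans_mat 0 = mat 1" by (simp add: mat2_eq_iff)
  then show ?thesis using lift_one assms by (simp add: periods_def mult_adj2)
qed

lemma adj2_mult: "adj2 (A ** B) = adj2 B ** adj2 A"
  by (simp add: mat2_eq_iff mat2_mult_nth algebra_simps)

lemma adj2_adj2 [simp]: "adj2 (adj2 A) = A" by (simp add: mat2_eq_iff)

lemma periods_uminus: "m \<in> periods K \<Longrightarrow> - m \<in> periods K"
  using lift_adj2[of "K ** trans_mat m ** adj2 K"]
  by (simp add: periods_def adj2_mult adj2_trans_mat matrix_mul_assoc)

lemma periods_mult: 
  assumes "det K = 1" "h \<in> periods K" shows "h * n \<in> periods K"
proof -
  have nat: "h * int k \<in> periods K" for k
  proof (induction k)
    case 0
    then show ?case using zero_period assms by simp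
  next
    case (Suc k)
    then show ?case using periods_add[OF assms(1) assms(2) Suc] by (simp add: algebra_simps)
  qed
  show ?thesis
  proof (cases "n \<ge> 0")
    case True then show ?thesis using nat[of "nat n"] by simp
  next
    case False then show ?thesis using periods_uminus[OF nat[of "nat (- n)"]] by simp
  qed
qed

lemma in_periods_iff:
  assumes "det K = 1"
  shows "psl K \<otimes>\<^bsub>PSL2Z\<^esub> psl (trans_mat n) \<otimes>\<^bsub>PSL2Z\<^esub> inv\<^bsub>PSL2Z\<^esub> (psl K) \<in> G \<longleftrightarrow> n \<in> periods K"
  using assms by (simp add: mult_PSL2Z inv_PSL2Z periods_def lift_SL_def det_mul del: lift_det)

text \<open>This is where finite index enters: two of the cosets of the conjugated translations must
  coincide.\<close>

lemma exists_period:
  assumes K: "det K = 1" obtains h where "h > 0" "int h \<in> periods K"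
proof -
  interpret P: group PSL2Z by (rule group_PSL2Z)
  define C where "C n = K ** trans_mat n ** adj2 K" for n
  have detC: "det (C n) = 1" for n using K by (simp add: C_def det_mul)
  have C: "psl (C n) \<in> carrier PSL2Z" for n using detC by (auto simp: carrier_PSL2Z)
  let ?f = "\<lambda>n. G #>\<^bsub>PSL2Z\<^esub> psl (C (int n))"
  have "range ?f \<subseteq> rcosets\<^bsub>PSL2Z\<^esub> G"
    using C subgroup.subset[OF subgroup_G] by (auto intro!: P.rcosetsI)
  then have "finite (range ?f)" using finite_index finite_subset by blast
  then have "\<not> inj ?f" using finite_imageD infinite_UNIV_nat by blast
  then obtain m n where mn: "?f m = ?f n" "n < m" unfolding inj_def by (metis linorder_neqE_nat)
  have "psl (C (int m)) \<in> ?f n" using P.rcos_self[OF C subgroup_G, of "int m"] mn(1) by simp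
  then obtain x where x: "x \<in> G" "psl (C (int m)) = x \<otimes>\<^bsub>PSL2Z\<^esub> psl (C (int n))"
    by (auto simp: r_coset_def)
  obtain X where X: "X \<in> lift_SL G" "x = psl X" using x(1) by (subst (asm) G_eq) auto
  have "psl (C (int m)) = psl (X ** C (int n))" using x X by (simp add: mult_PSL2Z)
  then have "X ** C (int n) = C (int m) \<or> (- X) ** C (int n) = C (int m)"
    by (auto simp: psl_eq_iff mult_minus2)
  then obtain Y where Y: "Y \<in> lift_SL G" "Y ** C (int n) = C (int m)"
    using X lift_uminus by blast
  have "trans_mat 0 = mat 1" by (simp add: mat2_eq_iff)
  then have "Y = Y ** (C (int n) ** C (- int n))"
    unfolding C_def conj_trans_mat_mult[OF K] using K by (simp add: mult_adj2)
  also have "\<dots> = C (int m) ** C (- int n)" by (simp only: matrix_mul_assoc Y(2))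
  also have "\<dots> = C (int (m - n))"
    unfolding C_def conj_trans_mat_mult[OF K] using mn(2) by (simp add: of_nat_diff)
  finally have "int (m - n) \<in> periods K" using Y(1) by (simp add: periods_def C_def)
  then show ?thesis using that[of "m - n"] mn(2) by simp
qed

lemma cusp_width_props:
  assumes "det K = 1"
  shows "cusp_width G (psl K) > 0" "int (cusp_width G (psl K)) \<in> periods K"
    "n \<in> periods K \<Longrightarrow> int (cusp_width G (psl K)) dvd n"
proof -
  define h where "h = cusp_width G (psl K)"
  have h_Least: "h = (LEAST h. 0 < h \<and> int h \<in> periods K)"
    unfolding h_def cusp_width_def using in_periods_iff[OF assms] by (simp only: trans_mat_def)
  obtain h0 where "h0 > 0" "int h0 \<in> periods K" by (rule exists_period[OF assms])
  then have h: "0 < h \<and> int h \<in> periods K" 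
    using LeastI[of "\<lambda>h. 0 < h \<and> int h \<in> periods K" h0] unfolding h_Least[symmetric] by blast
  then show "cusp_width G (psl K) > 0" "int (cusp_width G (psl K)) \<in> periods K"
    by (simp_all add: h_def)
  assume n: "n \<in> periods K"
  have "n mod int h = n + int h * (- (n div int h))"
    by (simp add: minus_mult_div_eq_mod)
  then have "n mod int h \<in> periods K"
    using periods_add[OF assms n periods_mult[OF assms, of "int h" "- (n div int h)"]] h by simp
  then have m: "int (nat (n mod int h)) \<in> periods K" using h by simp
  have "nat (n mod int h) < h" using h by (simp add: nat_less_iff)
  then have "\<not> 0 < nat (n mod int h)" using not_less_Least[of "nat (n mod int h)" "\<lambda>h. 0 < h \<and> int h \<in> periods K"] m
    unfolding h_Least[symmetric] by simp
  then have "n mod int h = 0" using h by (simp add: order_antisym)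
  then show "int (cusp_width G (psl K)) dvd n" by (simp add: h_def dvd_eq_mod_eq_0)
qed

end

section \<open>Existence of charts\<close>

context modular_subgroup begin

text \<open>The definition of the interior charts in terms of matrices.\<close>

lemma interior_charts_iff:
  "(U, \<psi>) \<in> interior_charts G \<longleftrightarrow> (\<exists>z0 r. Im z0 > 0 \<and> 0 < r \<and>
     (\<forall>A\<in>lift_SL G. (\<exists>z\<in>hyp_disc z0 r. mob A z \<in> hyp_disc z0 r) \<longrightarrow> mob A z0 = z0) \<and>
     U = proj ` hyp_disc z0 r \<and> (\<forall>z\<in>hyp_disc z0 r. \<psi> (proj z) = cayley z0 z ^ stab_order z0))"
proof -
  have *: "(\<forall>g\<in>G. psl_act g ` (Some ` hyp_disc z0 r) \<inter> Some ` hyp_disc z0 r \<noteq> {} \<longrightarrow> g \<in> stabilizer G (Some z0))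
    \<longleftrightarrow> (\<forall>A\<in>lift_SL G. (\<exists>z\<in>hyp_disc z0 r. mob A z \<in> hyp_disc z0 r) \<longrightarrow> mob A z0 = z0)"
    (is "?L \<longleftrightarrow> ?R") if "Im z0 > 0" for z0 r
  proof -
    have 1: "psl_act (psl A) ` (Some ` hyp_disc z0 r) \<inter> Some ` hyp_disc z0 r \<noteq> {} \<longleftrightarrow> (\<exists>z\<in>hyp_disc z0 r. mob A z \<in> hyp_disc z0 r)"
      if "A \<in> lift_SL G" for A
    proof -
      have "psl_act (psl A) ` (Some ` hyp_disc z0 r) = (\<lambda>z. Some (mob A z)) ` hyp_disc z0 r"
        using that unfolding image_image by (intro image_cong) (auto simp: hyp_disc_def moebius_Some)
      then show ?thesis by auto
    qed
    have 2: "psl A \<in> stabilizer G (Some z0) \<longleftrightarrow> mob A z0 = z0" if "A \<in> lift_SL G" for A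
    proof -
      have "psl A \<in> G" using that by (simp add: lift_SL_def del: lift_det)
      then show ?thesis using that \<open>Im z0 > 0\<close> by (simp add: stabilizer_def moebius_Some)
    qed
    have "?L \<longleftrightarrow> (\<forall>g\<in>psl ` lift_SL G. psl_act g ` (Some ` hyp_disc z0 r) \<inter> Some ` hyp_disc z0 r \<noteq> {} \<longrightarrow> g \<in> stabilizer G (Some z0))"
      by (simp only: G_eq[symmetric])
    also have "\<dots> \<longleftrightarrow> (\<forall>A\<in>lift_SL G. psl_act (psl A) ` (Some ` hyp_disc z0 r) \<inter> Some ` hyp_disc z0 r \<noteq> {} \<longrightarrow> psl A \<in> stabilizer G (Some z0))"
      by (rule ball_simps(9))
    also have "\<dots> \<longleftrightarrow> ?R" by (rule ball_cong[OF refl]) (simp only: 1 2)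
    finally show ?thesis .
  qed
  have "(U, \<psi>) \<in> interior_charts G \<longleftrightarrow> (\<exists>z0 r. Im z0 > 0 \<and> 0 < r \<and>
     (\<forall>g\<in>G. psl_act g ` (Some ` hyp_disc z0 r) \<inter> Some ` hyp_disc z0 r \<noteq> {} \<longrightarrow> g \<in> stabilizer G (Some z0)) \<and>
     U = modular_proj G ` (Some ` hyp_disc z0 r) \<and> (\<forall>z\<in>hyp_disc z0 r. \<psi> (proj z) = cayley z0 z ^ stab_order z0))"
    unfolding interior_charts_def hyp_disc_def cayley_def stab_order_def H_iff by simp
  also have "\<dots> \<longleftrightarrow> (\<exists>z0 r. Im z0 > 0 \<and> 0 < r \<and>
     (\<forall>A\<in>lift_SL G. (\<exists>z\<in>hyp_disc z0 r. mob A z \<in> hyp_disc z0 r) \<longrightarrow> mob A z0 = z0) \<and>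
     U = proj ` hyp_disc z0 r \<and> (\<forall>z\<in>hyp_disc z0 r. \<psi> (proj z) = cayley z0 z ^ stab_order z0))"
    by (rule iff_exI, rule iff_exI, rule conj_cong[OF refl]) 
      (simp only: *, simp only: image_image)
  finally show ?thesis .
qed

text \<open>The coordinate \<open>cayley z0 z ^ stab_order z0\<close> depends only on the orbit of \<open>z\<close>, because the elements of \<open>G\<close>
  that identify points of the disc rotate it by roots of unity of order \<open>stab_order z0\<close>.\<close>

lemma interior_chart_exists:
  assumes "Im z0 > 0"
  obtains c where "c \<in> modular_atlas G" "proj z0 \<in> fst c"
proof -
  obtain r where r: "r > 0"
    "\<And>A z. det A = 1 \<Longrightarrow> z \<in> hyp_disc z0 r \<Longrightarrow> mob A z \<in> hyp_disc z0 r \<Longrightarrow> mob A z0 = z0"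
    using discontinuous_action[OF assms] by metis
  define \<psi> where "\<psi> p = cayley z0 (SOME z. z \<in> hyp_disc z0 r \<and> proj z = p) ^ stab_order z0" for p
  have "\<psi> (proj z) = cayley z0 z ^ stab_order z0" if z: "z \<in> hyp_disc z0 r" for z
  proof -
    define w where "w = (SOME w. w \<in> hyp_disc z0 r \<and> proj w = proj z)"
    have "w \<in> hyp_disc z0 r \<and> proj w = proj z" unfolding w_def by (rule someI[of _ z]) (use z in simp)
    then have w: "w \<in> hyp_disc z0 r" "proj w = proj z" by auto
    have Imw: "Im w > 0" using w by (simp add: hyp_disc_def)
    obtain A where A: "A \<in> lift_SL G" "z = mob A w" using proj_eqE[OF w(2) Imw] .
    have fx: "mob A z0 = z0" using r(2)[of A w] A w z by simp
    then have "A \<in> fixers z0" using A by (simp add: fixers_def)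
    moreover have "cayley z0 z = rotation z0 A * cayley z0 w" unfolding A(2) using A fx assms Imw by (intro cayley_mob_fixed) auto
    ultimately have "cayley z0 z ^ stab_order z0 = cayley z0 w ^ stab_order z0"
      using rotation_power_stab_order[OF assms] by (simp add: power_mult_distrib)
    then show ?thesis unfolding \<psi>_def w_def by simp
  qed
  then have "(proj ` hyp_disc z0 r, \<psi>) \<in> interior_charts G"
    unfolding interior_charts_iff using r assms by (intro exI[of _ z0] exI[of _ r]) auto
  moreover have "z0 \<in> hyp_disc z0 r" using assms r(1) by (simp add: hyp_disc_def)
  ultimately show ?thesis using that[of "(proj ` hyp_disc z0 r, \<psi>)"] by (simp add: modular_atlas_def)
qed

text \<open>The local coordinate at the cusp \<open>K(\<infinity>)\<close>, as a function on the horoball.\<close>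

definition cusp_coord :: "mat2 \<Rightarrow> complex \<Rightarrow> complex" where
  "cusp_coord K z = exp (2 * of_real pi * \<i> * z / of_nat (cusp_width G (psl K)))"

text \<open>The point of the modular curve that the cusp \<open>K(\<infinity>)\<close> represents.\<close>

definition cusp_pt :: "mat2 \<Rightarrow> modular_point" where
  "cusp_pt K = modular_proj G (moebius K None)"

lemma cusp_charts_iff:
  "(U, \<psi>) \<in> cusp_charts G \<longleftrightarrow> (\<exists>K. det K = 1 \<and>
     U = insert (cusp_pt K) ((\<lambda>z. proj (mob K z)) ` {z. Im z > 1}) \<and>
     \<psi> (cusp_pt K) = 0 \<and> (\<forall>z. Im z > 1 \<longrightarrow> \<psi> (proj (mob K z)) = cusp_coord K z))"
proof -
  have "(U, \<psi>) \<in> cusp_charts G \<longleftrightarrow> (\<exists>K. det K = 1 \<and>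
     U = modular_proj G ` moebius K ` insert None (Some ` {z. Im z > 1}) \<and>
     \<psi> (cusp_pt K) = 0 \<and> (\<forall>z. Im z > 1 \<longrightarrow> \<psi> (modular_proj G (moebius K (Some z))) = cusp_coord K z))"
    unfolding cusp_charts_def carrier_PSL2Z cusp_pt_def cusp_coord_def by simp
  also have "\<dots> \<longleftrightarrow> (\<exists>K. det K = 1 \<and>
     U = insert (cusp_pt K) ((\<lambda>z. proj (mob K z)) ` {z. Im z > 1}) \<and>
     \<psi> (cusp_pt K) = 0 \<and> (\<forall>z. Im z > 1 \<longrightarrow> \<psi> (proj (mob K z)) = cusp_coord K z))"
  proof (rule iff_exI, rule conj_cong[OF refl])
    fix K :: mat2 assume K: "det K = 1"
    have 1: "modular_proj G (moebius K (Some z)) = proj (mob K z)" if "Im z > 1" for z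
      using that K by (simp add: moebius_Some)
    have "modular_proj G ` moebius K ` insert None (Some ` {z. Im z > 1}) =
      insert (cusp_pt K) ((\<lambda>z. modular_proj G (moebius K (Some z))) ` {z. Im z > 1})"
      by (simp add: image_image cusp_pt_def)
    also have "(\<lambda>z. modular_proj G (moebius K (Some z))) ` {z. Im z > 1} = (\<lambda>z. proj (mob K z)) ` {z. Im z > 1}"
      by (rule image_cong) (simp_all add: 1)
    finally show "(U = modular_proj G ` moebius K ` insert None (Some ` {z. Im z > 1}) \<and>
      \<psi> (cusp_pt K) = 0 \<and> (\<forall>z. Im z > 1 \<longrightarrow> \<psi> (modular_proj G (moebius K (Some z))) = cusp_coord K z)) \<longleftrightarrow>
      (U = insert (cusp_pt K) ((\<lambda>z. proj (mob K z)) ` {z. Im z > 1}) \<and>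
      \<psi> (cusp_pt K) = 0 \<and> (\<forall>z. Im z > 1 \<longrightarrow> \<psi> (proj (mob K z)) = cusp_coord K z))"
      using 1 by simp
  qed
  finally show ?thesis .
qed

lemma mob_trans_conj:
  assumes "det K = 1" "Im z > 0"
  shows "mob (K ** trans_mat n ** adj2 K) (mob K z) = mob K (z + of_int n)"
  using assms by (simp add: mob_mult det_mul)

lemma horoball_equiv:
  assumes K: "det K = 1" and "Im z > 1" "Im w > 1"
  shows "proj (mob K z) = proj (mob K w) \<longleftrightarrow> (\<exists>n\<in>periods K. w = z + of_int n)"
proof
  have Imz: "Im z > 0" "Im w > 0" "Im (mob K z) > 0" using assms by auto
  assume "proj (mob K z) = proj (mob K w)"
  then obtain A where A: "A \<in> lift_SL G" "mob K w = mob A (mob K z)"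
    using proj_eqE Imz(3) by metis
  define B where "B = adj2 K ** A ** K"
  have detB: "det B = 1" using K A by (simp add: B_def det_mul)
  have "mob B z = mob (adj2 K) (mob A (mob K z))"
    unfolding B_def using K A Imz by (simp add: mob_mult det_mul)
  also have "\<dots> = w" using K Imz by (simp flip: A(2))
  finally have Bz: "mob B z = w" .
  then have "B$2$1 = 0" using horoball_translation[OF detB] assms by simp
  then obtain n where n: "\<And>z. mob B z = z + of_int n" "psl B = psl (trans_mat n)"
    using mob_minus_id[OF _ detB] unfolding trans_mat_def by metis
  have A_eq: "A = K ** B ** adj2 K"
    unfolding B_def by (simp add: matrix_mul_assoc mult_adj2[OF K]) (simp add: mult_adj2[OF K] flip: matrix_mul_assoc)
  have "trans_mat n = B \<or> trans_mat n = - B" using n(2) by (simp add: psl_eq_iff)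
  then have "K ** trans_mat n ** adj2 K = A \<or> K ** trans_mat n ** adj2 K = - A"
    unfolding A_eq by (auto simp: mult_minus2)
  then have "n \<in> periods K" using A(1) lift_uminus[OF A(1)] unfolding periods_def by auto
  then show "\<exists>n\<in>periods K. w = z + of_int n" using n(1)[of z] Bz by auto
next
  assume "\<exists>n\<in>periods K. w = z + of_int n"
  then obtain n where n: "n \<in> periods K" "w = z + of_int n" by auto
  have "proj (mob (K ** trans_mat n ** adj2 K) (mob K z)) = proj (mob K z)"
    using n(1) assms by (intro proj_mob) (auto simp: periods_def)
  then show "proj (mob K z) = proj (mob K w)"
    using mob_trans_conj[OF K, of z n] assms n(2) by simp
qed

lemma cusp_coord_eq_iff:
  assumes "det K = 1"
  shows "cusp_coord K z = cusp_coord K w \<longleftrightarrow> (\<exists>n\<in>periods K. w = z + of_int n)"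
proof -
  define h where "h = cusp_width G (psl K)"
  have h: "h > 0" "int h \<in> periods K" "\<And>n. n \<in> periods K \<Longrightarrow> int h dvd n"
    unfolding h_def using cusp_width_props[OF assms] by auto
  have *: "2 * of_real pi * \<i> * w / of_nat h = 2 * of_real pi * \<i> * z / of_nat h + (of_int (2 * n) * pi) * \<i>
       \<longleftrightarrow> w = z + of_int (int h * n)" for n
  proof -
    have "2 * of_real pi * \<i> * w / of_nat h - (2 * of_real pi * \<i> * z / of_nat h + (of_int (2 * n) * pi) * \<i>)
      = 2 * of_real pi * \<i> / of_nat h * (w - (z + of_int (int h * n)))"
      using h(1) by (simp add: field_simps)
    moreover have "2 * of_real pi * \<i> / of_nat h \<noteq> (0::complex)" using h(1) by simp
    ultimately show ?thesis by (metis eq_iff_diff_eq_0 mult_eq_0_iff)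
  qed
  have "cusp_coord K w = cusp_coord K z \<longleftrightarrow> (\<exists>n::int. w = z + of_int (int h * n))"
    unfolding cusp_coord_def h_def[symmetric] exp_eq * ..
  also have "\<dots> \<longleftrightarrow> (\<exists>n\<in>periods K. w = z + of_int n)"
    using h(3) periods_mult[OF assms h(2)] by (metis dvdE)
  finally show ?thesis by (simp only: eq_commute)
qed

lemma cusp_pt_neq:
  assumes "det K = 1" "Im z > 0" shows "cusp_pt K \<noteq> proj z"
proof
  assume "cusp_pt K = proj z"
  then obtain A where A: "A \<in> lift_SL G" "Some z = moebius A (moebius K None)"
    unfolding cusp_pt_def modular_proj_eq_iff by blast
  then have "Some z = moebius (A ** K) None" using assms by (simp add: moebius_mult)
  then have "z = of_int ((A ** K)$1$1) / of_int ((A ** K)$2$1)"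
    by (simp add: moebius_def Let_def split: if_splits)
  then have "z = of_real (of_int ((A ** K)$1$1) / of_int ((A ** K)$2$1))" by simp
  then show False using assms(2) by (metis Im_complex_of_real less_irrefl)
qed

lemma cusp_coord_nonzero: "cusp_coord K z \<noteq> 0" by (simp add: cusp_coord_def)

lemma cusp_chart_exists:
  assumes K: "det K = 1"
  obtains c where "c \<in> modular_atlas G" 
    "fst c = insert (cusp_pt K) ((\<lambda>z. proj (mob K z)) ` {z. Im z > 1})"
    "snd c (cusp_pt K) = 0" "\<And>z. Im z > 1 \<Longrightarrow> snd c (proj (mob K z)) = cusp_coord K z"
proof -
  define \<psi> where "\<psi> p = (if p = cusp_pt K then 0 else cusp_coord K (SOME z. Im z > 1 \<and> proj (mob K z) = p))" for p
  have \<psi>: "\<psi> (proj (mob K z)) = cusp_coord K z" if z: "Im z > 1" for z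
  proof -
    define w where "w = (SOME w. Im w > 1 \<and> proj (mob K w) = proj (mob K z))"
    have w: "Im w > 1 \<and> proj (mob K w) = proj (mob K z)" unfolding w_def by (rule someI[of _ z]) (use z in simp)
    then have "cusp_coord K w = cusp_coord K z"
      using horoball_equiv[OF K, of w z] z cusp_coord_eq_iff[OF K, of w z] by simp
    moreover have "proj (mob K z) \<noteq> cusp_pt K" using cusp_pt_neq[OF K, of "mob K z"] K z by auto
    ultimately show ?thesis unfolding \<psi>_def w_def by simp
  qed
  let ?c = "(insert (cusp_pt K) ((\<lambda>z. proj (mob K z)) ` {z. Im z > 1}), \<psi>)"
  have "?c \<in> cusp_charts G"
    unfolding cusp_charts_iff using \<psi> K by (intro exI[of _ K]) (auto simp: \<psi>_def)
  then show ?thesis using that[of ?c] \<psi> by (simp add: modular_atlas_def \<psi>_def)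
qed

end

section \<open>The pullback of a differential to the half-plane\<close>

context modular_subgroup begin

lemma fixers_conj:
  assumes "Im z > 0" "A \<in> lift_SL G" "B \<in> fixers z"
  shows "A ** B ** adj2 A \<in> fixers (mob A z)" "rotation (mob A z) (A ** B ** adj2 A) = rotation z B"
proof -
  have det: "det A = 1" "det B = 1" using assms by (auto simp: fixers_def)
  have B: "mob B z = z" using assms by (simp add: fixers_def)
  have z: "Im (mob A z) > 0" "mob (adj2 A) (mob A z) = z" using det assms by auto
  show "A ** B ** adj2 A \<in> fixers (mob A z)"
    using assms det z B by (auto simp: fixers_def lift_mult lift_adj2 mob_mult det_mul)
  have "aut (adj2 A ** A) z = aut (adj2 A) (mob A z) * aut A z"
    using assms det by (simp add: aut_mult)
  then have 1: "aut (adj2 A) (mob A z) * aut A z = 1" using det by (simp add: mult_adj2 aut_def)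
  have "aut (A ** B ** adj2 A) (mob A z) = aut (A ** B) z * aut (adj2 A) (mob A z)"
    using det z by (simp add: aut_mult)
  also have "\<dots> = aut A z * aut B z * aut (adj2 A) (mob A z)"
    using det assms(1) B by (simp add: aut_mult)
  also have "\<dots> = aut B z" using 1 by (simp add: mult_ac)
  finally show "rotation (mob A z) (A ** B ** adj2 A) = rotation z B" by (simp add: rotation_def)
qed

lemma elliptic_exists:
  assumes "Im z > 0" "stab_order z > 1"
  obtains A where "A \<in> fixers z" "rotation z A \<noteq> 1"
proof (rule ccontr)
  assume "\<not> thesis"
  then have "rotation z ` fixers z \<subseteq> {1}" using that by blast
  then have "card (rotation z ` fixers z) \<le> card {1::complex}" by (intro card_mono) auto
  then show False using assms(2) unfolding stab_order_def card_stabilizer[OF assms(1)] by simp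
qed

lemma cusp_coord_has_field_derivative:
  "(cusp_coord K has_field_derivative 2 * of_real pi * \<i> / of_nat (cusp_width G (psl K)) * cusp_coord K z) (at z)"
proof -
  define h where "h = cusp_width G (psl K)"
  define a where "a = 2 * of_real pi * \<i> / of_nat h"
  have "((\<lambda>z. exp (a * z)) has_field_derivative a * exp (a * z)) (at z)"
    by (auto intro!: derivative_eq_intros)
  then show ?thesis unfolding a_def cusp_coord_def[abs_def] h_def[symmetric] by simp
qed

text \<open>Every chart, read on the half-plane near a point of its domain, is a holomorphic function up
  to a modular substitution. Its derivative can vanish only at an elliptic point.\<close>

lemma chart_local:
  assumes c: "c \<in> modular_atlas G" and z: "Im z > 0" "proj z \<in> fst c"
  obtains M D E z' where "det M = 1" "open D" "D \<subseteq> upper_half_plane" "z' \<in> D" "z = mob M z'"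
    "E holomorphic_on D" "\<And>w. w \<in> D \<Longrightarrow> proj (mob M w) \<in> fst c \<and> snd c (proj (mob M w)) = E w"
    "deriv E z' = 0 \<Longrightarrow> \<exists>A\<in>fixers z. rotation z A \<noteq> 1"
proof -
  obtain U \<psi> where c_eq: "c = (U, \<psi>)" by (cases c)
  from c consider "(U, \<psi>) \<in> interior_charts G" | "(U, \<psi>) \<in> cusp_charts G"
    unfolding modular_atlas_def c_eq by blast
  then show ?thesis
  proof cases
    case 1
    then obtain z0 r where z0: "Im z0 > 0" and U: "U = proj ` hyp_disc z0 r"
      and \<psi>: "\<And>z. z \<in> hyp_disc z0 r \<Longrightarrow> \<psi> (proj z) = cayley z0 z ^ stab_order z0"
      unfolding interior_charts_iff by blast
    obtain z' where z': "z' \<in> hyp_disc z0 r" "proj z' = proj z" using z(2) U c_eq by auto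
    have Imz': "Im z' > 0" using z'(1) by (simp add: hyp_disc_def)
    obtain A where A: "A \<in> lift_SL G" "z = mob A z'" using proj_eqE[OF z'(2) Imz'] .
    have sub: "hyp_disc z0 r \<subseteq> upper_half_plane" by (auto simp: hyp_disc_def)
    let ?E = "\<lambda>w. cayley z0 w ^ stab_order z0"
    show ?thesis
    proof (rule that[of A "hyp_disc z0 r" z' ?E])
      show "?E holomorphic_on hyp_disc z0 r"
        by (intro holomorphic_intros holomorphic_on_subset[OF cayley_holomorphic sub] z0)
    next
      fix w assume w: "w \<in> hyp_disc z0 r"
      then have "Im w > 0" by (simp add: hyp_disc_def)
      then have "proj (mob A w) = proj w" by (rule proj_mob[OF A(1)])
      then show "proj (mob A w) \<in> fst c \<and> snd c (proj (mob A w)) = ?E w"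
        using w \<psi> U c_eq by auto
    next
      assume 0: "deriv ?E z' = 0"
      have "(?E has_field_derivative of_nat (stab_order z0) * ((z0 - cnj z0) / (z' - cnj z0)\<^sup>2 * cayley z0 z' ^ (stab_order z0 - 1))) (at z')"
        using DERIV_power[OF cayley_has_field_derivative[OF z0 Imz'], of "stab_order z0"] by simp
      then have "of_nat (stab_order z0) * ((z0 - cnj z0) / (z' - cnj z0)\<^sup>2 * cayley z0 z' ^ (stab_order z0 - 1)) = 0"
        using 0 DERIV_imp_deriv by metis
      moreover have "z0 - cnj z0 \<noteq> 0" "z' - cnj z0 \<noteq> 0" using diff_cnj_nonzero z0 Imz' by blast+
      ultimately have "cayley z0 z' ^ (stab_order z0 - 1) = 0" using stab_order_pos[OF z0] by simp
      \<comment> \<open>the point is the centre of a disc with a non-trivial stabilizer\<close>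
    then have cz: "cayley z0 z' = 0" "stab_order z0 > 1" by (auto simp: power_eq_0_iff)
      then have eq: "z' = z0" using cayley_eq_0_iff[OF z0 Imz'] by simp
      obtain B where B: "B \<in> fixers z0" "rotation z0 B \<noteq> 1" using elliptic_exists[OF z0 cz(2)] .
      show "\<exists>A\<in>fixers z. rotation z A \<noteq> 1"
        using fixers_conj[OF z0 A(1) B(1)] B(2) A(2) eq by metis
    qed (use A z' sub open_hyp_disc[OF z0] in auto)
  next
    case 2
    then obtain K where K: "det K = 1" and U: "U = insert (cusp_pt K) ((\<lambda>z. proj (mob K z)) ` {z. Im z > 1})"
      and \<psi>: "\<And>z. Im z > 1 \<Longrightarrow> \<psi> (proj (mob K z)) = cusp_coord K z"
      unfolding cusp_charts_iff by blast
    have "proj z \<noteq> cusp_pt K" using cusp_pt_neq[OF K z(1)] by simp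
    then obtain z' where z': "Im z' > 1" "proj (mob K z') = proj z" using z(2) U c_eq by auto
    have Im: "Im (mob K z') > 0" using z' K by simp
    obtain A where A: "A \<in> lift_SL G" "z = mob A (mob K z')" using proj_eqE[OF z'(2) Im] .
    show ?thesis
    proof (rule that[of "A ** K" "{z. Im z > 1}" z' "cusp_coord K"])
      show "cusp_coord K holomorphic_on {z. Im z > 1}"
        unfolding cusp_coord_def[abs_def] by (intro holomorphic_intros) (use cusp_width_props(1)[OF K] in auto)
      show "z = mob (A ** K) z'" using A K z' by (simp add: mob_mult)
    next
      fix w assume w: "w \<in> {z. Im z > 1}"
      then have "proj (mob (A ** K) w) = proj (mob K w)"
        using A K by (simp add: mob_mult proj_mob)
      then show "proj (mob (A ** K) w) \<in> fst c \<and> snd c (proj (mob (A ** K) w)) = cusp_coord K w"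
        using w \<psi> U c_eq by auto
    next
      assume "deriv (cusp_coord K) z' = 0"
      moreover have "deriv (cusp_coord K) z' \<noteq> 0"
        using DERIV_imp_deriv[OF cusp_coord_has_field_derivative[of K z']] cusp_width_props(1)[OF K]
        by (simp add: cusp_coord_nonzero)
      ultimately show "\<exists>A\<in>fixers z. rotation z A \<noteq> 1" by simp
    qed (use A K z' in \<open>auto simp: det_mul open_halfspace_Im_gt\<close>)
  qed
qed

text \<open>The coordinate of a chart, read as a function on the half-plane. It is only meaningful at the
  points whose orbit lies in the domain of the chart.\<close>

definition chart_map :: "modular_point chart \<Rightarrow> complex \<Rightarrow> complex" where
  "chart_map c z = snd c (proj z)"

lemma chart_map_nbhd:
  assumes c: "c \<in> modular_atlas G" and z: "Im z > 0" "proj z \<in> fst c"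
  obtains N where "open N" "z \<in> N" "N \<subseteq> upper_half_plane" "\<And>w. w \<in> N \<Longrightarrow> proj w \<in> fst c"
    "chart_map c holomorphic_on N" "deriv (chart_map c) z = 0 \<Longrightarrow> \<exists>A\<in>fixers z. rotation z A \<noteq> 1"
proof -
  obtain M D E z' where M: "det M = 1" and D: "open D" "D \<subseteq> upper_half_plane" "z' \<in> D" and zz': "z = mob M z'"
    and E: "E holomorphic_on D" "\<And>w. w \<in> D \<Longrightarrow> proj (mob M w) \<in> fst c \<and> snd c (proj (mob M w)) = E w"
    "deriv E z' = 0 \<Longrightarrow> \<exists>A\<in>fixers z. rotation z A \<noteq> 1"
    by (rule chart_local[OF assms]) blast
  define N where "N = mob (adj2 M) -` D \<inter> upper_half_plane"
  have M': "det (adj2 M) = 1" using M by simp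
  have z': "mob (adj2 M) z = z'" using zz' M D by auto
  have oN: "open N" unfolding N_def
    using continuous_on_open_vimage[OF open_H] holomorphic_on_imp_continuous_on[OF mob_holomorphic[OF M']] D(1) by blast
  have zN: "z \<in> N" using z(1) z' D by (simp add: N_def)
  have u: "proj w \<in> fst c" "chart_map c w = (E \<circ> mob (adj2 M)) w" if "w \<in> N" for w
    using E(2)[of "mob (adj2 M) w"] that M by (auto simp: N_def chart_map_def)
  have holo: "(E \<circ> mob (adj2 M)) holomorphic_on N"
    by (rule holomorphic_on_compose_gen[OF holomorphic_on_subset[OF mob_holomorphic[OF M']] E(1)])
       (auto simp: N_def)
  have "chart_map c holomorphic_on N" using holo by (rule holomorphic_transform) (simp only: u(2))
  moreover have "deriv (chart_map c) z = deriv E z' * (1 / (aut (adj2 M) z)\<^sup>2)"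
  proof -
    have "(E has_field_derivative deriv E z') (at (mob (adj2 M) z))"
      unfolding z' by (rule holomorphic_derivI[OF E(1) D(1,3)])
    then have "(E \<circ> mob (adj2 M) has_field_derivative deriv E z' * (1 / (aut (adj2 M) z)\<^sup>2)) (at z)"
      by (rule DERIV_chain) (rule mob_has_field_derivative[OF M'], use z(1) in simp)
    then have "(chart_map c has_field_derivative deriv E z' * (1 / (aut (adj2 M) z)\<^sup>2)) (at z)"
      by (rule has_field_derivative_transform_within_open[OF _ oN zN]) (simp only: u(2))
    then show ?thesis by (rule DERIV_imp_deriv)
  qed
  moreover have "aut (adj2 M) z \<noteq> 0" using aut_nonzero[OF M'] z(1) by simp
  ultimately show ?thesis using that[of N] oN zN u(1) E(3) by (auto simp: N_def)
qed

lemma chart_map_mob: "A \<in> lift_SL G \<Longrightarrow> Im z > 0 \<Longrightarrow> chart_map c (mob A z) = chart_map c z"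
  by (simp add: chart_map_def proj_mob)

lemma chart_map_has_field_derivative:
  assumes "c \<in> modular_atlas G" "Im z > 0" "proj z \<in> fst c"
  shows "(chart_map c has_field_derivative deriv (chart_map c) z) (at z)"
  using chart_map_nbhd[OF assms] holomorphic_derivI by metis

lemma deriv_chart_map_mob:
  assumes "c \<in> modular_atlas G" "Im z > 0" "proj z \<in> fst c" "A \<in> lift_SL G"
  shows "deriv (chart_map c) z = deriv (chart_map c) (mob A z) * (1 / (aut A z)\<^sup>2)"
proof -
  have "(chart_map c has_field_derivative deriv (chart_map c) (mob A z)) (at (mob A z))"
    using assms by (intro chart_map_has_field_derivative) (auto simp: proj_mob)
  then have "(chart_map c \<circ> mob A has_field_derivative deriv (chart_map c) (mob A z) * (1 / (aut A z)\<^sup>2)) (at z)"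
    by (rule DERIV_chain) (rule mob_has_field_derivative, use assms in simp_all)
  then have "(chart_map c has_field_derivative deriv (chart_map c) (mob A z) * (1 / (aut A z)\<^sup>2)) (at z)"
    by (rule has_field_derivative_transform_within_open[OF _ open_H]) (use assms in \<open>simp_all add: chart_map_mob\<close>)
  then show ?thesis by (rule DERIV_imp_deriv)
qed

text \<open>An automorphism fixing \<open>z\<close> with derivative \<open>\<noteq> 1\<close> leaves the coordinate invariant, so that the
  derivative of the coordinate vanishes at \<open>z\<close>.\<close>

lemma deriv_chart_map_elliptic:
  assumes "c \<in> modular_atlas G" "Im z > 0" "proj z \<in> fst c" "A \<in> fixers z" "rotation z A \<noteq> 1"
  shows "deriv (chart_map c) z = 0"
proof -
  have A: "A \<in> lift_SL G" "mob A z = z" using assms by (auto simp: fixers_def)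
  have "deriv (chart_map c) z * (1 - rotation z A) = 0"
    using deriv_chart_map_mob[OF assms(1-3) A(1)] A(2) by (simp add: rotation_def algebra_simps)
  then show ?thesis using assms(5) by simp
qed

lemma chart_inj:
  assumes c: "c \<in> modular_atlas G" shows "inj_on (snd c) (fst c)"
proof -
  obtain U \<psi> where c_eq: "c = (U, \<psi>)" by (cases c)
  from c consider "(U, \<psi>) \<in> interior_charts G" | "(U, \<psi>) \<in> cusp_charts G"
    unfolding modular_atlas_def c_eq by blast
  then have "inj_on \<psi> U"
  proof cases
    case 1
    then obtain z0 r where z0: "Im z0 > 0" and U: "U = proj ` hyp_disc z0 r"
      and \<psi>: "\<And>z. z \<in> hyp_disc z0 r \<Longrightarrow> \<psi> (proj z) = cayley z0 z ^ stab_order z0"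
      unfolding interior_charts_iff by blast
    have "proj z = proj w" if zw: "z \<in> hyp_disc z0 r" "w \<in> hyp_disc z0 r" and eq: "cayley z0 z ^ stab_order z0 = cayley z0 w ^ stab_order z0" for z w
    proof -
      have Im: "Im z > 0" "Im w > 0" using zw by (auto simp: hyp_disc_def)
      have "\<exists>\<zeta>. cayley z0 w = \<zeta> * cayley z0 z \<and> \<zeta> ^ stab_order z0 = 1"
      proof (cases "cayley z0 z = 0")
        case True
        then have "cayley z0 w = 0" using eq stab_order_pos[OF z0] by (simp add: zero_power power_eq_0_iff)
        then show ?thesis using True by (intro exI[of _ 1]) simp
      next
        case False
        then have "cayley z0 w ^ stab_order z0 \<noteq> 0" using eq by (metis power_not_zero)
        then show ?thesis using False eq by (intro exI[of _ "cayley z0 w / cayley z0 z"]) (simp add: power_divide)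
      qed
      then obtain \<zeta> where \<zeta>: "cayley z0 w = \<zeta> * cayley z0 z" "\<zeta> ^ stab_order z0 = 1" by blast
      obtain A where A: "A \<in> fixers z0" "rotation z0 A = \<zeta>" by (rule rotation_roots_of_unity[OF z0 \<zeta>(2)])
      then have A': "A \<in> lift_SL G" "mob A z0 = z0" by (auto simp: fixers_def)
      have "cayley z0 (mob A z) = cayley z0 w"
        using cayley_mob_fixed[of A z0 z] A' A(2) \<zeta>(1) z0 Im by simp
      then have "mob A z = w" using cayley_inj[OF z0, of "mob A z" w] Im A' by simp
      then show ?thesis using proj_mob[OF A'(1) Im(1)] by simp
    qed
    note * = this
    show ?thesis
    proof (rule inj_onI)
      fix x y assume xy: "x \<in> U" "y \<in> U" "\<psi> x = \<psi> y"
      obtain z w where "z \<in> hyp_disc z0 r" "w \<in> hyp_disc z0 r" "x = proj z" "y = proj w"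
        using xy(1,2) unfolding U by blast
      then show "x = y" using *[of z w] xy(3) \<psi> by simp
    qed
  next
    case 2
    then obtain K where K: "det K = 1" and U: "U = insert (cusp_pt K) ((\<lambda>z. proj (mob K z)) ` {z. Im z > 1})"
      and \<psi>: "\<psi> (cusp_pt K) = 0" "\<And>z. Im z > 1 \<Longrightarrow> \<psi> (proj (mob K z)) = cusp_coord K z"
      unfolding cusp_charts_iff by blast
    have "proj (mob K z) = proj (mob K w)" if "Im z > 1" "Im w > 1" "cusp_coord K z = cusp_coord K w" for z w
      using horoball_equiv[OF K that(1,2)] cusp_coord_eq_iff[OF K] that(3) by simp
    note * = this
    have "inj_on \<psi> ((\<lambda>z. proj (mob K z)) ` {z. Im z > 1})"
    proof (rule inj_onI, elim imageE)
      fix x y z w assume "x = proj (mob K z)" "z \<in> {z. Im z > 1}" "y = proj (mob K w)" "w \<in> {z. Im z > 1}" "\<psi> x = \<psi> y"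
      then show "x = y" using *[of z w] \<psi>(2) by simp
    qed
    moreover have "\<psi> (cusp_pt K) \<notin> \<psi> ` ((\<lambda>z. proj (mob K z)) ` {z. Im z > 1})"
    proof
      assume "\<psi> (cusp_pt K) \<in> \<psi> ` ((\<lambda>z. proj (mob K z)) ` {z. Im z > 1})"
      then obtain z where "Im z > 1" "\<psi> (cusp_pt K) = \<psi> (proj (mob K z))" by blast
      then show False using \<psi> cusp_coord_nonzero[of K z] by simp
    qed
    ultimately show ?thesis unfolding U inj_on_insert
      using inj_on_subset by blast
  qed
  then show ?thesis by (simp add: c_eq)
qed

text \<open>The coefficient \<open>f\<close> of the pullback \<open>f(z) dz\<close> of a differential to the half-plane.\<close>

definition pullback_coeff :: "modular_differential \<Rightarrow> complex \<Rightarrow> complex" where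
  "pullback_coeff \<omega> = pullback (modular_atlas G) proj \<omega>"

text \<open>The pullback may be computed in any chart around the point, not only in the one that the
  definition selects. Where the selected coordinate has a non-zero derivative it has a local
  inverse, and the transition function of the two charts can be differentiated; elsewhere the
  point is elliptic and both expressions vanish.\<close>

lemma pullback_coeff_eq:
  assumes \<omega>: "\<omega> \<in> modular_differentials G" and d: "d \<in> modular_atlas G" and z: "Im z > 0" "proj z \<in> fst d"
  shows "pullback_coeff \<omega> z = \<omega> d (chart_map d z) * deriv (chart_map d) z"
proof -
  define c where "c = (SOME c. c \<in> modular_atlas G \<and> proj z \<in> fst c)"
  have c: "c \<in> modular_atlas G \<and> proj z \<in> fst c"
    unfolding c_def by (rule someI[of _ d]) (use d z in simp)
  have f: "pullback_coeff \<omega> z = \<omega> c (chart_map c z) * deriv (chart_map c) z"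
    unfolding pullback_coeff_def pullback_def c_def[symmetric] Let_def chart_map_def[abs_def] ..
  obtain N1 where N1: "open N1" "z \<in> N1" "N1 \<subseteq> upper_half_plane" "\<And>w. w \<in> N1 \<Longrightarrow> proj w \<in> fst c"
    "chart_map c holomorphic_on N1" "deriv (chart_map c) z = 0 \<Longrightarrow> \<exists>A\<in>fixers z. rotation z A \<noteq> 1"
    using c z(1) by (elim conjE) (rule chart_map_nbhd, auto)
  obtain N2 where N2: "open N2" "z \<in> N2" "N2 \<subseteq> upper_half_plane" "\<And>w. w \<in> N2 \<Longrightarrow> proj w \<in> fst d"
    "chart_map d holomorphic_on N2"
    using chart_map_nbhd[OF d z] by metis
  show ?thesis
  proof (cases "deriv (chart_map c) z = 0")
    case True
    then obtain A where "A \<in> fixers z" "rotation z A \<noteq> 1" using N1(6) by blast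
    then have "deriv (chart_map d) z = 0" using deriv_chart_map_elliptic[OF d z] by blast
    then show ?thesis using f True by simp
  next
    case False
    define T where "T = (\<lambda>w. snd d (inv_into (fst c) (snd c) w))"
    have trans: "\<omega> c (snd c p) = \<omega> d (snd d p) * deriv T (snd c p)" if "p \<in> fst c \<inter> fst d" for p
      using \<omega> c d that unfolding modular_differentials_def holomorphic_differentials_def T_def by blast
    have holc: "chart_map c holomorphic_on N1 \<inter> N2" by (rule holomorphic_on_subset[OF N1(5)]) simp
    obtain r where r: "r > 0" "ball z r \<subseteq> N1 \<inter> N2" "open (chart_map c ` ball z r)" "inj_on (chart_map c) (ball z r)"
      by (rule has_complex_derivative_locally_invertible[OF holc _ _ False]) (use N1 N2 in auto)
    obtain g where g: "g holomorphic_on (chart_map c ` ball z r)"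
      "\<And>w. w \<in> ball z r \<Longrightarrow> deriv (chart_map c) w * deriv g (chart_map c w) = 1"
      "\<And>w. w \<in> ball z r \<Longrightarrow> g (chart_map c w) = w"
      using holomorphic_has_inverse[OF holomorphic_on_subset[OF holc r(2)] open_ball r(4)] by metis
    have zb: "z \<in> ball z r" using r by simp
    have T: "(chart_map d \<circ> g) v = T v" if v: "v \<in> chart_map c ` ball z r" for v
    proof -
      obtain w where w: "w \<in> ball z r" "v = chart_map c w" using v by blast
      have "proj w \<in> fst c" using w r(2) N1(4) by blast
      then have "T v = snd d (proj w)"
        unfolding T_def w(2) chart_map_def using chart_inj c by (simp add: inv_into_f_f)
      then show ?thesis using g(3)[OF w(1)] w by (simp add: chart_map_def)
    qed
    have "(g has_field_derivative deriv g (chart_map c z)) (at (chart_map c z))"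
      by (rule holomorphic_derivI[OF g(1) r(3)]) (use zb in simp)
    moreover have "(chart_map d has_field_derivative deriv (chart_map d) z) (at (g (chart_map c z)))"
      unfolding g(3)[OF zb] by (rule chart_map_has_field_derivative[OF d z])
    ultimately have "(chart_map d \<circ> g has_field_derivative deriv (chart_map d) z * deriv g (chart_map c z)) (at (chart_map c z))"
      by (intro DERIV_chain)
    then have "(T has_field_derivative deriv (chart_map d) z * deriv g (chart_map c z)) (at (chart_map c z))"
      by (rule has_field_derivative_transform_within_open[OF _ r(3)]) (use zb T in auto)
    then have "deriv T (chart_map c z) = deriv (chart_map d) z * deriv g (chart_map c z)" by (rule DERIV_imp_deriv)
    then have "deriv T (chart_map c z) * deriv (chart_map c) z = deriv (chart_map d) z * (deriv (chart_map c) z * deriv g (chart_map c z))"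
      by simp
    also have "\<dots> = deriv (chart_map d) z" by (simp only: g(2)[OF zb] mult_1_right)
    finally have "deriv T (chart_map c z) * deriv (chart_map c) z = deriv (chart_map d) z" .
    moreover have "\<omega> c (chart_map c z) = \<omega> d (chart_map d z) * deriv T (chart_map c z)"
      using trans[of "proj z"] c z unfolding chart_map_def by blast
    ultimately show ?thesis using f by (simp add: mult.assoc)
  qed
qed

lemma pullback_coeff_holomorphic:
  assumes \<omega>: "\<omega> \<in> modular_differentials G"
  shows "pullback_coeff \<omega> holomorphic_on upper_half_plane"
  unfolding holomorphic_on_open[OF open_H]
proof
  fix z assume "z \<in> upper_half_plane"
  then have z: "Im z > 0" by simp
  obtain d where d: "d \<in> modular_atlas G" "proj z \<in> fst d" by (rule interior_chart_exists[OF z])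
  obtain N where N: "open N" "z \<in> N" "N \<subseteq> upper_half_plane" "\<And>w. w \<in> N \<Longrightarrow> proj w \<in> fst d"
    "chart_map d holomorphic_on N"
    using chart_map_nbhd[OF d(1) z d(2)] by metis
  have "\<omega> d holomorphic_on (snd d ` fst d)"
    using \<omega> d unfolding modular_differentials_def holomorphic_differentials_def by blast
  then have "(\<omega> d \<circ> chart_map d) holomorphic_on N"
    by (rule holomorphic_on_compose_gen[OF N(5)]) (use N(4) in \<open>auto simp: chart_map_def\<close>)
  then have "(\<lambda>w. (\<omega> d \<circ> chart_map d) w * deriv (chart_map d) w) holomorphic_on N"
    by (intro holomorphic_intros holomorphic_deriv N(5,1))
  then have "pullback_coeff \<omega> holomorphic_on N"
  proof (rule holomorphic_transform)
    fix w assume "w \<in> N"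
    then show "(\<omega> d \<circ> chart_map d) w * deriv (chart_map d) w = pullback_coeff \<omega> w"
      using pullback_coeff_eq[OF \<omega> d(1), of w] N(3,4) by auto
  qed
  then show "\<exists>f'. (pullback_coeff \<omega> has_field_derivative f') (at z)"
    using N(1,2) holomorphic_derivI by blast
qed

lemma pullback_coeff_mob:
  assumes \<omega>: "\<omega> \<in> modular_differentials G" and z: "Im z > 0" and A: "A \<in> lift_SL G"
  shows "pullback_coeff \<omega> (mob A z) * (1 / (aut A z)\<^sup>2) = pullback_coeff \<omega> z"
proof -
  obtain d where d: "d \<in> modular_atlas G" "proj z \<in> fst d" by (rule interior_chart_exists[OF z])
  have "pullback_coeff \<omega> (mob A z) = \<omega> d (chart_map d z) * deriv (chart_map d) (mob A z)"
    using pullback_coeff_eq[OF \<omega> d(1), of "mob A z"] A z d(2) by (simp add: proj_mob chart_map_mob)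
  then show ?thesis
    using pullback_coeff_eq[OF \<omega> d(1) z d(2)] deriv_chart_map_mob[OF d(1) z d(2) A] by simp
qed

text \<open>Near a cusp the pullback is \<open>h(q) dq\<close> with \<open>h\<close> holomorphic on a disc around \<open>0\<close>.\<close>

lemma pullback_coeff_cusp:
  assumes \<omega>: "\<omega> \<in> modular_differentials G" and K: "det K = 1"
  obtains h \<rho> where "\<rho> > 0" "h holomorphic_on ball 0 \<rho>"
    "\<And>z. Im z > 1 \<Longrightarrow> cusp_coord K z \<in> ball 0 \<rho>"
    "\<And>z. Im z > 1 \<Longrightarrow> pullback_coeff \<omega> (mob K z) * (1 / (aut K z)\<^sup>2) = h (cusp_coord K z) * deriv (cusp_coord K) z"
proof -
  obtain d where d: "d \<in> modular_atlas G" 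
    "fst d = insert (cusp_pt K) ((\<lambda>z. proj (mob K z)) ` {z. Im z > 1})"
    "snd d (cusp_pt K) = 0" "\<And>z. Im z > 1 \<Longrightarrow> snd d (proj (mob K z)) = cusp_coord K z"
    by (rule cusp_chart_exists[OF K]) blast
  define w where "w = real (cusp_width G (psl K))"
  have w: "w > 0" using cusp_width_props(1)[OF K] by (simp add: w_def)
  have qnorm: "cmod (cusp_coord K z) = exp (- (2 * pi * Im z / w))" for z
    by (simp add: cusp_coord_def w_def norm_exp_eq_Re)
  define \<rho> where "\<rho> = exp (- (2 * pi / w))"
  have in_ball: "cusp_coord K z \<in> ball 0 \<rho>" if "Im z > 1" for z
    using that w by (simp add: qnorm \<rho>_def divide_strict_right_mono)
  have "ball 0 \<rho> \<subseteq> snd d ` fst d"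
  proof
    fix q :: complex assume q: "q \<in> ball 0 \<rho>"
    show "q \<in> snd d ` fst d"
    proof (cases "q = 0")
      case True then show ?thesis using d by force
    next
      case False
      \<comment> \<open>the logarithm inverts the coordinate\<close>
      define z where "z = of_real w * Ln q / (2 * of_real pi * \<i>)"
      have "cusp_coord K z = exp (Ln q)" using w unfolding cusp_coord_def z_def w_def by simp
      then have z: "cusp_coord K z = q" using False by simp
      then have "exp (- (2 * pi * Im z / w)) < exp (- (2 * pi / w))" using q qnorm[of z] by (simp add: \<rho>_def)
      then have "Im z > 1" using w by (simp add: divide_less_cancel)
      then show ?thesis using d z by force
    qed
  qed
  moreover have "\<omega> d holomorphic_on (snd d ` fst d)"
    using \<omega> d unfolding modular_differentials_def holomorphic_differentials_def by blast
  ultimately have hol: "\<omega> d holomorphic_on ball 0 \<rho>" by (rule holomorphic_on_subset[rotated])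
  show ?thesis
  proof (rule that[OF _ hol in_ball])
    fix z assume z: "Im z > 1"
    have Kz: "Im (mob K z) > 0" "proj (mob K z) \<in> fst d" using z K d by auto
    have u: "chart_map d (mob K v) = cusp_coord K v" if "Im v > 1" for v using d(4) that by (simp add: chart_map_def)
    have "(chart_map d \<circ> mob K has_field_derivative deriv (chart_map d) (mob K z) * (1 / (aut K z)\<^sup>2)) (at z)"
      by (rule DERIV_chain[OF chart_map_has_field_derivative[OF d(1) Kz] mob_has_field_derivative[OF K]]) (use z in simp)
    then have "(cusp_coord K has_field_derivative deriv (chart_map d) (mob K z) * (1 / (aut K z)\<^sup>2)) (at z)"
      by (rule has_field_derivative_transform_within_open[OF _ open_halfspace_Im_gt[of 1]]) (use z u in auto)
    then have "deriv (cusp_coord K) z = deriv (chart_map d) (mob K z) * (1 / (aut K z)\<^sup>2)" by (rule DERIV_imp_deriv)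
    then show "pullback_coeff \<omega> (mob K z) * (1 / (aut K z)\<^sup>2) = \<omega> d (cusp_coord K z) * deriv (cusp_coord K) z"
      using pullback_coeff_eq[OF \<omega> d(1) Kz] u[OF z] by simp
  qed (simp_all add: \<rho>_def)
qed

end

section \<open>Geodesics and their endpoints\<close>

text \<open>Convergence in the sphere of a path in the plane, in terms of the usual filters.\<close>

lemma filterlim_sphere_iff:
  "filterlim (\<lambda>t. Some (f t)) (sphere_nhds p) F \<longleftrightarrow>
     (case p of None \<Rightarrow> filterlim f at_infinity F | Some z \<Rightarrow> (f \<longlongrightarrow> z) F)"
proof (cases p)
  case (Some z)
  have "(\<forall>P. eventually (\<lambda>x. P (Some x)) (nhds z) \<longrightarrow> eventually (\<lambda>t. P (Some (f t))) F) \<longleftrightarrow>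
        (\<forall>Q. eventually Q (nhds z) \<longrightarrow> eventually (\<lambda>t. Q (f t)) F)" (is "?L \<longleftrightarrow> ?R")
  proof
    assume L: ?L
    show ?R
    proof (intro allI impI)
      fix Q assume "eventually Q (nhds z)"
      then show "eventually (\<lambda>t. Q (f t)) F" using L[rule_format, of "\<lambda>p. Q (the p)"] by simp
    qed
  qed blast
  then show ?thesis
    by (simp add: Some sphere_nhds_def filterlim_iff eventually_filtermap)
next
  case None
  have "(\<forall>P. P None \<and> eventually (\<lambda>x. P (Some x)) at_infinity \<longrightarrow> eventually (\<lambda>t. P (Some (f t))) F) \<longleftrightarrow>
        (\<forall>Q. eventually Q at_infinity \<longrightarrow> eventually (\<lambda>t. Q (f t)) F)" (is "?L \<longleftrightarrow> ?R")
  proof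
    assume L: ?L
    show ?R
    proof (intro allI impI)
      fix Q assume "eventually Q (at_infinity :: complex filter)"
      then show "eventually (\<lambda>t. Q (f t)) F"
        using L[rule_format, of "case_option True Q"] by simp
    qed
  qed blast
  then show ?thesis
    by (simp add: None sphere_nhds_def filterlim_iff eventually_filtermap eventually_sup eventually_principal)
qed

lemma sphere_limit_unique:
  assumes "filterlim (\<lambda>t. Some (f t)) (sphere_nhds p) F" "filterlim (\<lambda>t. Some (f t)) (sphere_nhds q) F" "F \<noteq> bot"
  shows "p = q"
  using assms not_tendsto_and_filterlim_at_infinity[OF assms(3), of f] tendsto_unique[OF assms(3), of f]
  unfolding filterlim_sphere_iff by (auto split: option.splits)

text \<open>The image of \<open>t \<mapsto> \<i> e\<^sup>t\<close> under a real matrix. If the determinant is \<open>1\<close>, it is a geodesic from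
  \<open>b/d\<close> to \<open>a/c\<close>.\<close>

definition real_geodesic :: "real \<Rightarrow> real \<Rightarrow> real \<Rightarrow> real \<Rightarrow> real \<Rightarrow> complex" where
  "real_geodesic a b c d t = (of_real a * (\<i> * of_real (exp t)) + of_real b) / (of_real c * (\<i> * of_real (exp t)) + of_real d)"

lemma geodesic_iff_real_geodesic: "geodesic \<gamma> \<longleftrightarrow> (\<exists>a b c d. a * d - b * c = 1 \<and> \<gamma> = real_geodesic a b c d)"
  unfolding geodesic_def real_geodesic_def[abs_def] ..

lemma real_geodesic_denom_nonzero:
  assumes "a * d - b * c = (1::real)"
  shows "of_real c * (\<i> * of_real (exp t)) + of_real d \<noteq> (0::complex)"
  using assms by (auto simp: complex_eq_iff)

lemma geodesic_in_H: "geodesic \<gamma> \<Longrightarrow> Im (\<gamma> t) > 0"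
  using geodesic_unit_speed(1) by (simp add: upper_half_plane_def)

lemma mob_real_geodesic:
  assumes "det A = 1" "a * d - b * c = 1"
  shows "mob A (real_geodesic a b c d t) = real_geodesic (of_int (A$1$1) * a + of_int (A$1$2) * c) (of_int (A$1$1) * b + of_int (A$1$2) * d)
     (of_int (A$2$1) * a + of_int (A$2$2) * c) (of_int (A$2$1) * b + of_int (A$2$2) * d) t"
proof -
  define x :: complex where "x = of_real a * (\<i> * of_real (exp t)) + of_real b"
  define y :: complex where "y = of_real c * (\<i> * of_real (exp t)) + of_real d"
  have y: "y \<noteq> 0" unfolding y_def by (rule real_geodesic_denom_nonzero[OF assms(2)])
  have "mob A (real_geodesic a b c d t) = (of_int (A$1$1) * (x / y) + of_int (A$1$2)) / (of_int (A$2$1) * (x / y) + of_int (A$2$2))"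
    by (simp add: real_geodesic_def mob_def aut_def x_def y_def)
  also have "\<dots> = ((of_int (A$1$1) * x + of_int (A$1$2) * y) / y) / ((of_int (A$2$1) * x + of_int (A$2$2) * y) / y)"
    using y by (simp add: add_divide_distrib)
  also have "\<dots> = (of_int (A$1$1) * x + of_int (A$1$2) * y) / (of_int (A$2$1) * x + of_int (A$2$2) * y)" using y by simp
  finally show ?thesis
    unfolding real_geodesic_def x_def y_def by (simp add: algebra_simps)
qed

lemma geodesic_mob:
  assumes "geodesic \<gamma>" "det A = 1" shows "geodesic (\<lambda>t. mob A (\<gamma> t))"
proof -
  obtain a b c d where det: "a * d - b * c = 1" and \<gamma>: "\<gamma> = real_geodesic a b c d"
    using assms(1) geodesic_iff_real_geodesic by auto
  define a1 b1 c1 d1 :: real where "a1 = of_int (A$1$1)" "b1 = of_int (A$1$2)" "c1 = of_int (A$2$1)" "d1 = of_int (A$2$2)"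
  note A = this
  have det1: "a1 * d1 - b1 * c1 = 1" unfolding A by (rule of_int_det2[OF assms(2)])
  have "(\<lambda>t. mob A (\<gamma> t)) = real_geodesic (a1 * a + b1 * c) (a1 * b + b1 * d) (c1 * a + d1 * c) (c1 * b + d1 * d)"
    unfolding \<gamma> A by (rule ext) (rule mob_real_geodesic[OF assms(2) det])
  moreover have "(a1 * a + b1 * c) * (c1 * b + d1 * d) - (a1 * b + b1 * d) * (c1 * a + d1 * c) = (a1 * d1 - b1 * c1) * (a * d - b * c)"
    by (simp add: algebra_simps)
  then have "(a1 * a + b1 * c) * (c1 * b + d1 * d) - (a1 * b + b1 * d) * (c1 * a + d1 * c) = 1"
    by (simp only: det det1)
  ultimately show ?thesis unfolding geodesic_iff_real_geodesic by blast
qed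

text \<open>Reversal of time reduces the statements about the starting point to those about the end
  point.\<close>

lemma real_geodesic_minus: "real_geodesic a b c d (- t) = real_geodesic b (- a) d (- c) t"
proof -
  define E :: complex where "E = \<i> * of_real (exp t)"
  have E: "E \<noteq> 0" by (simp add: E_def)
  have m: "\<i> * of_real (exp (- t)) = - 1 / E" by (simp add: E_def exp_minus field_simps)
  have "real_geodesic a b c d (- t) = (of_real a * (- 1 / E) + of_real b) / (of_real c * (- 1 / E) + of_real d)"
    unfolding real_geodesic_def m ..
  also have "\<dots> = ((of_real b * E + of_real (- a)) / E) / ((of_real d * E + of_real (- c)) / E)"
    using E by (simp add: field_simps)
  also have "\<dots> = (of_real b * E + of_real (- a)) / (of_real d * E + of_real (- c))" using E by simp
  finally show ?thesis by (simp add: real_geodesic_def E_def)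
qed

lemma geodesic_reverse: "geodesic \<gamma> \<Longrightarrow> geodesic (\<lambda>t. \<gamma> (- t))"
proof -
  assume "geodesic \<gamma>"
  then obtain a b c d where det: "a * d - b * c = 1" and \<gamma>: "\<gamma> = real_geodesic a b c d"
    using geodesic_iff_real_geodesic by auto
  show ?thesis unfolding geodesic_iff_real_geodesic \<gamma> using det
    by (intro exI[of _ b] exI[of _ "-a"] exI[of _ d] exI[of _ "-c"]) (auto simp: real_geodesic_minus algebra_simps)
qed

lemma real_geodesic_limit:
  assumes "a * d - b * c = 1"
  shows "filterlim (\<lambda>t. Some (real_geodesic a b c d t)) (sphere_nhds (hom_pt (of_real a) (of_real c))) at_top"
proof (cases "c = 0")
  case True
  then have ad: "a * d = 1" using assms by simp
  then have d: "a \<noteq> 0" "d \<noteq> 0" by auto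
  have "filterlim (\<lambda>t. norm (of_real (a / d) * (\<i> * of_real (exp t)) :: complex)) at_top at_top"
  proof -
    have "filterlim (\<lambda>t. \<bar>a / d\<bar> * exp t) at_top at_top"
      by (rule filterlim_tendsto_pos_mult_at_top[OF tendsto_const _ exp_at_top]) (use d in simp)
    then show ?thesis by (simp add: norm_mult norm_divide)
  qed
  then have "filterlim (\<lambda>t. of_real (a / d) * (\<i> * of_real (exp t)) :: complex) at_infinity at_top"
    by (rule filterlim_norm_at_top_imp_at_infinity)
  then have "filterlim (\<lambda>t. of_real (b / d) + of_real (a / d) * (\<i> * of_real (exp t)) :: complex) at_infinity at_top"
    by (rule tendsto_add_filterlim_at_infinity[OF tendsto_const])
  moreover have "real_geodesic a b c d t = of_real (b / d) + of_real (a / d) * (\<i> * of_real (exp t))" for t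
    using True d by (simp add: real_geodesic_def field_simps)
  ultimately have "filterlim (real_geodesic a b c d) at_infinity at_top" by presburger
  then show ?thesis using True by (simp add: filterlim_sphere_iff hom_pt_def)
next
  case False
  have *: "real_geodesic a b c d t = of_real (a / c) - of_real (1 / c) * inverse (of_real d + of_real c * (\<i> * of_real (exp t)))" for t
  proof -
    define E :: complex where "E = \<i> * of_real (exp t)"
    have nz: "of_real c * E + of_real d \<noteq> 0" unfolding E_def by (rule real_geodesic_denom_nonzero[OF assms])
    have "b * c = a * d - 1" using assms by simp
    then have "complex_of_real (b * c) = of_real (a * d - 1)" by (rule arg_cong)
    then have "complex_of_real b * of_real c = of_real a * of_real d - 1" by simp
    then have "of_real c * (of_real a * E + of_real b) = of_real a * (of_real c * E + of_real d) - 1"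
      by (simp add: algebra_simps)
    then have "of_real a * E + of_real b = (of_real a * (of_real c * E + of_real d) - 1) / of_real c"
      using False by (simp add: field_simps)
    then have "(of_real a * E + of_real b) / (of_real c * E + of_real d) =
       of_real (a / c) - of_real (1 / c) * inverse (of_real d + of_real c * E)"
      using nz False by (simp add: diff_divide_distrib inverse_eq_divide add.commute)
    then show ?thesis by (simp add: real_geodesic_def E_def)
  qed
  have "filterlim (\<lambda>t. norm (of_real c * (\<i> * of_real (exp t)) :: complex)) at_top at_top"
  proof -
    have "filterlim (\<lambda>t. \<bar>c\<bar> * exp t) at_top at_top"
      by (rule filterlim_tendsto_pos_mult_at_top[OF tendsto_const _ exp_at_top]) (use False in simp)
    then show ?thesis by (simp add: norm_mult)
  qed
  then have "filterlim (\<lambda>t. of_real c * (\<i> * of_real (exp t)) :: complex) at_infinity at_top"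
    by (rule filterlim_norm_at_top_imp_at_infinity)
  then have "filterlim (\<lambda>t. of_real d + of_real c * (\<i> * of_real (exp t)) :: complex) at_infinity at_top"
    by (rule tendsto_add_filterlim_at_infinity[OF tendsto_const])
  then have "((\<lambda>t. inverse (of_real d + of_real c * (\<i> * of_real (exp t)) :: complex)) \<longlongrightarrow> 0) at_top"
    by (rule filterlim_compose[OF tendsto_inverse_0])
  then have "((\<lambda>t. of_real (a / c) - of_real (1 / c) * inverse (of_real d + of_real c * (\<i> * of_real (exp t)))) \<longlongrightarrow> (of_real (a / c) - of_real (1 / c) * 0 :: complex)) at_top"
    by (intro tendsto_intros)
  then have "(real_geodesic a b c d \<longlongrightarrow> of_real a / of_real c) at_top" by (simp add: *[abs_def])
  then show ?thesis using False by (simp add: filterlim_sphere_iff hom_pt_def)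
qed

lemma geodesic_reverse_point:
  "geodesic_point \<gamma> (-\<infinity>) p \<longleftrightarrow> geodesic_point (\<lambda>t. \<gamma> (- t)) \<infinity> p"
  by (simp add: geodesic_point_def filterlim_at_bot_mirror)

lemma geodesic_point_PInf: "geodesic_point \<gamma> \<infinity> p \<longleftrightarrow> filterlim (\<lambda>t. Some (\<gamma> t)) (sphere_nhds p) at_top"
  by (simp add: geodesic_point_def)

lemma geodesic_point_real: "geodesic_point \<gamma> (ereal t) p \<longleftrightarrow> p = Some (\<gamma> t)"
  by (simp add: geodesic_point_def)

lemma real_geodesic_endpoint:
  assumes "a * d - b * c = 1" "geodesic_point (real_geodesic a b c d) \<infinity> p"
  shows "p = hom_pt (of_real a) (of_real c)"
  using sphere_limit_unique[OF assms(2)[unfolded geodesic_point_PInf] real_geodesic_limit[OF assms(1)]] by simp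

lemma geodesic_point_unique:
  assumes "geodesic_point \<gamma> e p" "geodesic_point \<gamma> e q" shows "p = q"
  using assms sphere_limit_unique[of \<gamma> p at_top q] sphere_limit_unique[of \<gamma> p at_bot q]
  by (cases e) (auto simp: geodesic_point_def)

text \<open>The endpoints of a complete geodesic lie on the boundary.\<close>

lemma geodesic_endpoint_boundary:
  assumes "geodesic \<gamma>" "geodesic_point \<gamma> e (Some z)" "Im z \<noteq> 0"
  obtains t where "e = ereal t" "z = \<gamma> t"
proof -
  have *: False if g: "geodesic \<gamma>" and p: "geodesic_point \<gamma> \<infinity> (Some z)" for \<gamma>
  proof -
    obtain a b c d where det: "a * d - b * c = 1" and \<gamma>: "\<gamma> = real_geodesic a b c d"
      using g geodesic_iff_real_geodesic by auto
    have "Some z = hom_pt (of_real a) (of_real c)" using real_geodesic_endpoint[OF det] p \<gamma> by simp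
    then have "z = of_real (a / c)" by (simp add: hom_pt_def split: if_splits)
    then show False using assms(3) by simp
  qed
  show ?thesis
  proof (cases e)
    case (real t) then show ?thesis using that assms(2) by (simp add: geodesic_point_real)
  next
    case PInf then show ?thesis using * assms by auto
  next
    case MInf then show ?thesis
      using *[OF geodesic_reverse[OF assms(1)]] assms(2) by (simp add: geodesic_reverse_point)
  qed
qed

lemma real_geodesic_has_vector_derivative:
  assumes "a * d - b * c = 1"
  shows "(real_geodesic a b c d has_vector_derivative
     (\<i> * of_real (exp t) / (of_real c * (\<i> * of_real (exp t)) + of_real d)\<^sup>2)) (at t)"
proof -
  define E :: "real \<Rightarrow> complex" where "E t = \<i> * of_real (exp t)" for t
  have E: "(E has_vector_derivative \<i> * of_real (exp t)) (at t)"
    unfolding E_def by (auto intro!: derivative_eq_intros has_vector_derivative_real_field simp: has_real_derivative_iff_has_vector_derivative[symmetric])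
  have nz: "of_real c * E t + of_real d \<noteq> 0" unfolding E_def by (rule real_geodesic_denom_nonzero[OF assms])
  have "((\<lambda>w. (of_real a * w + of_real b) / (of_real c * w + of_real d)) has_field_derivative
    (of_real a * (of_real c * E t + of_real d) - (of_real a * E t + of_real b) * of_real c) /
      ((of_real c * E t + of_real d) * (of_real c * E t + of_real d))) (at (E t))"
    by (rule derivative_eq_intros refl | (use nz in simp))+
  moreover have "of_real a * (of_real c * E t + of_real d) - (of_real a * E t + of_real b) * of_real c = (of_real (a * d - b * c) :: complex)"
    by (simp add: algebra_simps)
  ultimately have "((\<lambda>w. (of_real a * w + of_real b) / (of_real c * w + of_real d)) has_field_derivative
    1 / (of_real c * E t + of_real d)\<^sup>2) (at (E t))"
    using assms by (simp add: power2_eq_square)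
  from field_vector_diff_chain_at[OF E this]
  show ?thesis by (simp add: E_def real_geodesic_def[abs_def] o_def)
qed

lemma geodesic_derivative:
  assumes "geodesic \<gamma>"
  obtains \<gamma>' where "\<And>t. (\<gamma> has_vector_derivative \<gamma>' t) (at t)" "continuous_on UNIV \<gamma>'"
proof -
  obtain a b c d where det: "a * d - b * c = 1" and \<gamma>: "\<gamma> = real_geodesic a b c d"
    using assms geodesic_iff_real_geodesic by auto
  show ?thesis
  proof (rule that)
    show "(\<gamma> has_vector_derivative (\<i> * of_real (exp t) / (of_real c * (\<i> * of_real (exp t)) + of_real d)\<^sup>2)) (at t)" for t
      unfolding \<gamma> by (rule real_geodesic_has_vector_derivative[OF det])
    show "continuous_on UNIV (\<lambda>t. \<i> * of_real (exp t) / (of_real c * (\<i> * of_real (exp t)) + of_real d)\<^sup>2 :: complex)"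
      using real_geodesic_denom_nonzero[OF det] by (intro continuous_intros) auto
  qed
qed

text \<open>A geodesic that ends at a cusp \<open>K(\<infinity>)\<close> is the image under \<open>K\<close> of a vertical line.\<close>

lemma geodesic_to_cusp:
  assumes "geodesic \<gamma>" and K: "det K = 1" and "geodesic_point \<gamma> \<infinity> (moebius K None)"
  obtains a b :: real where "a > 0" "\<And>t. \<gamma> t = mob K (of_real b + of_real a * (\<i> * of_real (exp t)))"
proof -
  have K': "det (adj2 K) = 1" using K by simp
  have g: "geodesic (\<lambda>t. mob (adj2 K) (\<gamma> t))" by (rule geodesic_mob[OF assms(1) K'])
  then obtain a b c d where det: "a * d - b * c = 1" and \<eta>: "(\<lambda>t. mob (adj2 K) (\<gamma> t)) = real_geodesic a b c d"
    using geodesic_iff_real_geodesic by auto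
  have \<gamma>: "\<gamma> t = mob K (real_geodesic a b c d t)" for t
    using mob_adj2(2)[OF K geodesic_in_H[OF assms(1)], of t] fun_cong[OF \<eta>, of t] by simp
  have "c = 0"
  proof (rule ccontr)
    assume c: "c \<noteq> 0"
    have lim: "(real_geodesic a b c d \<longlongrightarrow> of_real a / of_real c) at_top"
      using real_geodesic_limit[OF det] c by (simp add: filterlim_sphere_iff hom_pt_def)
    show False
    proof (cases "K$2$1 = 0")
      case True
      \<comment> \<open>\<open>K\<close> fixes \<open>\<infinity>\<close> and is affine\<close>
      then have kd: "K$2$2 \<noteq> 0" using K by (auto simp: det_2)
      have "(\<lambda>t. (of_int (K$1$1) * real_geodesic a b c d t + of_int (K$1$2)) / of_int (K$2$2)) = \<gamma>"
        using True by (simp add: fun_eq_iff \<gamma> mob_def aut_def)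
      moreover have "((\<lambda>t. (of_int (K$1$1) * real_geodesic a b c d t + of_int (K$1$2)) / of_int (K$2$2)) \<longlongrightarrow>
         (of_int (K$1$1) * (of_real a / of_real c) + of_int (K$1$2)) / of_int (K$2$2)) at_top"
        using kd by (intro tendsto_intros lim) simp
      ultimately have l: "(\<gamma> \<longlongrightarrow> (of_int (K$1$1) * (of_real a / of_real c) + of_int (K$1$2)) / of_int (K$2$2)) at_top" by simp
      have "moebius K None = None" using True by (simp add: moebius_def)
      then have "filterlim \<gamma> at_infinity at_top"
        using assms(3) by (simp add: geodesic_point_PInf filterlim_sphere_iff)
      then show False using not_tendsto_and_filterlim_at_infinity[OF _ l] by simp
    next
      case False
      define p :: complex where "p = of_int (K$1$1) / of_int (K$2$1)"
      have "moebius K None = Some p" using False by (simp add: moebius_def p_def)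
      then have "(\<gamma> \<longlongrightarrow> p) at_top" using assms(3) by (simp add: geodesic_point_PInf filterlim_sphere_iff)
      then have lp: "((\<lambda>t. (p - \<gamma> t) * aut K (real_geodesic a b c d t)) \<longlongrightarrow> (p - p) * aut K (of_real a / of_real c)) at_top"
        unfolding aut_def by (intro tendsto_intros lim)
      have "(p - \<gamma> t) * aut K (real_geodesic a b c d t) = 1 / of_int (K$2$1)" for t
      proof -
        have nz: "aut K (real_geodesic a b c d t) \<noteq> 0"
          using aut_nonzero[OF K] geodesic_in_H[OF g, of t] unfolding fun_cong[OF \<eta>, of t] by simp
        have "(p - \<gamma> t) * aut K (real_geodesic a b c d t) = p * aut K (real_geodesic a b c d t) - (of_int (K$1$1) * real_geodesic a b c d t + of_int (K$1$2))"
          using nz unfolding \<gamma> mob_def by (simp add: field_simps)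
        also have "\<dots> = (of_int (K$1$1) * of_int (K$2$2) - of_int (K$1$2) * of_int (K$2$1)) / of_int (K$2$1)"
          using False unfolding p_def aut_def by (simp add: field_simps)
        finally show ?thesis by (simp only: of_int_det2[OF K])
      qed
      then have "((\<lambda>t. 1 / of_int (K$2$1)) \<longlongrightarrow> (p - p) * aut K (of_real a / of_real c)) (at_top :: real filter)"
        using lp by simp
      then have "1 / of_int (K$2$1) = (p - p) * aut K (of_real a / of_real c)"
        by (simp add: tendsto_const_iff)
      then show False using False by simp
    qed
  qed
  then have ad: "a * d = 1" using det by simp
  then have d: "d \<noteq> 0" by auto
  show ?thesis
  proof (rule that[of "a / d" "b / d"])
    have "a / d = a\<^sup>2" using ad d by (simp add: field_simps power2_eq_square)
    then show "a / d > 0" using ad by auto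
    show "\<gamma> t = mob K (of_real (b / d) + of_real (a / d) * (\<i> * of_real (exp t)))" for t
      using d \<open>c = 0\<close> unfolding \<gamma> by (simp add: real_geodesic_def add_divide_distrib add.commute)
  qed
qed

section \<open>Primitives and modular symbols\<close>

context modular_subgroup begin

text \<open>A primitive on the half-plane of the pullback of \<open>\<omega>\<close>.\<close>

definition primitive_of :: "modular_differential \<Rightarrow> (complex \<Rightarrow> complex) \<Rightarrow> bool" where
  "primitive_of \<omega> F \<longleftrightarrow> (\<forall>z. Im z > 0 \<longrightarrow> (F has_field_derivative pullback_coeff \<omega> z) (at z))"

lemma primitive_exists:
  assumes "\<omega> \<in> modular_differentials G" obtains F where "primitive_of \<omega> F"
proof -
  obtain F where "\<And>z. z \<in> upper_half_plane \<Longrightarrow> (F has_field_derivative pullback_coeff \<omega> z) (at z within upper_half_plane)"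
    using holomorphic_convex_primitive'[OF convex_H open_H pullback_coeff_holomorphic[OF assms]] by blast
  then show ?thesis using that[of F] at_within_open[OF _ open_H] by (simp add: primitive_of_def)
qed

text \<open>The period of \<open>A\<close> does not depend on the base point, because the pullback is invariant under
  \<open>A\<close>.\<close>

lemma primitive_mob:
  assumes \<omega>: "\<omega> \<in> modular_differentials G" and F: "primitive_of \<omega> F" and A: "A \<in> lift_SL G"
    and z: "Im z > 0" and w: "Im w > 0"
  shows "F (mob A z) - F z = F (mob A w) - F w"
proof -
  have "((\<lambda>z. F (mob A z) - F z) has_field_derivative 0) (at v within upper_half_plane)" if "v \<in> upper_half_plane" for v
  proof -
    have v: "Im v > 0" using that by simp
    have "(F has_field_derivative pullback_coeff \<omega> (mob A v)) (at (mob A v))"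
      using F v A unfolding primitive_of_def by simp
    then have "(F \<circ> mob A has_field_derivative pullback_coeff \<omega> (mob A v) * (1 / (aut A v)\<^sup>2)) (at v)"
      by (rule DERIV_chain) (rule mob_has_field_derivative, use A v in simp_all)
    then have "(F \<circ> mob A has_field_derivative pullback_coeff \<omega> v) (at v)" by (simp only: pullback_coeff_mob[OF \<omega> v A])
    moreover have "(F has_field_derivative pullback_coeff \<omega> v) (at v)" using F v by (simp add: primitive_of_def)
    ultimately have "((\<lambda>z. (F \<circ> mob A) z - F z) has_field_derivative pullback_coeff \<omega> v - pullback_coeff \<omega> v) (at v)"
      by (rule DERIV_diff)
    then show ?thesis by (simp add: has_field_derivative_at_within)
  qed
  then obtain C where "\<forall>v\<in>upper_half_plane. F (mob A v) - F v = C"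
    using has_field_derivative_zero_constant[OF convex_H] by blast
  then show ?thesis using z w by simp
qed

lemma norm_cusp_coord:
  "cmod (cusp_coord K z) = exp (- (2 * pi / real (cusp_width G (psl K)) * Im z))"
  by (simp add: cusp_coord_def norm_exp_eq_Re)

text \<open>In the coordinate \<open>q\<close> at a cusp, a primitive extends holomorphically to \<open>q = 0\<close>. Hence it has a
  limit along every approach to the cusp through shrinking horoballs.\<close>

lemma primitive_cusp_limit:
  assumes \<omega>: "\<omega> \<in> modular_differentials G" and F: "primitive_of \<omega> F" and K: "det K = 1"
  obtains l where "((\<lambda>z. F (mob K z)) \<longlongrightarrow> l) (filtercomap Im at_top)"
proof -
  obtain h \<rho> where h: "\<rho> > 0" "h holomorphic_on ball 0 \<rho>"
    "\<And>z. Im z > 1 \<Longrightarrow> cusp_coord K z \<in> ball 0 \<rho>"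
    "\<And>z. Im z > 1 \<Longrightarrow> pullback_coeff \<omega> (mob K z) * (1 / (aut K z)\<^sup>2) = h (cusp_coord K z) * deriv (cusp_coord K) z"
    using pullback_coeff_cusp[OF \<omega> K] by metis
  obtain \<Omega> where "\<And>q. q \<in> ball 0 \<rho> \<Longrightarrow> (\<Omega> has_field_derivative h q) (at q within ball 0 \<rho>)"
    using holomorphic_convex_primitive'[OF convex_ball open_ball h(2)] by blast
  then have \<Omega>: "(\<Omega> has_field_derivative h q) (at q)" if "q \<in> ball 0 \<rho>" for q
    using that at_within_open[OF that open_ball] by metis
  have "((\<lambda>z. F (mob K z) - \<Omega> (cusp_coord K z)) has_field_derivative 0) (at v within {z. Im z > 1})"
    if "v \<in> {z. Im z > 1}" for v
  proof -
    have v: "Im v > 1" using that by simp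
    have "(F has_field_derivative pullback_coeff \<omega> (mob K v)) (at (mob K v))"
      using F v K unfolding primitive_of_def by simp
    then have "(F \<circ> mob K has_field_derivative pullback_coeff \<omega> (mob K v) * (1 / (aut K v)\<^sup>2)) (at v)"
      by (rule DERIV_chain) (rule mob_has_field_derivative, use K v in simp_all)
    then have 1: "(F \<circ> mob K has_field_derivative h (cusp_coord K v) * deriv (cusp_coord K) v) (at v)"
      by (simp only: h(4)[OF v])
    have "(cusp_coord K has_field_derivative deriv (cusp_coord K) v) (at v)"
      using cusp_coord_has_field_derivative DERIV_imp_deriv by metis
    with \<Omega>[OF h(3)[OF v]] have "(\<Omega> \<circ> cusp_coord K has_field_derivative h (cusp_coord K v) * deriv (cusp_coord K) v) (at v)"
      by (rule DERIV_chain)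
    from DERIV_diff[OF 1 this] show ?thesis by (simp add: has_field_derivative_at_within)
  qed
  then obtain C where C: "\<forall>v\<in>{z. Im z > 1}. F (mob K v) - \<Omega> (cusp_coord K v) = C"
    using has_field_derivative_zero_constant[OF convex_halfspace_Im_gt] by blast
  define w where "w = 2 * pi / real (cusp_width G (psl K))"
  have w: "w > 0" using cusp_width_props(1)[OF K] by (simp add: w_def)
  have "filterlim (\<lambda>y. w * y) at_top at_top"
    by (rule filterlim_tendsto_pos_mult_at_top[OF tendsto_const w filterlim_ident])
  then have "((\<lambda>y. exp (- (w * y))) \<longlongrightarrow> 0) at_top"
    by (intro filterlim_compose[OF exp_at_bot]) (simp add: filterlim_uminus_at_top)
  then have "((\<lambda>z. cmod (cusp_coord K z)) \<longlongrightarrow> 0) (filtercomap Im at_top)"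
    unfolding norm_cusp_coord w_def[symmetric] by (rule filterlim_filtercomapI)
  then have q0: "(cusp_coord K \<longlongrightarrow> 0) (filtercomap Im at_top)" by (rule tendsto_norm_zero_cancel)
  have "isCont \<Omega> 0" using DERIV_isCont[OF \<Omega>[of 0]] h(1) by simp
  then have "((\<lambda>z. C + \<Omega> (cusp_coord K z)) \<longlongrightarrow> C + \<Omega> 0) (filtercomap Im at_top)"
    by (intro tendsto_intros isCont_tendsto_compose[OF _ q0])
  moreover have "eventually (\<lambda>z. F (mob K z) = C + \<Omega> (cusp_coord K z)) (filtercomap Im at_top)"
  proof -
    have "eventually (\<lambda>z. Im z > 1) (filtercomap Im at_top)"
      by (rule eventually_filtercomapI) (rule eventually_gt_at_top)
    then show ?thesis by eventually_elim (use C in \<open>auto simp: algebra_simps\<close>)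
  qed
  ultimately have "((\<lambda>z. F (mob K z)) \<longlongrightarrow> C + \<Omega> 0) (filtercomap Im at_top)"
    by (simp add: tendsto_cong)
  then show ?thesis by (rule that)
qed

lemma pullback_coeff_cusp_bound:
  assumes \<omega>: "\<omega> \<in> modular_differentials G" and K: "det K = 1"
  obtains B w where "w > 0" 
    "\<And>z. Im z \<ge> 2 \<Longrightarrow> cmod (pullback_coeff \<omega> (mob K z) * (1 / (aut K z)\<^sup>2)) \<le> B * exp (- (w * Im z))"
proof -
  obtain h \<rho> where h: "\<rho> > 0" "h holomorphic_on ball 0 \<rho>"
    "\<And>z. Im z > 1 \<Longrightarrow> cusp_coord K z \<in> ball 0 \<rho>"
    "\<And>z. Im z > 1 \<Longrightarrow> pullback_coeff \<omega> (mob K z) * (1 / (aut K z)\<^sup>2) = h (cusp_coord K z) * deriv (cusp_coord K) z"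
    using pullback_coeff_cusp[OF \<omega> K] by metis
  define w where "w = 2 * pi / real (cusp_width G (psl K))"
  have w: "w > 0" using cusp_width_props(1)[OF K] by (simp add: w_def)
  have qnorm: "cmod (cusp_coord K z) = exp (- (w * Im z))" for z by (simp add: norm_cusp_coord w_def)
  define r where "r = exp (- (w * 2))"
  \<comment> \<open>\<open>r\<close> is attained by the coordinate at \<open>2\<i>\<close>, which lies in the open disc\<close>
  have "r < \<rho>" using h(3)[of "2 * \<i>"] qnorm[of "2 * \<i>"] by (simp add: r_def)
  then have "continuous_on (cball 0 r) h"
    by (intro continuous_on_subset[OF holomorphic_on_imp_continuous_on[OF h(2)]]) auto
  then have "bounded (h ` cball 0 r)" by (intro compact_imp_bounded compact_continuous_image compact_cball)
  then obtain B where B: "\<And>q. q \<in> cball 0 r \<Longrightarrow> cmod (h q) \<le> B" unfolding bounded_iff by blast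
  have d: "cmod (deriv (cusp_coord K) z) = w * exp (- (w * Im z))" for z
  proof -
    have "deriv (cusp_coord K) z = 2 * of_real pi * \<i> / of_nat (cusp_width G (psl K)) * cusp_coord K z"
      by (rule DERIV_imp_deriv[OF cusp_coord_has_field_derivative])
    then show ?thesis by (simp add: norm_mult norm_divide qnorm) (simp add: w_def)
  qed
  show ?thesis
  proof (rule that[OF w])
    fix z assume z: "Im z \<ge> 2"
    have "cusp_coord K z \<in> cball 0 r" using w z by (simp add: qnorm r_def)
    then have "cmod (h (cusp_coord K z)) * (w * exp (- (w * Im z))) \<le> B * (w * exp (- (w * Im z)))"
      using B w by (intro mult_right_mono) auto
    then show "cmod (pullback_coeff \<omega> (mob K z) * (1 / (aut K z)\<^sup>2)) \<le> (B * w) * exp (- (w * Im z))"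
      using h(4)[of z] z by (simp add: norm_mult d mult.assoc)
  qed
qed

lemma vertical_line_tendsto:
  assumes "a > (0::real)"
  shows "filterlim (\<lambda>t. of_real b + of_real a * (\<i> * of_real (exp t))) (filtercomap Im at_top) at_top"
proof -
  have "filterlim (\<lambda>t. a * exp t) at_top at_top"
    by (rule filterlim_tendsto_pos_mult_at_top[OF tendsto_const assms exp_at_top])
  then show ?thesis by (simp add: filterlim_filtercomap_iff o_def)
qed

lemma primitive_along_geodesic:
  assumes "geodesic \<gamma>" "det K = 1" "geodesic_point \<gamma> \<infinity> (moebius K None)"
    "((\<lambda>z. F (mob K z)) \<longlongrightarrow> l) (filtercomap Im at_top)"
  shows "((\<lambda>t. F (\<gamma> t)) \<longlongrightarrow> l) at_top"
proof -
  obtain a b :: real where ab: "a > 0" "\<And>t. \<gamma> t = mob K (of_real b + of_real a * (\<i> * of_real (exp t)))"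
    using geodesic_to_cusp[OF assms(1-3)] by metis
  show ?thesis unfolding ab(2)
    by (rule filterlim_compose[OF assms(4) vertical_line_tendsto[OF ab(1)]])
qed

lemma set_integrable_exp_minus: "set_integrable lborel {T<..} (\<lambda>t::real. exp (- t))"
proof -
  have lim: "((\<lambda>t::real. - exp (- t)) \<longlongrightarrow> - 0) at_top"
    by (intro tendsto_minus filterlim_compose[OF exp_at_bot filterlim_uminus_at_bot_at_top])
  have "set_integrable lborel (einterval (ereal T) \<infinity>) (\<lambda>t::real. exp (- t))"
  proof (rule interval_integral_FTC_nonneg(1)[where F = "\<lambda>t. - exp (- t)" and A = "- exp (- T)" and B = 0])
    show "(((\<lambda>t. - exp (- t)) \<circ> real_of_ereal) \<longlongrightarrow> - exp (- T)) (at_right (ereal T))"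
      unfolding ereal_tendsto_simps by (intro tendsto_intros)
    show "(((\<lambda>t. - exp (- t)) \<circ> real_of_ereal) \<longlongrightarrow> 0) (at_left \<infinity>)"
      unfolding ereal_tendsto_simps using lim by simp
  qed (auto intro!: derivative_eq_intros continuous_intros)
  moreover have "einterval (ereal T) \<infinity> = {T<..}" by (auto simp: einterval_def)
  ultimately show ?thesis by simp
qed

text \<open>The integrand of the integral of the pullback along a geodesic.\<close>

definition geo_form :: "modular_differential \<Rightarrow> (real \<Rightarrow> complex) \<Rightarrow> real \<Rightarrow> complex" where
  "geo_form \<omega> \<gamma> t = pullback_coeff \<omega> (\<gamma> t) * vector_derivative \<gamma> (at t)"

lemma continuous_geo_form:
  assumes "\<omega> \<in> modular_differentials G" "geodesic \<gamma>"
  shows "continuous_on UNIV (geo_form \<omega> \<gamma>)"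
proof -
  obtain \<gamma>' where \<gamma>': "\<And>t. (\<gamma> has_vector_derivative \<gamma>' t) (at t)" "continuous_on UNIV \<gamma>'"
    by (rule geodesic_derivative[OF assms(2)]) blast
  have "vector_derivative \<gamma> (at t) = \<gamma>' t" for t using \<gamma>'(1) by (rule vector_derivative_at)
  then have eq: "geo_form \<omega> \<gamma> = (\<lambda>t. pullback_coeff \<omega> (\<gamma> t) * \<gamma>' t)" by (simp add: geo_form_def fun_eq_iff)
  have "continuous_on UNIV \<gamma>"
    using \<gamma>'(1) has_vector_derivative_continuous by (metis continuous_at_imp_continuous_on)
  then have "continuous_on UNIV (\<lambda>t. pullback_coeff \<omega> (\<gamma> t))"
    by (rule continuous_on_compose2[OF holomorphic_on_imp_continuous_on[OF pullback_coeff_holomorphic[OF assms(1)]]])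
       (auto simp: geodesic_in_H[OF assms(2)])
  then show ?thesis unfolding eq by (intro continuous_intros \<gamma>'(2))
qed

lemma primitive_has_vector_derivative:
  assumes F: "primitive_of \<omega> F" "geodesic \<gamma>"
  shows "((\<lambda>t. F (\<gamma> t)) has_vector_derivative geo_form \<omega> \<gamma> t) (at t)"
proof -
  obtain \<gamma>' where \<gamma>': "\<And>t. (\<gamma> has_vector_derivative \<gamma>' t) (at t)"
    by (rule geodesic_derivative[OF assms(2)]) blast
  have "(\<gamma> has_vector_derivative vector_derivative \<gamma> (at t)) (at t)"
    using \<gamma>' vector_derivative_at by metis
  moreover have "(F has_field_derivative pullback_coeff \<omega> (\<gamma> t)) (at (\<gamma> t))"
    using F geodesic_in_H by (simp add: primitive_of_def)
  ultimately have "(F \<circ> \<gamma> has_vector_derivative vector_derivative \<gamma> (at t) * pullback_coeff \<omega> (\<gamma> t)) (at t)"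
    by (rule field_vector_diff_chain_at)
  then show ?thesis by (simp add: geo_form_def o_def mult.commute)
qed

text \<open>The cuspidal decay makes the improper integral at a cusp converge absolutely.\<close>

lemma geo_form_integrable_at_cusp:
  assumes \<omega>: "\<omega> \<in> modular_differentials G" and g: "geodesic \<gamma>" and K: "det K = 1"
    and p: "geodesic_point \<gamma> \<infinity> (moebius K None)"
  obtains T where "set_integrable lborel {T<..} (geo_form \<omega> \<gamma>)"
proof -
  obtain a b :: real where ab: "a > 0" "\<And>t. \<gamma> t = mob K (of_real b + of_real a * (\<i> * of_real (exp t)))"
    using geodesic_to_cusp[OF g K p] by metis
  define \<eta> where "\<eta> t = of_real b + of_real a * (\<i> * complex_of_real (exp t))" for t
  have \<gamma>: "\<gamma> = (\<lambda>t. mob K (\<eta> t))" using ab(2) by (simp add: fun_eq_iff \<eta>_def)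
  obtain B w where w: "w > 0"
    "\<And>z. Im z \<ge> 2 \<Longrightarrow> cmod (pullback_coeff \<omega> (mob K z) * (1 / (aut K z)\<^sup>2)) \<le> B * exp (- (w * Im z))"
    using pullback_coeff_cusp_bound[OF \<omega> K] by metis
  have B: "B \<ge> 0"
    using order_trans[OF norm_ge_zero w(2)[of "2 * \<i>"]] by (simp add: zero_le_mult_iff)
  have Im\<eta>: "Im (\<eta> t) = a * exp t" for t by (simp add: \<eta>_def)
  have vd: "vector_derivative \<gamma> (at t) = (\<i> * of_real (a * exp t)) * (1 / (aut K (\<eta> t))\<^sup>2)" for t
  proof -
    have "(\<eta> has_vector_derivative \<i> * of_real (a * exp t)) (at t)"
      unfolding \<eta>_def by (auto intro!: derivative_eq_intros has_vector_derivative_real_field simp: has_real_derivative_iff_has_vector_derivative[symmetric])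
    moreover have "Im (\<eta> t) \<noteq> 0" using ab(1) by (simp add: Im\<eta>)
    ultimately have "(mob K \<circ> \<eta> has_vector_derivative (\<i> * of_real (a * exp t)) * (1 / (aut K (\<eta> t))\<^sup>2)) (at t)"
      by (intro field_vector_diff_chain_at mob_has_field_derivative[OF K])
    then show ?thesis unfolding \<gamma> o_def by (rule vector_derivative_at)
  qed
  \<comment> \<open>beyond \<open>T\<close> the path \<open>\<eta>\<close> stays in the region \<open>Im z \<ge> 2\<close> of the exponential bound\<close>
  define T where "T = ln (2 / a)"
  have bound: "cmod (geo_form \<omega> \<gamma> t) \<le> cmod (complex_of_real (B * 2 / (w\<^sup>2 * a) * exp (- t)))" if t: "t > T" for t
  proof -
    have "2 / a = exp T" using ab(1) by (simp add: T_def)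
    then have "2 / a \<le> exp t" using t by simp
    then have Im2: "Im (\<eta> t) \<ge> 2" using ab(1) by (simp add: Im\<eta> pos_divide_le_eq mult.commute)
    define x where "x = a * exp t"
    have x: "x > 0" using ab(1) by (simp add: x_def)
    have "geo_form \<omega> \<gamma> t = (pullback_coeff \<omega> (mob K (\<eta> t)) * (1 / (aut K (\<eta> t))\<^sup>2)) * (\<i> * of_real x)"
      unfolding geo_form_def vd x_def by (simp add: \<gamma>)
    then have "cmod (geo_form \<omega> \<gamma> t) = cmod (pullback_coeff \<omega> (mob K (\<eta> t)) * (1 / (aut K (\<eta> t))\<^sup>2)) * x"
      using x by (simp only: norm_mult) simp
    also have "\<dots> \<le> (B * exp (- (w * x))) * x"
      using w(2)[OF Im2] x by (intro mult_right_mono) (simp_all add: Im\<eta> x_def)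
    \<comment> \<open>as \<open>x = a e\<^sup>t\<close>, even a quadratic lower bound for the exponential leaves a factor \<open>exp (- t)\<close>\<close>
    also have "\<dots> \<le> (B * (2 / (w * x)\<^sup>2)) * x"
    proof -
      have wx: "w * x > 0" using w x by simp
      have "(w * x)\<^sup>2 / 2 \<le> exp (w * x)"
        using exp_lower_Taylor_quadratic[of "w * x"] wx by simp
      then have "inverse (exp (w * x)) \<le> inverse ((w * x)\<^sup>2 / 2)"
        using wx by (intro le_imp_inverse_le) auto
      then have "exp (- (w * x)) \<le> 2 / (w * x)\<^sup>2" by (simp add: exp_minus)
      then show ?thesis using B x by (intro mult_right_mono mult_left_mono) auto
    qed
    also have "\<dots> = B * 2 / (w\<^sup>2 * a) * exp (- t)"
      using w x ab(1) by (simp add: x_def exp_minus field_simps power2_eq_square)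
    also have "\<dots> = cmod (complex_of_real (B * 2 / (w\<^sup>2 * a) * exp (- t)))"
      using B w ab(1) by (simp only: norm_of_real) simp
    finally show ?thesis .
  qed
  show ?thesis
  proof (rule that[of T], rule set_integrable_bound)
    have "set_integrable lborel {T<..} (\<lambda>t. B * 2 / (w\<^sup>2 * a) * exp (- t))"
      by (intro set_integrable_mult_right set_integrable_exp_minus)
    then have "integrable lborel (\<lambda>t. complex_of_real (indicator {T<..} t *\<^sub>R (B * 2 / (w\<^sup>2 * a) * exp (- t))))"
      unfolding set_integrable_def by (rule integrable_of_real)
    then show "set_integrable lborel {T<..} (\<lambda>t. complex_of_real (B * 2 / (w\<^sup>2 * a) * exp (- t)))"
      unfolding set_integrable_def by (simp add: scaleR_conv_of_real)
    have "geo_form \<omega> \<gamma> \<in> borel_measurable borel"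
      using continuous_geo_form[OF \<omega> g] by (rule borel_measurable_continuous_onI)
    then show "set_borel_measurable lborel {T<..} (geo_form \<omega> \<gamma>)"
      unfolding set_borel_measurable_def by simp
    show "AE t in lborel. t \<in> {T<..} \<longrightarrow> cmod (geo_form \<omega> \<gamma> t) \<le> cmod (complex_of_real (B * 2 / (w\<^sup>2 * a) * exp (- t)))"
      using bound by (intro AE_I2) simp
  qed
qed

lemma geo_form_reverse:
  assumes "geodesic \<gamma>" shows "geo_form \<omega> (\<lambda>t. \<gamma> (- t)) t = - geo_form \<omega> \<gamma> (- t)"
proof -
  obtain \<gamma>' where \<gamma>': "\<And>t. (\<gamma> has_vector_derivative \<gamma>' t) (at t)"
    by (rule geodesic_derivative[OF assms]) blast
  have "((\<lambda>t. - t) has_real_derivative - 1) (at t)" by (auto intro!: derivative_eq_intros)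
  then have "((\<lambda>t. - t) has_vector_derivative - 1) (at t)"
    by (simp add: has_real_derivative_iff_has_vector_derivative)
  from vector_diff_chain_at[OF this \<gamma>'(1)[of "- t"]]
  have "((\<lambda>t. \<gamma> (- t)) has_vector_derivative - \<gamma>' (- t)) (at t)" by (simp add: o_def)
  then show ?thesis using vector_derivative_at[OF \<gamma>'(1)[of "- t"]]
    by (simp add: geo_form_def vector_derivative_at)
qed

lemma geo_form_integrable:
  assumes \<omega>: "\<omega> \<in> modular_differentials G" and g: "geodesic \<gamma>" and K: "det K1 = 1" "det K2 = 1"
    and p: "geodesic_point \<gamma> (-\<infinity>) (moebius K1 None)" "geodesic_point \<gamma> \<infinity> (moebius K2 None)"
  shows "set_integrable lborel UNIV (geo_form \<omega> \<gamma>)"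
proof -
  obtain T where T: "set_integrable lborel {T<..} (geo_form \<omega> \<gamma>)"
    using geo_form_integrable_at_cusp[OF \<omega> g K(2) p(2)] .
  obtain S where S: "set_integrable lborel {S<..} (geo_form \<omega> (\<lambda>t. \<gamma> (- t)))"
    using geo_form_integrable_at_cusp[OF \<omega> geodesic_reverse[OF g] K(1)] p(1) unfolding geodesic_reverse_point by blast
  have "integrable lborel (\<lambda>x. indicator {S<..} x *\<^sub>R (- geo_form \<omega> \<gamma> (- x)))"
    using S unfolding set_integrable_def geo_form_reverse[OF g] .
  then have "integrable lborel (\<lambda>x. indicator {S<..} (0 + (-1) * x) *\<^sub>R (- geo_form \<omega> \<gamma> (- (0 + (-1) * x))))"
    by (rule lborel_integrable_real_affine) simp
  then have "integrable lborel (\<lambda>x. indicator {S<..} (- x) *\<^sub>R (- geo_form \<omega> \<gamma> x))"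
    by simp
  moreover have "indicator {S<..} (- x) = (indicator {..<-S} x :: real)" for x
    by (auto simp: indicator_def)
  ultimately have "set_integrable lborel {..<-S} (geo_form \<omega> \<gamma>)"
    unfolding set_integrable_def by simp
  moreover have "set_integrable lborel {-S..T} (geo_form \<omega> \<gamma>)"
    using continuous_on_subset[OF continuous_geo_form[OF \<omega> g]] by (intro borel_integrable_atLeastAtMost') simp
  ultimately have "set_integrable lborel ({..<-S} \<union> {-S..T} \<union> {T<..}) (geo_form \<omega> \<gamma>)"
    using T by (intro set_integrable_Un) auto
  then show ?thesis by (rule set_integrable_subset) auto
qed

text \<open>The integral along the geodesic between two points may be evaluated on any parametrised
  geodesic that joins them, provided that all of them give the same value.\<close>

lemma geodesic_integral_eqI:
  assumes "\<alpha> \<noteq> \<beta>"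
    and "\<exists>\<gamma> a b. geodesic \<gamma> \<and> a \<le> b \<and> geodesic_point \<gamma> a \<alpha> \<and> geodesic_point \<gamma> b \<beta>"
    and "\<And>\<gamma> a b. geodesic \<gamma> \<Longrightarrow> a \<le> b \<Longrightarrow> geodesic_point \<gamma> a \<alpha> \<Longrightarrow> geodesic_point \<gamma> b \<beta> \<Longrightarrow>
       (LBINT t=a..b. f (\<gamma> t) * vector_derivative \<gamma> (at t)) = V"
  shows "geodesic_integral f \<alpha> \<beta> = V"
proof -
  define P where "P = (\<lambda>(\<gamma>, a, b). geodesic \<gamma> \<and> a \<le> b \<and> geodesic_point \<gamma> a \<alpha> \<and> geodesic_point \<gamma> b \<beta>)"
  obtain \<gamma> a b where gab: "(SOME x. P x) = (\<gamma>, a, b)" by (cases "SOME x. P x") auto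
  have "\<exists>x. P x" using assms(2) by (auto simp: P_def)
  then have "P (SOME x. P x)" by (rule someI_ex)
  then have "P (\<gamma>, a, b)" by (simp only: gab)
  then have "(LBINT t=a..b. f (\<gamma> t) * vector_derivative \<gamma> (at t)) = V"
    using assms(3) by (simp add: P_def)
  then show ?thesis
    using assms(1) unfolding geodesic_integral_def P_def[symmetric] gab by simp
qed

lemma symbol_interior:
  assumes \<omega>: "\<omega> \<in> modular_differentials G" and F: "primitive_of \<omega> F" and g: "geodesic \<gamma>" and st: "s \<le> t"
  shows "modular_symbol G (Some (\<gamma> s)) (Some (\<gamma> t)) \<omega> = F (\<gamma> t) - F (\<gamma> s)"
proof (cases "\<gamma> s = \<gamma> t")
  case True then show ?thesis by (simp add: modular_symbol_def geodesic_integral_def)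
next
  case False
  have "geodesic_integral (pullback_coeff \<omega>) (Some (\<gamma> s)) (Some (\<gamma> t)) = F (\<gamma> t) - F (\<gamma> s)"
  proof (rule geodesic_integral_eqI)
    show "\<exists>\<gamma>' a b. geodesic \<gamma>' \<and> a \<le> b \<and> geodesic_point \<gamma>' a (Some (\<gamma> s)) \<and> geodesic_point \<gamma>' b (Some (\<gamma> t))"
      by (intro exI[of _ \<gamma>] exI[of _ "ereal s"] exI[of _ "ereal t"]) (simp add: g st geodesic_point_real)
  next
    fix \<delta> a b assume \<delta>: "geodesic \<delta>" "a \<le> b" "geodesic_point \<delta> a (Some (\<gamma> s))" "geodesic_point \<delta> b (Some (\<gamma> t))"
    have Im: "Im (\<gamma> s) \<noteq> 0" "Im (\<gamma> t) \<noteq> 0" using geodesic_in_H[OF g, of s] geodesic_in_H[OF g, of t] by linarith+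
    obtain a' where a': "a = ereal a'" "\<gamma> s = \<delta> a'" by (rule geodesic_endpoint_boundary[OF \<delta>(1,3) Im(1)])
    obtain b' where b': "b = ereal b'" "\<gamma> t = \<delta> b'" by (rule geodesic_endpoint_boundary[OF \<delta>(1,4) Im(2)])
    have "(LBINT t=ereal a'..ereal b'. geo_form \<omega> \<delta> t) = F (\<delta> b') - F (\<delta> a')"
      by (rule interval_integral_FTC_finite)
         (auto intro: continuous_on_subset[OF continuous_geo_form[OF \<omega> \<delta>(1)]]
            has_vector_derivative_at_within primitive_has_vector_derivative[OF F \<delta>(1)])
    then show "(LBINT t=a..b. pullback_coeff \<omega> (\<delta> t) * vector_derivative \<delta> (at t)) = F (\<gamma> t) - F (\<gamma> s)"
      unfolding geo_form_def a' b' .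
  qed (use False in simp)
  then show ?thesis using \<omega> by (simp add: modular_symbol_def pullback_coeff_def)
qed

lemma cusp_not_interior:
  assumes "moebius K None = Some z" shows "Im z = 0"
proof -
  have "z = of_real (of_int (K$1$1) / of_int (K$2$1))"
    using assms by (simp add: moebius_def Let_def split: if_splits)
  then show ?thesis by (metis Im_complex_of_real)
qed

lemma symbol_cusps:
  assumes \<omega>: "\<omega> \<in> modular_differentials G" and F: "primitive_of \<omega> F" and K: "det K1 = 1" "det K2 = 1"
    and ne: "moebius K1 None \<noteq> moebius K2 None"
    and ex: "\<exists>\<gamma>. geodesic \<gamma> \<and> geodesic_point \<gamma> (-\<infinity>) (moebius K1 None) \<and> geodesic_point \<gamma> \<infinity> (moebius K2 None)"
    and l: "((\<lambda>z. F (mob K1 z)) \<longlongrightarrow> l1) (filtercomap Im at_top)" "((\<lambda>z. F (mob K2 z)) \<longlongrightarrow> l2) (filtercomap Im at_top)"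
  shows "modular_symbol G (moebius K1 None) (moebius K2 None) \<omega> = l2 - l1"
proof -
  have "geodesic_integral (pullback_coeff \<omega>) (moebius K1 None) (moebius K2 None) = l2 - l1"
  proof (rule geodesic_integral_eqI[OF ne])
    show "\<exists>\<gamma>' a b. geodesic \<gamma>' \<and> a \<le> b \<and> geodesic_point \<gamma>' a (moebius K1 None) \<and> geodesic_point \<gamma>' b (moebius K2 None)"
      using ex by (metis ereal_infty_less_eq2(1) uminus_ereal.simps(2) ereal_less_eq(2))
  next
    fix \<gamma> a b assume \<gamma>: "geodesic \<gamma>" "a \<le> b" "geodesic_point \<gamma> a (moebius K1 None)" "geodesic_point \<gamma> b (moebius K2 None)"
    \<comment> \<open>a cusp is not a point of the half-plane, so both parameters are infinite\<close>
    have not_real: "e \<noteq> ereal t" if "geodesic_point \<gamma> e (moebius K None)" for e K t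
    proof
      assume "e = ereal t"
      then have "Im (\<gamma> t) = 0" using that cusp_not_interior by (simp add: geodesic_point_real)
      then show False using geodesic_in_H[OF \<gamma>(1), of t] by simp
    qed
    have "a \<noteq> b" using geodesic_point_unique[of \<gamma> a] \<gamma>(3,4) ne by blast
    with \<gamma>(2) not_real[OF \<gamma>(3)] not_real[OF \<gamma>(4)] have ab: "a = -\<infinity>" "b = \<infinity>"
      by (cases a; cases b; auto)+
    note p = \<gamma>(3,4)[unfolded ab]
    have "(LBINT t=-\<infinity>..\<infinity>. geo_form \<omega> \<gamma> t) = l2 - l1"
    proof (rule interval_integral_FTC_integrable[where F = "\<lambda>t. F (\<gamma> t)"])
      show "set_integrable lborel (einterval (-\<infinity>) \<infinity>) (geo_form \<omega> \<gamma>)"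
        using geo_form_integrable[OF \<omega> \<gamma>(1) K p] by simp
      show "isCont (geo_form \<omega> \<gamma>) x" for x
        using continuous_geo_form[OF \<omega> \<gamma>(1)] by (simp add: continuous_on_eq_continuous_at)
      show "(((\<lambda>t. F (\<gamma> t)) \<circ> real_of_ereal) \<longlongrightarrow> l2) (at_left \<infinity>)"
        unfolding ereal_tendsto_simps by (rule primitive_along_geodesic[OF \<gamma>(1) K(2) p(2) l(2)])
      have "((\<lambda>t. F (\<gamma> (- t))) \<longlongrightarrow> l1) at_top"
        using primitive_along_geodesic[OF geodesic_reverse[OF \<gamma>(1)] K(1) _ l(1)] p(1)
        unfolding geodesic_reverse_point by blast
      then show "(((\<lambda>t. F (\<gamma> t)) \<circ> real_of_ereal) \<longlongrightarrow> l1) (at_right (-\<infinity>))"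
        unfolding ereal_tendsto_simps by (simp add: filterlim_at_bot_mirror)
    qed (auto intro: primitive_has_vector_derivative[OF F \<gamma>(1)])
    then show "(LBINT t=a..b. pullback_coeff \<omega> (\<gamma> t) * vector_derivative \<gamma> (at t)) = l2 - l1"
      unfolding geo_form_def ab .
  qed
  then show ?thesis using \<omega> by (simp add: modular_symbol_def pullback_coeff_def)
qed

end

section \<open>The axis of a hyperbolic element\<close>

text \<open>A fixed point with real homogeneous coordinates is an eigenvector.\<close>

lemma real_eigenvector:
  assumes A: "det A = 1" and ac: "a \<noteq> 0 \<or> c \<noteq> (0::real)"
    and fp: "moebius A (hom_pt (of_real a) (of_real c)) = hom_pt (of_real a) (of_real c)"
  obtains \<mu> where "of_int (A$1$1) * a + of_int (A$1$2) * c = \<mu> * a" "of_int (A$2$1) * a + of_int (A$2$2) * c = \<mu> * c"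
proof -
  define x where "x = of_int (A$1$1) * a + of_int (A$1$2) * c"
  define y where "y = of_int (A$2$1) * a + of_int (A$2$2) * c"
  have ac': "complex_of_real a \<noteq> 0 \<or> complex_of_real c \<noteq> 0" using ac by simp
  have xy: "complex_of_real x = of_int (A$1$1) * of_real a + of_int (A$1$2) * of_real c"
    "complex_of_real y = of_int (A$2$1) * of_real a + of_int (A$2$2) * of_real c" by (simp_all add: x_def y_def)
  have "complex_of_real x \<noteq> 0 \<or> complex_of_real y \<noteq> 0"
    unfolding xy by (rule hom_coord_nonzero[OF A ac'])
  moreover have "hom_pt (of_real x) (of_real y) = hom_pt (of_real a) (of_real c)"
    using fp unfolding moebius_hom_pt[OF ac'] xy .
  ultimately have "complex_of_real x * of_real c = of_real a * of_real y"
    using hom_pt_eq_iff ac' by blast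
  then have "complex_of_real (x * c) = of_real (a * y)" by simp
  then have eq: "x * c = a * y" by (simp only: of_real_eq_iff)
  show ?thesis
  proof (cases "c = 0")
    case True
    then have "x = x / a * a" "y = x / a * c" using ac eq by auto
    then show ?thesis unfolding x_def y_def by (rule that)
  next
    case False
    then have "x = y / c * a" "y = y / c * c" using eq by (auto simp: field_simps)
    then show ?thesis unfolding x_def y_def by (rule that)
  qed
qed

lemma real_geodesic_scale:
  assumes "\<mu> * \<nu> = 1"
  shows "real_geodesic (\<mu> * a) (\<nu> * b) (\<mu> * c) (\<nu> * d) t = real_geodesic a b c d (t + ln (\<mu>\<^sup>2))"
proof -
  have \<mu>: "\<mu> \<noteq> 0" using assms by auto
  have \<nu>: "\<nu> = 1 / \<mu>" using assms \<mu> by (simp add: field_simps)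
  define E :: complex where "E = \<i> * of_real (exp t)"
  have E2: "\<i> * complex_of_real (exp (t + ln (\<mu>\<^sup>2))) = of_real (\<mu>\<^sup>2) * E"
    using \<mu> by (simp add: E_def exp_add)
  have 1: "of_real (\<mu> * x) * E + of_real (\<nu> * y) = of_real \<nu> * (of_real x * (of_real (\<mu>\<^sup>2) * E) + of_real y)" for x y
    using \<mu> by (simp add: \<nu> field_simps power2_eq_square)
  have "complex_of_real \<nu> \<noteq> 0" using \<mu> \<nu> by simp
  then show ?thesis unfolding real_geodesic_def E2 E_def[symmetric] 1 by simp
qed

text \<open>An element that fixes both endpoints is diagonal in the basis of the endpoints, with
  eigenvalues \<open>\<mu>\<close> and \<open>1/\<mu>\<close>. It moves the geodesic along itself by \<open>ln (\<mu>\<^sup>2)\<close>.\<close>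

lemma geodesic_translated:
  assumes A: "det A = 1" and g: "geodesic \<gamma>" and p: "geodesic_point \<gamma> (-\<infinity>) p" "geodesic_point \<gamma> \<infinity> q"
    and fp: "moebius A p = p" "moebius A q = q"
  obtains L where "\<And>t. mob A (\<gamma> t) = \<gamma> (t + L)"
proof -
  obtain a b c d where det: "a * d - b * c = 1" and \<gamma>: "\<gamma> = real_geodesic a b c d"
    using g geodesic_iff_real_geodesic by auto
  have q: "q = hom_pt (of_real a) (of_real c)" using real_geodesic_endpoint[OF det] p(2) \<gamma> by simp
  have "geodesic_point (real_geodesic b (- a) d (- c)) \<infinity> p"
    using p(1) unfolding geodesic_reverse_point \<gamma> real_geodesic_minus .
  then have p': "p = hom_pt (of_real b) (of_real d)"
    using real_geodesic_endpoint[of b "- c" "- a" d p] det by simp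
  have nz: "a \<noteq> 0 \<or> c \<noteq> 0" "b \<noteq> 0 \<or> d \<noteq> 0" using det by auto
  obtain \<mu> where \<mu>: "of_int (A$1$1) * a + of_int (A$1$2) * c = \<mu> * a" "of_int (A$2$1) * a + of_int (A$2$2) * c = \<mu> * c"
    by (rule real_eigenvector[OF A nz(1)]) (use fp q in auto)
  obtain \<nu> where \<nu>: "of_int (A$1$1) * b + of_int (A$1$2) * d = \<nu> * b" "of_int (A$2$1) * b + of_int (A$2$2) * d = \<nu> * d"
    by (rule real_eigenvector[OF A nz(2)]) (use fp p' in auto)
  have "\<mu> * \<nu> = \<mu> * \<nu> * (a * d - b * c)" using det by simp
  also have "\<dots> = (\<mu> * a) * (\<nu> * d) - (\<nu> * b) * (\<mu> * c)" by (simp add: algebra_simps)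
  also have "\<dots> = (of_int (A$1$1) * of_int (A$2$2) - of_int (A$1$2) * of_int (A$2$1)) * (a * d - b * c)"
    unfolding \<mu>[symmetric] \<nu>[symmetric] by (simp add: algebra_simps)
  finally have \<mu>\<nu>: "\<mu> * \<nu> = 1" unfolding of_int_det2[OF A] det by simp
  have "mob A (\<gamma> t) = \<gamma> (t + ln (\<mu>\<^sup>2))" for t
    unfolding \<gamma> mob_real_geodesic[OF A det] \<mu> \<nu> by (rule real_geodesic_scale[OF \<mu>\<nu>])
  then show ?thesis by (rule that)
qed

lemma geodesic_endpoints_distinct:
  assumes "geodesic \<gamma>" "geodesic_point \<gamma> (-\<infinity>) p" "geodesic_point \<gamma> \<infinity> q"
  shows "p \<noteq> q"
proof
  assume eq: "p = q"
  obtain a b c d where det: "a * d - b * c = 1" and \<gamma>: "\<gamma> = real_geodesic a b c d"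
    using assms(1) geodesic_iff_real_geodesic by auto
  have q: "q = hom_pt (of_real a) (of_real c)" using real_geodesic_endpoint[OF det] assms(3) \<gamma> by simp
  have "geodesic_point (real_geodesic b (- a) d (- c)) \<infinity> p"
    using assms(2) unfolding geodesic_reverse_point \<gamma> real_geodesic_minus .
  then have "p = hom_pt (of_real b) (of_real d)"
    using real_geodesic_endpoint[of b "- c" "- a" d p] det by simp
  then have h: "hom_pt (complex_of_real a) (of_real c) = hom_pt (of_real b) (of_real d)" using eq q by simp
  have "complex_of_real a \<noteq> 0 \<or> complex_of_real c \<noteq> 0" "complex_of_real b \<noteq> 0 \<or> complex_of_real d \<noteq> 0"
    using det by auto
  then have "complex_of_real a * of_real d = of_real b * of_real c"
    using h hom_pt_eq_iff by blast
  then have "complex_of_real (a * d) = of_real (b * c)" by simp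
  then have "a * d = b * c" by (simp only: of_real_eq_iff)
  then show False using det by simp
qed

text \<open>The direction of the translation is read off from the iterates of a point of the geodesic:
  they have to converge to the attracting fixed point, which is not on the geodesic and differs
  from the other endpoint.\<close>

lemma translation_length_pos:
  assumes A: "det A = 1" and g: "geodesic \<gamma>" and p: "geodesic_point \<gamma> (-\<infinity>) p" "geodesic_point \<gamma> \<infinity> q"
    and q: "q \<in> P1R" and attr: "attracting_fixed_point (psl A) q"
    and L: "\<And>t. mob A (\<gamma> t) = \<gamma> (t + L)"
  shows "L > 0"
proof (rule ccontr)
  assume "\<not> L > 0"
  have "eventually (\<lambda>u. filterlim (\<lambda>n. (psl_act (psl A) ^^ n) u) (sphere_nhds q) sequentially) (sphere_nhds q)"
    using attr unfolding attracting_fixed_point_def by blast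
  then have "eventually (\<lambda>t. filterlim (\<lambda>n. (psl_act (psl A) ^^ n) (Some (\<gamma> t))) (sphere_nhds q) sequentially) at_top"
    using p(2)[unfolded geodesic_point_PInf] by (rule eventually_compose_filterlim)
  then obtain t where t: "filterlim (\<lambda>n. (psl_act (psl A) ^^ n) (Some (\<gamma> t))) (sphere_nhds q) sequentially"
    using eventually_happens by force
  have iter: "(psl_act (psl A) ^^ n) (Some (\<gamma> t)) = Some (\<gamma> (t + real n * L))" for n
  proof (induction n)
    case (Suc n)
    have "Im (\<gamma> (t + real n * L)) \<noteq> 0" using geodesic_in_H[OF g, of "t + real n * L"] by simp
    then show ?case using Suc A by (simp add: moebius_Some L algebra_simps)
  qed simp
  have lim: "filterlim (\<lambda>n. Some (\<gamma> (t + real n * L))) (sphere_nhds q) sequentially"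
    using t unfolding iter .
  show False
  proof (cases "L = 0")
    case True
    have "filterlim (\<lambda>n::nat. Some (\<gamma> t)) (sphere_nhds (Some (\<gamma> t))) sequentially"
      by (simp add: filterlim_sphere_iff)
    then have "q = Some (\<gamma> t)"
      using lim True sphere_limit_unique[of "\<lambda>_::nat. \<gamma> t" q sequentially "Some (\<gamma> t)"] by simp
    then have "\<gamma> t \<in> \<real>" using q by (auto simp: P1R_def)
    then show False using geodesic_in_H[OF g, of t] by (simp add: complex_is_Real_iff)
  next
    case False
    with \<open>\<not> L > 0\<close> have "- L > 0" by simp
    then have "filterlim (\<lambda>n. real n * (- L)) at_top sequentially"
      by (intro filterlim_at_top_mult_tendsto_pos[OF tendsto_const _ filterlim_real_sequentially])
    then have "filterlim (\<lambda>n. (- t) + real n * (- L)) at_top sequentially"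
      by (intro filterlim_tendsto_add_at_top[OF tendsto_const])
    then have "filterlim (\<lambda>n. t + real n * L) at_bot sequentially"
      by (simp add: filterlim_uminus_at_bot)
    moreover have "filterlim (\<lambda>t. Some (\<gamma> t)) (sphere_nhds p) at_bot"
      using p(1) by (simp add: geodesic_point_def)
    ultimately have "filterlim (\<lambda>n. Some (\<gamma> (t + real n * L))) (sphere_nhds p) sequentially"
      by (rule filterlim_compose[rotated])
    then have "p = q" using lim by (rule sphere_limit_unique) simp
    then show False using geodesic_endpoints_distinct[OF g p] by simp
  qed
qed

lemma square_minus_four:
  fixes t k :: int
  assumes "k\<^sup>2 = t\<^sup>2 - 4" shows "\<bar>t\<bar> \<le> 2"
proof (rule ccontr)
  assume "\<not> \<bar>t\<bar> \<le> 2"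
  then have t: "\<bar>t\<bar> \<ge> 3" by simp
  have "\<bar>k\<bar>\<^sup>2 < \<bar>t\<bar>\<^sup>2" using assms by simp
  then have "\<bar>k\<bar> < \<bar>t\<bar>" by (rule power_less_imp_less_base) simp
  then have "\<bar>k\<bar>\<^sup>2 \<le> (\<bar>t\<bar> - 1)\<^sup>2" by (intro power_mono) auto
  also have "\<dots> = \<bar>t\<bar>\<^sup>2 - 2 * \<bar>t\<bar> + 1" by (simp add: power2_eq_square algebra_simps)
  finally show False using assms t by simp
qed

text \<open>The fixed points of a hyperbolic element are irrational, because \<open>t\<^sup>2 - 4\<close> is not a square.\<close>

lemma hyperbolic_fixed_irrational:
  assumes A: "det A = 1" and h: "\<bar>trace A\<bar> > 2" and fp: "moebius A p = p"
  shows "p \<notin> P1Q"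
proof
  assume "p \<in> P1Q"
  have tr: "trace A = A$1$1 + A$2$2" by (simp add: trace_def sum_2)
  have c0: False if "A$2$1 = 0"
  proof -
    have "A$1$1 * A$2$2 = 1" using A that by (simp add: det_2)
    then have "A$1$1 = 1 \<and> A$2$2 = 1 \<or> A$1$1 = -1 \<and> A$2$2 = -1"
      using zmult_eq_1_iff by blast
    then show False using h tr by auto
  qed
  show False
  proof (cases p)
    case None
    then show False using fp c0 by (auto simp: moebius_def Let_def split: if_splits)
  next
    case (Some x)
    then have x: "x \<in> \<rat>" using \<open>p \<in> P1Q\<close> by (auto simp: P1Q_def)
    define a b c d :: complex where "a = of_int (A$1$1)" "b = of_int (A$1$2)" "c = of_int (A$2$1)" "d = of_int (A$2$2)"
    note abcd = this
    have det: "a * d - b * c = 1" unfolding abcd by (rule of_int_det2[OF A])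
    have "c * x + d \<noteq> 0" "(a * x + b) / (c * x + d) = x"
      using fp Some unfolding abcd by (auto simp: moebius_def Let_def split: if_splits)
    then have eq: "a * x + b = x * (c * x + d)" by (simp add: field_simps)
    \<comment> \<open>a square root of the discriminant of the equation for the fixed point \<open>x\<close>\<close>
    define s where "s = 2 * c * x + d - a"
    have "s\<^sup>2 = 4 * c * (x * (c * x + d) - a * x) + (d - a)\<^sup>2"
      by (simp add: s_def power2_eq_square algebra_simps)
    also have "\<dots> = 4 * c * b + (d - a)\<^sup>2" unfolding eq[symmetric] by simp
    also have "\<dots> = (a + d)\<^sup>2 - 4 * (a * d - b * c)" by (simp add: power2_eq_square algebra_simps)
    finally have "s\<^sup>2 = (a + d)\<^sup>2 - 4" unfolding det by simp
    then have s2: "s\<^sup>2 = of_int ((trace A)\<^sup>2 - 4)" by (simp add: tr abcd)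
    have "s \<in> \<rat>" unfolding s_def abcd using x by (intro Rats_add Rats_diff Rats_mult) auto
    moreover have "algebraic_int s"
    proof (rule algebraic_int.intros)
      show "poly [:- of_int ((trace A)\<^sup>2 - 4), 0, 1:] s = 0"
        using s2 by (simp add: power2_eq_square)
      show "\<forall>i. coeff [:- of_int ((trace A)\<^sup>2 - 4), 0, 1:] i \<in> (\<int> :: complex set)"
        by (auto simp: coeff_pCons split: nat.splits simp del: of_int_diff)
    qed simp
    ultimately have "s \<in> \<int>" by (intro rational_algebraic_int_is_int)
    then obtain k where "s = of_int k" by (elim Ints_cases)
    then have "complex_of_int (k\<^sup>2) = of_int ((trace A)\<^sup>2 - 4)" using s2 by simp
    then have "k\<^sup>2 = (trace A)\<^sup>2 - 4" by (simp only: of_int_eq_iff)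
    then show False using square_minus_four h by fastforce
  qed
qed

section \<open>Quasi-periodic functions\<close>

lemma periodic_bounded:
  fixes H :: "real \<Rightarrow> complex"
  assumes cont: "continuous_on UNIV H" and L: "L > 0" and per: "\<And>t. H (t + L) = H t"
  obtains B where "\<And>t. t \<ge> 0 \<Longrightarrow> cmod (H t) \<le> B"
proof -
  have "bounded (H ` {0..L})"
    by (intro compact_imp_bounded compact_continuous_image continuous_on_subset[OF cont]) auto
  then obtain B where B: "\<And>t. t \<in> {0..L} \<Longrightarrow> cmod (H t) \<le> B" unfolding bounded_iff by blast
  have pern: "H (t + real n * L) = H t" for t n
  proof (induction n)
    case (Suc n) then show ?case using per[of "t + real n * L"] by (simp add: algebra_simps)
  qed simp
  show ?thesis
  proof (rule that)
    fix t :: real assume t: "t \<ge> 0"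
    define n where "n = nat \<lfloor>t / L\<rfloor>"
    have n: "real n = of_int \<lfloor>t / L\<rfloor>" using t L by (simp add: n_def)
    have "real n \<le> t / L" "t / L \<le> real n + 1" unfolding n by linarith+
    then have "real n * L \<le> t" "t \<le> (real n + 1) * L"
      using L by (simp_all add: pos_le_divide_eq pos_divide_le_eq)
    then have "t - real n * L \<in> {0..L}" by (simp add: algebra_simps)
    then show "cmod (H t) \<le> B" using B pern[of "t - real n * L" n] by force
  qed
qed

text \<open>A function with \<open>F (t + L) = F t + P\<close> grows linearly with slope \<open>P / L\<close>.\<close>

lemma quasi_periodic_slope:
  fixes F :: "real \<Rightarrow> complex"
  assumes cont: "continuous_on UNIV F" and L: "L > 0" and per: "\<And>t. F (t + L) = F t + P"
  shows "((\<lambda>t. (F t - F s) / of_real (t - s)) \<longlongrightarrow> P / of_real L) at_top"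
proof -
  define H where "H t = F t - of_real (t / L) * P" for t
  have "continuous_on UNIV H" unfolding H_def using L by (intro continuous_intros cont) auto
  moreover have "H (t + L) = H t" for t
    using L by (simp add: H_def per add_divide_distrib ring_distribs)
  ultimately obtain B where B: "\<And>t. t \<ge> 0 \<Longrightarrow> cmod (H t) \<le> B" using periodic_bounded[OF _ L] by metis
  have inv: "((\<lambda>t. inverse (t - s)) \<longlongrightarrow> 0) at_top"
    by (rule filterlim_compose[OF tendsto_inverse_0_at_top[OF filterlim_ident]])
       (rule filterlim_tendsto_add_at_top[OF tendsto_const filterlim_ident, of "- s", simplified])
  have "((\<lambda>t. (H t - H s) / of_real (t - s)) \<longlongrightarrow> 0) at_top"
  proof (rule Lim_null_comparison)
    show "eventually (\<lambda>t. norm ((H t - H s) / of_real (t - s)) \<le> (B + cmod (H s)) * inverse (t - s)) at_top"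
      using eventually_ge_at_top[of 0] eventually_gt_at_top[of s]
    proof eventually_elim
      case (elim t)
      have "cmod (H t - H s) \<le> B + cmod (H s)"
        using norm_triangle_ineq4[of "H t" "H s"] B[of t] elim by simp
      then have "cmod (H t - H s) * inverse (t - s) \<le> (B + cmod (H s)) * inverse (t - s)"
        using elim by (intro mult_right_mono) auto
      moreover have "norm ((H t - H s) / of_real (t - s)) = cmod (H t - H s) * inverse (t - s)"
        unfolding norm_divide norm_of_real using elim by (simp add: divide_inverse)
      ultimately show ?case by simp
    qed
    show "((\<lambda>t. (B + cmod (H s)) * inverse (t - s)) \<longlongrightarrow> 0) at_top"
      using tendsto_mult_right_zero[OF inv] by simp
  qed
  then have "((\<lambda>t. (H t - H s) / of_real (t - s) + P / of_real L) \<longlongrightarrow> 0 + P / of_real L) at_top"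
    by (intro tendsto_intros)
  moreover have "eventually (\<lambda>t. (H t - H s) / of_real (t - s) + P / of_real L = (F t - F s) / of_real (t - s)) at_top"
    using eventually_gt_at_top[of s]
  proof eventually_elim
    case (elim t)
    then have nz: "complex_of_real (t - s) \<noteq> 0" by simp
    have "H t - H s = (F t - F s) - of_real (t - s) * (P / of_real L)"
      using L by (simp add: H_def field_simps)
    then show ?case using nz by (simp add: diff_divide_distrib)
  qed
  ultimately show ?thesis by (simp add: tendsto_cong)
qed

section \<open>The limiting modular symbol\<close>

text \<open>Convergence of functions is pointwise.\<close>

lemma tendsto_fun_iff:
  fixes f :: "'a \<Rightarrow> 'i \<Rightarrow> 'b::topological_space"
  shows "(f \<longlongrightarrow> l) F \<longleftrightarrow> (\<forall>i. ((\<lambda>x. f x i) \<longlongrightarrow> l i) F)"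
  using limitin_componentwise[of "\<lambda>_. euclidean" UNIV f l F]
  by (simp add: euclidean_product_topology)

context modular_subgroup begin

text \<open>The symbol \<open>{0, g(0)}\<close> is the period of \<open>g\<close>: the limits of a primitive at the cusps \<open>g(0)\<close> and
  \<open>0\<close> differ by the same constant as its values at \<open>g(z)\<close> and \<open>z\<close>. The cusp \<open>0\<close> is the image of \<open>\<infinity>\<close>
  under \<open>S\<close>, and \<open>g(0) \<noteq> 0\<close> because \<open>g\<close> is hyperbolic.\<close>

lemma symbol_period:
  assumes \<omega>: "\<omega> \<in> modular_differentials G" and F: "primitive_of \<omega> F" and A: "A \<in> lift_SL G"
    and h: "\<bar>trace A\<bar> > 2" and z: "Im z > 0"
  shows "modular_symbol G (Some 0) (moebius A (Some 0)) \<omega> = F (mob A z) - F z"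
proof -
  define S :: mat2 where "S = vector [vector [0, -1], vector [1, 0]]"
  have S_nth: "S$1$1 = 0" "S$1$2 = -1" "S$2$1 = 1" "S$2$2 = 0" by (simp_all add: S_def)
  have detA: "det A = 1" using A by simp
  have S: "det S = 1" by (simp add: det_2 S_nth)
  have S0: "moebius S None = Some 0" by (simp add: moebius_def S_nth)
  have AS0: "moebius (A ** S) None = moebius A (Some 0)" using detA S by (simp add: moebius_mult S0)
  have b: "A$1$2 \<noteq> 0"
  proof
    assume "A$1$2 = 0"
    then have "A$1$1 * A$2$2 = 1" using detA by (simp add: det_2)
    then have "A$1$1 = 1 \<and> A$2$2 = 1 \<or> A$1$1 = -1 \<and> A$2$2 = -1"
      using zmult_eq_1_iff by blast
    then show False using h by (auto simp: trace_def sum_2)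
  qed
  have ne: "moebius S None \<noteq> moebius (A ** S) None"
    using b unfolding S0 AS0 by (simp add: moebius_def)
  \<comment> \<open>the geodesic from \<open>0\<close> to \<open>g(0) = 1/q\<close>, where \<open>q = 0\<close> if \<open>g(0) = \<infinity>\<close>\<close>
  define q where "q = real_of_int (A$2$2) / real_of_int (A$1$2)"
  have "geodesic_point (real_geodesic 1 0 q 1) \<infinity> (moebius (A ** S) None)"
  proof -
    have "hom_pt (of_real 1) (of_real q) = moebius A (Some 0)"
      using b by (simp add: hom_pt_def moebius_def q_def)
    then show ?thesis using real_geodesic_limit[of 1 1 0 q] unfolding AS0 geodesic_point_PInf by simp
  qed
  moreover have "geodesic_point (real_geodesic 1 0 q 1) (-\<infinity>) (moebius S None)"
    unfolding geodesic_reverse_point geodesic_point_PInf real_geodesic_minus S0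
    using real_geodesic_limit[of 0 "- q" "- 1" 1] by (simp add: hom_pt_def)
  moreover have "geodesic (real_geodesic 1 0 q 1)" 
    unfolding geodesic_iff_real_geodesic by (rule exI[of _ 1], rule exI[of _ 0], rule exI[of _ q], rule exI[of _ 1]) simp
  ultimately have ex: "\<exists>\<gamma>. geodesic \<gamma> \<and> geodesic_point \<gamma> (-\<infinity>) (moebius S None) \<and> geodesic_point \<gamma> \<infinity> (moebius (A ** S) None)"
    by blast
  obtain l where l: "((\<lambda>z. F (mob S z)) \<longlongrightarrow> l) (filtercomap Im at_top)"
    using primitive_cusp_limit[OF \<omega> F S] .
  have "eventually (\<lambda>v. F (mob (A ** S) v) = F (mob S v) + (F (mob A z) - F z)) (filtercomap Im at_top)"
  proof -
    have "eventually (\<lambda>v. Im v > 0) (filtercomap Im at_top)"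
      by (rule eventually_filtercomapI) (rule eventually_gt_at_top)
    then show ?thesis
    proof eventually_elim
      case (elim v)
      then have "Im (mob S v) > 0" using S by simp
      then show ?case using primitive_mob[OF \<omega> F A _ z, of "mob S v"] elim detA S by (simp add: mob_mult algebra_simps)
    qed
  qed
  moreover have "((\<lambda>v. F (mob S v) + (F (mob A z) - F z)) \<longlongrightarrow> l + (F (mob A z) - F z)) (filtercomap Im at_top)"
    by (intro tendsto_intros l)
  ultimately have l2: "((\<lambda>v. F (mob (A ** S) v)) \<longlongrightarrow> l + (F (mob A z) - F z)) (filtercomap Im at_top)"
    by (simp add: tendsto_cong)
  have "det (A ** S) = 1" using detA S by (simp add: det_mul)
  from symbol_cusps[OF \<omega> F S this ne ex l l2] show ?thesis unfolding S0 AS0 by simp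
qed

lemma differentials_linear:
  assumes "\<omega> \<in> modular_differentials G" "\<eta> \<in> modular_differentials G"
  shows "(\<lambda>c w. \<omega> c w + \<eta> c w) \<in> modular_differentials G"
    "(\<lambda>c w. a * \<omega> c w) \<in> modular_differentials G"
proof -
  have hol: "\<theta> c holomorphic_on snd c ` fst c"
    and trans: "d \<in> modular_atlas G \<Longrightarrow> p \<in> fst c \<inter> fst d \<Longrightarrow>
      \<theta> c (snd c p) = \<theta> d (snd d p) * deriv (\<lambda>w. snd d (inv_into (fst c) (snd c) w)) (snd c p)"
    if "\<theta> \<in> modular_differentials G" "c \<in> modular_atlas G" for \<theta> c d p
    using that unfolding modular_differentials_def holomorphic_differentials_def by blast+
  have zero: "\<theta> c w = 0" if "\<theta> \<in> modular_differentials G" "c \<notin> modular_atlas G \<or> w \<notin> snd c ` fst c" for \<theta> c w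
    using that unfolding modular_differentials_def holomorphic_differentials_def by blast
  note \<omega> = hol[OF assms(1)] trans[OF assms(1)] zero[OF assms(1)]
  note \<eta> = hol[OF assms(2)] trans[OF assms(2)] zero[OF assms(2)]
  show "(\<lambda>c w. \<omega> c w + \<eta> c w) \<in> modular_differentials G"
    unfolding modular_differentials_def holomorphic_differentials_def
  proof (intro CollectI conjI ballI allI impI)
    fix c d p assume "c \<in> modular_atlas G" "d \<in> modular_atlas G" "p \<in> fst c \<inter> fst d"
    then show "\<omega> c (snd c p) + \<eta> c (snd c p) =
      (\<omega> d (snd d p) + \<eta> d (snd d p)) * deriv (\<lambda>w. snd d (inv_into (fst c) (snd c) w)) (snd c p)"
      using \<omega>(2)[of c d p] \<eta>(2)[of c d p] by (simp only: distrib_right)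
  next
    fix c w assume "c \<notin> modular_atlas G \<or> w \<notin> snd c ` fst c"
    then show "\<omega> c w + \<eta> c w = 0" by (simp only: \<omega>(3) \<eta>(3) add_0)
  qed (intro holomorphic_on_add \<omega>(1) \<eta>(1))
  show "(\<lambda>c w. a * \<omega> c w) \<in> modular_differentials G"
    unfolding modular_differentials_def holomorphic_differentials_def
  proof (intro CollectI conjI ballI allI impI)
    fix c d p assume "c \<in> modular_atlas G" "d \<in> modular_atlas G" "p \<in> fst c \<inter> fst d"
    then show "a * \<omega> c (snd c p) =
      a * \<omega> d (snd d p) * deriv (\<lambda>w. snd d (inv_into (fst c) (snd c) w)) (snd c p)"
      using \<omega>(2)[of c d p] by (simp only: mult.assoc)
  next
    fix c w assume "c \<notin> modular_atlas G \<or> w \<notin> snd c ` fst c"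
    then show "a * \<omega> c w = 0" by (simp only: \<omega>(3) mult_zero_right)
  qed (intro holomorphic_on_mult holomorphic_on_const \<omega>(1))
qed

lemma pullback_coeff_linear:
  "pullback_coeff (\<lambda>c w. \<omega> c w + \<eta> c w) = (\<lambda>z. pullback_coeff \<omega> z + pullback_coeff \<eta> z)"
  "pullback_coeff (\<lambda>c w. a * \<omega> c w) = (\<lambda>z. a * pullback_coeff \<omega> z)"
  by (simp_all add: pullback_coeff_def pullback_def Let_def fun_eq_iff distrib_right)

lemma symbol_period_real_homology:
  assumes A: "A \<in> lift_SL G" and h: "\<bar>trace A\<bar> > 2"
  shows "(\<lambda>\<omega>. modular_symbol G (Some 0) (moebius A (Some 0)) \<omega> / r) \<in> real_homology G"
proof -
  let ?S = "modular_symbol G (Some 0) (moebius A (Some 0))"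
  have i: "Im \<i> > 0" by simp
  have add: "?S (\<lambda>c w. \<omega> c w + \<eta> c w) = ?S \<omega> + ?S \<eta>"
    if "\<omega> \<in> modular_differentials G" "\<eta> \<in> modular_differentials G" for \<omega> \<eta>
  proof -
    obtain F1 F2 where F: "primitive_of \<omega> F1" "primitive_of \<eta> F2" using primitive_exists \<open>\<omega> \<in> _\<close> \<open>\<eta> \<in> _\<close> by metis
    then have "primitive_of (\<lambda>c w. \<omega> c w + \<eta> c w) (\<lambda>z. F1 z + F2 z)"
      unfolding primitive_of_def pullback_coeff_linear by (auto intro: DERIV_add)
    then show ?thesis
      using symbol_period[OF differentials_linear(1)[OF that] _ A h i] symbol_period[OF that(1) F(1) A h i]
        symbol_period[OF that(2) F(2) A h i] by simp
  qed
  have mult: "?S (\<lambda>c w. a * \<omega> c w) = a * ?S \<omega>" if "\<omega> \<in> modular_differentials G" for \<omega> a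
  proof -
    obtain F where F: "primitive_of \<omega> F" using primitive_exists \<open>\<omega> \<in> _\<close> by metis
    then have "primitive_of (\<lambda>c w. a * \<omega> c w) (\<lambda>z. a * F z)"
      unfolding primitive_of_def pullback_coeff_linear by (auto intro: DERIV_cmult)
    then have "?S (\<lambda>c w. a * \<omega> c w) = a * F (mob A \<i>) - a * F \<i>"
      by (rule symbol_period[OF differentials_linear(2)[OF that that] _ A h i])
    also have "\<dots> = a * ?S \<omega>"
      unfolding symbol_period[OF that F A h i] by (rule right_diff_distrib[symmetric])
    finally show ?thesis .
  qed
  show ?thesis unfolding real_homology_def
    using add mult by (auto simp: add_divide_distrib) (simp add: modular_symbol_def)
qed

end

theorem mainTheorem4:
  fixes G0 :: "mat2 set set" and g :: "mat2 set"
    and \<alpha>m \<alpha>p :: "complex option" and \<gamma> :: "real \<Rightarrow> complex"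
  assumes "subgroup G0 PSL2Z"
    and "finite (rcosets\<^bsub>PSL2Z\<^esub> G0)"
    and "g \<in> G0" and "hyperbolic g"
    and "\<alpha>m \<in> P1R" and "repelling_fixed_point g \<alpha>m"
    and "\<alpha>p \<in> P1R" and "attracting_fixed_point g \<alpha>p"
    and "geodesic \<gamma>" and "geodesic_point \<gamma> (-\<infinity>) \<alpha>m" and "geodesic_point \<gamma> \<infinity> \<alpha>p"
  shows "shift_length g \<gamma> > 0 \<and>
    has_limiting_modular_symbol G0 \<gamma> \<alpha>p
      (\<lambda>\<omega>. modular_symbol G0 (Some 0) (psl_act g (Some 0)) \<omega> / of_real (shift_length g \<gamma>))"
proof -
  interpret modular_subgroup G0
    by (intro modular_subgroup.intro PSL2Z_subgroup.intro modular_subgroup_axioms.intro assms)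
  obtain A where A: "A \<in> lift_SL G0" "g = psl A" using assms(3) by (subst (asm) G_eq) auto
  have det: "det A = 1" using A by simp
  have tr: "\<bar>trace A\<bar> > 2" using assms(4) A(2) by (simp add: hyperbolic_def psl_def)
  have fp: "moebius A \<alpha>p = \<alpha>p" using assms(8) A(2) by (simp add: attracting_fixed_point_def)
  have "moebius (adj2 A) \<alpha>m = \<alpha>m"
    using assms(6) det unfolding repelling_fixed_point_def attracting_fixed_point_def A(2) by (simp add: inv_PSL2Z)
  then have fm: "moebius A \<alpha>m = \<alpha>m" using moebius_adj2(2)[OF det, of \<alpha>m] by simp
  obtain L where L: "\<And>t. mob A (\<gamma> t) = \<gamma> (t + L)"
    using geodesic_translated[OF det assms(9-11) fm fp] by blast
  have Lpos: "L > 0"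
    using translation_length_pos[OF det assms(9-11) assms(7) _ L] assms(8) A(2) by simp
  have act: "psl_act g (Some (\<gamma> t)) = Some (\<gamma> (t + L))" for t
    using geodesic_in_H[OF assms(9), of t] det by (simp add: A(2) moebius_Some L)
  have shift: "shift_length g \<gamma> = L"
    unfolding shift_length_def act option.sel geodesic_unit_speed(2)[OF assms(9)]
    by (rule the_equality) (use Lpos in auto)
  have lim: "((\<lambda>t. modular_symbol G0 (Some (\<gamma> s)) (Some (\<gamma> t)) \<omega> / of_real (hyp_dist (\<gamma> s) (\<gamma> t))) \<longlongrightarrow>
      modular_symbol G0 (Some 0) (psl_act g (Some 0)) \<omega> / of_real L) at_top" for s \<omega>
  proof (cases "\<omega> \<in> modular_differentials G0")
    case False then show ?thesis by (simp add: modular_symbol_def)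
  next
    case True
    obtain F where F: "primitive_of \<omega> F" using primitive_exists[OF True] .
    define P where "P = modular_symbol G0 (Some 0) (psl_act g (Some 0)) \<omega>"
    have P: "F (\<gamma> (t + L)) = F (\<gamma> t) + P" for t
      using symbol_period[OF True F A(1) tr geodesic_in_H[OF assms(9)], of t] by (simp add: P_def A(2) L)
    have "continuous_on UNIV (\<lambda>t. F (\<gamma> t))"
      using primitive_has_vector_derivative[OF F assms(9)] has_vector_derivative_continuous
      by (metis continuous_at_imp_continuous_on)
    then have "((\<lambda>t. (F (\<gamma> t) - F (\<gamma> s)) / of_real (t - s)) \<longlongrightarrow> P / of_real L) at_top"
      using Lpos P by (rule quasi_periodic_slope)
    moreover have "eventually (\<lambda>t. (F (\<gamma> t) - F (\<gamma> s)) / of_real (t - s) =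
        modular_symbol G0 (Some (\<gamma> s)) (Some (\<gamma> t)) \<omega> / of_real (hyp_dist (\<gamma> s) (\<gamma> t))) at_top"
      using eventually_ge_at_top[of s]
      by eventually_elim (simp add: symbol_interior[OF True F assms(9)] geodesic_unit_speed(2)[OF assms(9)])
    ultimately show ?thesis unfolding P_def by (simp add: tendsto_cong)
  qed
  have "\<alpha>p \<in> P1R - P1Q" using hyperbolic_fixed_irrational[OF det tr fp] assms(7) by blast
  moreover have "(\<lambda>\<omega>. modular_symbol G0 (Some 0) (psl_act g (Some 0)) \<omega> / of_real L) \<in> real_homology G0"
    using symbol_period_real_homology[OF A(1) tr] by (simp add: A(2))
  ultimately show ?thesis
    unfolding has_limiting_modular_symbol_def shift tendsto_fun_iff
    using Lpos assms(9,11) lim by blast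
qed

end
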